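(* Let $p\colon E\to B$ be a fibration with fiber $F$ such that $E$, $B$ and $F$ have the homotopy type of CW complexes. Fix integers $r\ge 2$ and $n\ge 1$ and a commutative ring $R$ with unity. Let $\Delta_r\colon E\to E^r_B$ be the diagonal map and $\delta_{n!}\colon E^r_B\to SP^{n!}(E^r_B)$ the diagonal embedding. Suppose $\alpha_i^*\in H^{k_i}(SP^{n!}(E^r_B);R)$ for $1\le i\le n$, where $k_i\ge 1$, and set $\alpha_i=\delta_{n!}^*(\alpha_i^* )\in H^{k_i}(E^r_B;R)$. Suppose $\Delta_r^*(\alpha_i)=0$ for all $i$. If $\alpha_1\alpha_2\cdots\alpha_n\neq 0$ (cup product), then $$\mathrm{dTC}_r[p\colon E\to B]\ge n.$$ Here $H^*$ denotes Alexander–Spanier cohomology.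
   Context: Conventions: all spaces are path-connected, fibrations are Hurewicz fibrations, sections are continuous, $I=[0,1]$, path spaces carry the compact-open topology. The total space $E$ of the fibration is a metric space. For a metric space $X$ and $k\ge 1$, $\mathcal{B}_k(X)$ is the set of probability measures on $X$ supported on at most $k$ points, with the Lévy–Prokhorov metric topology. For a fibration $p\colon E\to B$ with $E$ metric, let $E_k(p)=\{\mu\in\mathcal{B}_k(E)\mid \mathrm{supp}(\mu)\subset p^{-1}(x)\text{ for some }x\in B\}$ and $\mathcal{B}_k(p)\colon E_k(p)\to B$, $\mathcal{B}_k(p)(\mu)=x$ if $\mathrm{supp}(\mu)\subset p^{-1}(x)$. The distributional sectional category $\mathrm{dsecat}(p)$ is the smallest integer $n\geq 0$ such that $\mathcal{B}_{n+1}(p)$ admits a section. For a fibration $p\colon E\to B$ and $r\ge2$: $E^I_B=\{\gamma\in E^I\mid p\circ\gamma \text{ is constant}\}$, $E^r_B=\{(e_1,\dots,e_r)\in E^r\mid p(e_i)=p(e_j)\ \forall i,j\}$, and $\Pi_r^E\colon E^I_B\to E^r_B$ is the fibration $\gamma\mapsto(\gamma(0),\gamma(\tfrac1{r-1}),\dots,\gamma(\tfrac{r-2}{r-1}),\gamma(1))$. Define $\mathrm{dTC}_r[p\colon E\to B]:=\mathrm{dsecat}(\Pi_r^E)$. The $k$-th symmetric product $SP^k(X)$ is the orbit space of $X^k$ under the permutation action of the symmetric group $S_k$. The diagonal embedding $\delta_k\colon X\to SP^k(X)$ sends $x$ to the orbit of $(x,\dots,x)$. The diagonal map $\Delta_r\colon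 E\to E^r_B$ is $e\mapsto(e,\dots,e)$. *)

theory Defs
  imports "HOL-Probability.Probability" "HOL-Algebra.Coset"
begin

section \<open>Function spaces and Hurewicz fibrations\<close>

abbreviation unit_interval :: "real topology"
  where "unit_interval \<equiv> top_of_set {0..1}"

text \<open>Maps out of a space \<open>X\<close> are represented by functions that are \<^const>\<open>undefined\<close>
  outside \<open>topspace X\<close>.\<close>

definition compact_open_topology :: "'a topology \<Rightarrow> 'b topology \<Rightarrow> ('a \<Rightarrow> 'b) topology"
  where "compact_open_topology X Y =
    topology_generated_by
      {{f \<in> extensional (topspace X). continuous_map X Y f \<and> f ` K \<subseteq> U} |K U.
         compactin X K \<and> openin Y U}"

definition homotopy_lifting :: "'z topology \<Rightarrow> 'a topology \<Rightarrow> 'b topology \<Rightarrow> ('a \<Rightarrow> 'b) \<Rightarrow> bool"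
  where "homotopy_lifting Z E B p \<longleftrightarrow>
    (\<forall>h f. continuous_map (prod_topology Z unit_interval) B h \<and> continuous_map Z E f \<and>
           (\<forall>z\<in>topspace Z. p (f z) = h (z, 0))
       \<longrightarrow> (\<exists>H. continuous_map (prod_topology Z unit_interval) E H \<and>
                (\<forall>z\<in>topspace Z. H (z, 0) = f z) \<and>
                (\<forall>z\<in>topspace Z. \<forall>t\<in>{0..1}. p (H (z, t)) = h (z, t))))"

text \<open>HOL cannot quantify over the type of points of the test space \<open>Z\<close>.  The type used here
  contains the path space \<open>{(e, \<omega>) \<in> E \<times> B\<^sup>I. \<omega> 0 = p e}\<close>, and this makes the definition
  equivalent to homotopy lifting for test spaces over every type:
  see \<open>hurewicz_fibration_lifting\<close> below.\<close>

definition hurewicz_fibration :: "'a topology \<Rightarrow> 'b topology \<Rightarrow> ('a \<Rightarrow> 'b) \<Rightarrow> bool"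
  where "hurewicz_fibration E B p \<longleftrightarrow>
    continuous_map E B p \<and>
    (\<forall>Z :: ('a \<times> (real \<Rightarrow> 'b)) topology. homotopy_lifting Z E B p)"


lemma topspace_compact_open_topology [simp]:
  "topspace (compact_open_topology X Y) = {f \<in> extensional (topspace X). continuous_map X Y f}"
proof -
  have "\<exists>K U. compactin X K \<and> openin Y U \<and> f ` K \<subseteq> U" for f :: "'a \<Rightarrow> 'b"
    by (intro exI[of _ "{}"]) auto
  then show ?thesis
    unfolding compact_open_topology_def topology_generated_by_topspace by auto
qed

lemma openin_compact_open_topology_subbasic:
  assumes "compactin X K" "openin Y U"
  shows "openin (compact_open_topology X Y)
           {f \<in> extensional (topspace X). continuous_map X Y f \<and> f ` K \<subseteq> U}"
  unfolding compact_open_topology_def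
  by (rule topology_generated_by_Basis) (use assms in blast)

lemma mtopology_of_cfunspace:
  fixes m :: "'b metric"
  assumes X: "compact_space X" "regular_space X"
  shows "mtopology_of (cfunspace X m) = compact_open_topology X (mtopology_of m)" (is "?L = ?R")
proof (cases "topspace X = {}")
  case True
  have *: "mspace (cfunspace X m) = {\<lambda>x. undefined}"
    using True X by (subst compactin_mspace_cfunspace) (auto simp: extensional_def compact_space_def)
  then have L: "topspace ?L = {\<lambda>x. undefined}" by simp
  moreover have R: "topspace ?R = {\<lambda>x. undefined}"
    using True by (auto simp: extensional_def)
  ultimately show ?thesis
    unfolding topology_eq
    by (metis openin_empty openin_subset openin_topspace subset_singletonD)
next
  case False
  interpret C: Metric_space "mspace (cfunspace X m)" "mdist (cfunspace X m)"
    by (rule Metric_space_mspace_mdist)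
  interpret M: Metric_space "mspace m" "mdist m" by simp
  note mspace_cfunspace [simp del]
  have cX: "compactin X (topspace X)" using X by (simp add: compact_space_def)
  have L: "?L = C.mtopology" by (simp add: mtopology_of_def)
  have Mt: "mtopology_of m = M.mtopology" by (simp add: mtopology_of_def)
  have sp: "f \<in> mspace (cfunspace X m) \<longleftrightarrow> f \<in> extensional (topspace X) \<and> continuous_map X M.mtopology f" for f
    using continuous_map_image_subset_topspace[of X M.mtopology f]
    unfolding compactin_mspace_cfunspace[OF cX] Mt by auto
  have le: "mdist m (f x) (g x) \<le> mdist (cfunspace X m) f g"
    if "f \<in> mspace (cfunspace X m)" "g \<in> mspace (cfunspace X m)" "x \<in> topspace X" for f g x
    using mdist_cfunspace_imp_mdist_le[OF that(1,2) order_refl that(3)] .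
  have in_m: "f x \<in> mspace m" if "f \<in> mspace (cfunspace X m)" "x \<in> topspace X" for f x
    using that unfolding compactin_mspace_cfunspace[OF cX] by simp
  have sub: "openin ?L {f \<in> extensional (topspace X). continuous_map X (mtopology_of m) f \<and> f ` K \<subseteq> U}" (is "openin _ ?W")
    if K: "compactin X K" and U: "openin (mtopology_of m) U" for K U
  proof -
    have "\<exists>\<epsilon>>0. C.mball f \<epsilon> \<subseteq> ?W" if f: "f \<in> ?W" for f
    proof -
      have fM: "f \<in> mspace (cfunspace X m)" using f unfolding sp Mt by simp
      have Kt: "K \<subseteq> topspace X" using K compactin_subset_topspace by blast
      have cK: "compactin M.mtopology (f ` K)"
        using K f image_compactin by (metis (no_types, lifting) Mt mem_Collect_eq)
      have "\<exists>\<epsilon>>0. \<forall>x\<in>K. \<forall>y\<in>mspace m. mdist m (f x) y < \<epsilon> \<longrightarrow> y \<in> U"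
      proof -
        have "\<forall>a\<in>f ` K. \<exists>\<delta>>0. M.mball a (2*\<delta>) \<subseteq> U"
        proof
          fix a assume "a \<in> f ` K"
          then have "a \<in> U" using f by blast
          then obtain r where "r>0" "M.mball a r \<subseteq> U"
            using U unfolding Mt M.openin_mtopology by blast
          then show "\<exists>\<delta>>0. M.mball a (2*\<delta>) \<subseteq> U" by (intro exI[of _ "r/2"]) auto
        qed
        then obtain \<delta> where \<delta>: "\<And>a. a \<in> f ` K \<Longrightarrow> \<delta> a > 0 \<and> M.mball a (2 * \<delta> a) \<subseteq> U" by metis
        obtain \<F> where F: "finite \<F>" "\<F> \<subseteq> (\<lambda>a. M.mball a (\<delta> a)) ` (f ` K)" "f ` K \<subseteq> \<Union>\<F>"
        proof -
          have "\<forall>V\<in>(\<lambda>a. M.mball a (\<delta> a)) ` (f ` K). openin M.mtopology V" by auto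
          moreover have "f ` K \<subseteq> \<Union>((\<lambda>a. M.mball a (\<delta> a)) ` (f ` K))"
            using \<delta> in_m[OF fM] Kt by (force simp: M.in_mball)
          ultimately show ?thesis
            using cK that unfolding compactin_def by meson
        qed
        then obtain T where T: "finite T" "T \<subseteq> f ` K" "\<F> = (\<lambda>a. M.mball a (\<delta> a)) ` T"
          by (meson finite_subset_image)
        define \<epsilon> where "\<epsilon> = Min (insert 1 (\<delta> ` T))"
        have "\<epsilon> > 0" unfolding \<epsilon>_def using T \<delta> by (subst Min_gr_iff) auto
        moreover have "y \<in> U" if "x \<in> K" "y \<in> mspace m" "mdist m (f x) y < \<epsilon>" for x y
        proof -
          obtain a where a: "a \<in> T" "f x \<in> M.mball a (\<delta> a)" using F T \<open>x \<in> K\<close> by auto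
          have "\<epsilon> \<le> \<delta> a" unfolding \<epsilon>_def using T a by (intro Min_le) auto
          moreover have "mdist m a y \<le> mdist m a (f x) + mdist m (f x) y"
            using a that by (intro M.triangle) (auto simp: M.in_mball)
          ultimately have "y \<in> M.mball a (2 * \<delta> a)"
            using a that by (auto simp: M.in_mball)
          then show ?thesis using \<delta> a T by blast
        qed
        ultimately show ?thesis by blast
      qed
      then obtain \<epsilon> where \<epsilon>: "\<epsilon>>0" "\<And>x y. \<lbrakk>x\<in>K; y\<in>mspace m; mdist m (f x) y < \<epsilon>\<rbrakk> \<Longrightarrow> y \<in> U" by blast
      have "g \<in> ?W" if "g \<in> C.mball f \<epsilon>" for g
      proof -
        have gM: "g \<in> mspace (cfunspace X m)" and d: "mdist (cfunspace X m) f g < \<epsilon>"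
          using that by (auto simp only: C.in_mball)
        have "g x \<in> U" if "x \<in> K" for x
          using \<epsilon>(2)[OF that in_m[OF gM]] le[OF fM gM] d Kt that by fastforce
        with gM show ?thesis by (auto simp: sp Mt)
      qed
      with \<epsilon> show ?thesis by blast
    qed
    moreover have "?W \<subseteq> mspace (cfunspace X m)" by (auto simp only: sp Mt)
    ultimately show ?thesis unfolding L C.openin_mtopology by blast
  qed
  have 1: "openin ?L S" if "openin ?R S" for S
  proof (rule generate_topology_on_coarsest[OF istopology_openin])
    show "generate_topology_on {{f \<in> extensional (topspace X). continuous_map X (mtopology_of m) f \<and> f ` K \<subseteq> U} |K U.
         compactin X K \<and> openin (mtopology_of m) U} S"
      using that unfolding compact_open_topology_def openin_topology_generated_by_iff .
  qed (use sub in blast)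
  have 2: "\<exists>W. openin ?R W \<and> f \<in> W \<and> W \<subseteq> C.mball f \<epsilon>" if f: "f \<in> mspace (cfunspace X m)" and e: "\<epsilon> > 0" for f \<epsilon>
  proof -
    have fc: "continuous_map X M.mtopology f" using f sp by blast
    have "\<exists>U K. openin X U \<and> closedin X K \<and> x \<in> U \<and> U \<subseteq> K \<and> f ` K \<subseteq> M.mball (f x) (\<epsilon>/4)" if x: "x \<in> topspace X" for x
    proof -
      have o: "openin X {y \<in> topspace X. f y \<in> M.mball (f x) (\<epsilon>/4)}"
        using openin_continuous_map_preimage[OF fc] by blast
      have "x \<in> {y \<in> topspace X. f y \<in> M.mball (f x) (\<epsilon>/4)}"
        using x in_m[OF f x] e by (auto simp: M.in_mball)
      then obtain U K where "openin X U" "closedin X K" "x \<in> U" "U \<subseteq> K" "K \<subseteq> {y \<in> topspace X. f y \<in> M.mball (f x) (\<epsilon>/4)}"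
        using X(2) o unfolding neighbourhood_base_of_closedin[symmetric] neighbourhood_base_of by meson
      then show ?thesis by blast
    qed
    then obtain U K where UK: "\<And>x. x \<in> topspace X \<Longrightarrow> openin X (U x) \<and> closedin X (K x) \<and> x \<in> U x \<and> U x \<subseteq> K x \<and> f ` K x \<subseteq> M.mball (f x) (\<epsilon>/4)"
      by metis
    have "\<exists>\<F>. finite \<F> \<and> \<F> \<subseteq> U ` topspace X \<and> topspace X \<subseteq> \<Union>\<F>"
    proof -
      have "\<forall>V\<in>U ` topspace X. openin X V" "topspace X \<subseteq> \<Union>(U ` topspace X)" using UK by auto
      then show ?thesis using X(1) unfolding compact_space_alt by meson
    qed
    then obtain \<F> where F: "finite \<F>" "\<F> \<subseteq> U ` topspace X" "topspace X \<subseteq> \<Union>\<F>"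
      by meson
    then obtain T where T: "finite T" "T \<subseteq> topspace X" "\<F> = U ` T" by (meson finite_subset_image)
    define W where "W = (\<Inter>x\<in>T. {g \<in> extensional (topspace X). continuous_map X (mtopology_of m) g \<and> g ` K x \<subseteq> M.mball (f x) (\<epsilon>/4)})"
    have Tne: "T \<noteq> {}" using F T False by auto
    have "openin ?R W" unfolding W_def
    proof (rule openin_INT2[OF T(1) Tne])
      fix x assume "x \<in> T"
      then have "compactin X (K x)" using UK T(2) X(1) closedin_compact_space by blast
      then show "openin ?R {g \<in> extensional (topspace X). continuous_map X (mtopology_of m) g \<and> g ` K x \<subseteq> M.mball (f x) (\<epsilon>/4)}"
        by (rule openin_compact_open_topology_subbasic) (simp add: Mt)
    qed
    moreover have "f \<in> W" unfolding W_def using UK T(2) f by (auto simp only: sp Mt)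
    moreover have "g \<in> C.mball f \<epsilon>" if g: "g \<in> W" for g
    proof -
      have gM: "g \<in> mspace (cfunspace X m)" using g Tne unfolding W_def sp Mt by blast
      have "mdist m (f y) (g y) \<le> \<epsilon>/2" if y: "y \<in> topspace X" for y
      proof -
        obtain x where x: "x \<in> T" "y \<in> U x" using F T y by auto
        then have "f y \<in> M.mball (f x) (\<epsilon>/4)" "g y \<in> M.mball (f x) (\<epsilon>/4)"
          using UK T(2) g unfolding W_def by blast+
        then show ?thesis
          using M.triangle[of "f y" "f x" "g y"] M.commute[of "f x" "f y"] by (auto simp: M.in_mball)
      qed
      then have "mdist (cfunspace X m) f g \<le> \<epsilon>/2"
        using e by (intro mdist_cfunspace_le) auto
      then show ?thesis using f gM e by (auto simp only: C.in_mball)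
    qed
    ultimately show ?thesis by blast
  qed
  have 3: "openin ?R S" if "openin ?L S" for S
  proof (subst openin_subopen, intro ballI)
    fix f assume f: "f \<in> S"
    then obtain \<epsilon> where "\<epsilon>>0" "C.mball f \<epsilon> \<subseteq> S" "f \<in> mspace (cfunspace X m)"
      using \<open>openin ?L S\<close> unfolding L C.openin_mtopology by blast
    then show "\<exists>T. openin ?R T \<and> f \<in> T \<and> T \<subseteq> S" using 2 by (meson order_trans)
  qed
  show ?thesis unfolding topology_eq using 1 3 by blast
qed

lemma continuous_map_curry:
  assumes h: "continuous_map (prod_topology Z X) B h"
  shows "continuous_map Z (compact_open_topology X B) (\<lambda>z. \<lambda>t\<in>topspace X. h (z, t))"
  unfolding compact_open_topology_def
proof (rule continuous_on_generated_topo)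
  let ?g = "\<lambda>z. \<lambda>t\<in>topspace X. h (z, t)"
  have gc: "continuous_map X B (?g z)" if "z \<in> topspace Z" for z
  proof -
    have "continuous_map X (prod_topology Z X) (\<lambda>t. (z, t))"
      using that by (simp add: continuous_map_pairwise o_def)
    then have "continuous_map X B (h \<circ> (\<lambda>t. (z, t)))"
      using h continuous_map_compose by blast
    then show ?thesis by (rule continuous_map_eq) auto
  qed
  show "?g ` topspace Z \<subseteq> \<Union>{{f \<in> extensional (topspace X). continuous_map X B f \<and> f ` K \<subseteq> U} |K U.
           compactin X K \<and> openin B U}"
  proof
    fix f assume f: "f \<in> ?g ` topspace Z"
    then have "f \<in> {f \<in> extensional (topspace X). continuous_map X B f \<and> f ` {} \<subseteq> {}}"
      using gc by auto
    then show "f \<in> \<Union>{{f \<in> extensional (topspace X). continuous_map X B f \<and> f ` K \<subseteq> U} |K U.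
           compactin X K \<and> openin B U}"
      by (intro UnionI[rotated]) (assumption, blast intro: compactin_empty openin_empty)
  qed
  fix V assume "V \<in> {{f \<in> extensional (topspace X). continuous_map X B f \<and> f ` K \<subseteq> U} |K U.
           compactin X K \<and> openin B U}"
  then obtain K U where KU: "compactin X K" "openin B U"
    and V: "V = {f \<in> extensional (topspace X). continuous_map X B f \<and> f ` K \<subseteq> U}" by blast
  have Kt: "K \<subseteq> topspace X" using KU(1) by (rule compactin_subset_topspace)
  have "\<exists>T. openin Z T \<and> z \<in> T \<and> T \<subseteq> ?g -` V \<inter> topspace Z" if z: "z \<in> ?g -` V \<inter> topspace Z" for z
  proof -
    have o: "openin (prod_topology Z X) {y \<in> topspace (prod_topology Z X). h y \<in> U}"
      by (rule openin_continuous_map_preimage[OF h KU(2)])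
    have s: "{z} \<times> K \<subseteq> {y \<in> topspace (prod_topology Z X). h y \<in> U}"
      using z Kt V by auto
    have "compactin Z {z}" using z by simp
    then obtain T W where TW: "openin Z T" "openin X W" "{z} \<subseteq> T" "K \<subseteq> W"
        "T \<times> W \<subseteq> {y \<in> topspace (prod_topology Z X). h y \<in> U}"
      using Wallace_theorem_prod_topology[OF _ KU(1) o s] by blast
    have "T \<subseteq> ?g -` V \<inter> topspace Z"
    proof
      fix y assume y: "y \<in> T"
      then have yZ: "y \<in> topspace Z" using TW(1) openin_subset by blast
      moreover have "?g y ` K \<subseteq> U" using TW y Kt by auto
      ultimately show "y \<in> ?g -` V \<inter> topspace Z" using V gc by auto
    qed
    with TW show ?thesis by blast
  qed
  then show "openin Z (?g -` V \<inter> topspace Z)"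
    by (subst openin_subopen) blast
qed

lemma continuous_map_eval_unit_interval:
  "continuous_map (prod_topology (compact_open_topology unit_interval B) unit_interval) B (\<lambda>(\<omega>, t). \<omega> t)"
proof -
  let ?I = unit_interval and ?C = "compact_open_topology unit_interval B"
  have comp: "compact_space ?I" by (simp add: compact_space_subtopology)
  have reg: "regular_space ?I" by (simp add: regular_space_euclidean regular_space_subtopology)
  have im: "\<omega> t \<in> topspace B" if "continuous_map ?I B \<omega>" "t \<in> {0..1}" for \<omega> and t :: real
    using continuous_map_image_subset_topspace[OF that(1)] that(2) by auto
  have "openin (prod_topology ?C ?I) {x \<in> topspace (prod_topology ?C ?I). (case x of (\<omega>, t) \<Rightarrow> \<omega> t) \<in> U}"
    (is "openin _ ?S") if U: "openin B U" for U
    unfolding openin_prod_topology_alt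
  proof (intro allI impI)
    fix \<omega> t assume a: "(\<omega>, t) \<in> ?S"
    then have w: "\<omega> \<in> extensional {0..1}" "continuous_map ?I B \<omega>" "t \<in> {0..1}" "\<omega> t \<in> U" by auto
    have o: "openin ?I {s \<in> topspace ?I. \<omega> s \<in> U}"
      by (rule openin_continuous_map_preimage[OF w(2) U])
    have "t \<in> {s \<in> topspace ?I. \<omega> s \<in> U}" using w by simp
    with o obtain W K where WK: "openin ?I W" "closedin ?I K" "t \<in> W" "W \<subseteq> K" "K \<subseteq> {s \<in> topspace ?I. \<omega> s \<in> U}"
      using reg unfolding neighbourhood_base_of_closedin[symmetric] neighbourhood_base_of by meson
    have K: "compactin ?I K" using WK comp closedin_compact_space by blast
    let ?T = "{f \<in> extensional (topspace ?I). continuous_map ?I B f \<and> f ` K \<subseteq> U}"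
    have 1: "openin ?C ?T" by (rule openin_compact_open_topology_subbasic[OF K U])
    have 2: "\<omega> \<in> ?T" using w WK by auto
    have 3: "?T \<times> W \<subseteq> ?S"
    proof clarify
      fix f s assume f: "f \<in> extensional (topspace ?I)" "continuous_map ?I B f" "f ` K \<subseteq> U" and s: "s \<in> W"
      then have "s \<in> topspace ?I" using openin_subset[OF WK(1)] by blast
      then show "(f, s) \<in> topspace (prod_topology ?C ?I) \<and> f s \<in> U"
        using f s WK(4) by auto
    qed
    show "\<exists>T W. openin ?C T \<and> openin ?I W \<and> \<omega> \<in> T \<and> t \<in> W \<and> T \<times> W \<subseteq> ?S"
      by (rule exI[of _ ?T], rule exI[of _ W]) (use 1 2 3 WK(1,3) in blast)
  qed
  then show ?thesis
    unfolding continuous_map using im by (fastforce simp: case_prod_beta)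
qed

lemma hurewicz_fibration_lifting:
  fixes Z :: "'z topology"
  assumes "hurewicz_fibration E B p"
  shows "homotopy_lifting Z E B p"
  unfolding homotopy_lifting_def
proof (intro allI impI, elim conjE)
  let ?C = "compact_open_topology unit_interval B" and ?I = unit_interval
  fix h :: "'z \<times> real \<Rightarrow> 'b" and f :: "'z \<Rightarrow> 'a"
  assume h: "continuous_map (prod_topology Z ?I) B h" and f: "continuous_map Z E f"
    and hf: "\<forall>z\<in>topspace Z. p (f z) = h (z, 0)"
  define N where "N = subtopology (prod_topology E ?C) {(e, \<omega>). p e = \<omega> 0}"
  have tN: "topspace N = {(e, \<omega>). e \<in> topspace E \<and> \<omega> \<in> topspace ?C \<and> p e = \<omega> 0}"
    unfolding N_def by auto
  have "homotopy_lifting N E B p"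
    using assms by (simp add: hurewicz_fibration_def)
  moreover have "continuous_map (prod_topology N ?I) B (\<lambda>x. snd (fst x) (snd x))"
  proof -
    have "continuous_map (prod_topology N ?I) ?C (snd \<circ> fst)"
      by (rule continuous_map_compose[OF continuous_map_fst])
        (simp add: N_def continuous_map_from_subtopology continuous_map_snd)
    then have "continuous_map (prod_topology N ?I) (prod_topology ?C ?I) (\<lambda>x. ((snd \<circ> fst) x, snd x))"
      by (intro continuous_map_pairedI continuous_map_snd)
    from continuous_map_compose[OF this continuous_map_eval_unit_interval] show ?thesis
      by (simp add: o_def case_prod_beta)
  qed
  moreover have "continuous_map N E fst"
    by (simp add: N_def continuous_map_from_subtopology continuous_map_fst)
  moreover have "\<forall>z\<in>topspace N. p (fst z) = (\<lambda>x. snd (fst x) (snd x)) (z, 0)"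
    using tN by auto
  ultimately obtain H where H: "continuous_map (prod_topology N ?I) E H"
      "\<forall>z\<in>topspace N. H (z, 0) = fst z"
      "\<forall>z\<in>topspace N. \<forall>t\<in>{0..1}. p (H (z, t)) = (\<lambda>x. snd (fst x) (snd x)) (z, t)"
    unfolding homotopy_lifting_def by blast
  define g where "g z = (f z, \<lambda>t\<in>topspace ?I. h (z, t))" for z
  have "continuous_map Z (prod_topology E ?C) g"
    unfolding g_def by (intro continuous_map_pairedI f continuous_map_curry h)
  moreover have gN: "g z \<in> {(e, \<omega>). p e = \<omega> 0}" if "z \<in> topspace Z" for z
    using that hf by (simp add: g_def)
  ultimately have g: "continuous_map Z N g"
    unfolding N_def by (simp add: continuous_map_in_subtopology image_subset_iff)
  then have gt: "g z \<in> topspace N" if "z \<in> topspace Z" for z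
    using that continuous_map_image_subset_topspace by blast
  have "continuous_map (prod_topology Z ?I) (prod_topology N ?I) (\<lambda>x. (g (fst x), snd x))"
    by (intro continuous_map_pairedI continuous_map_snd)
      (use continuous_map_compose[OF continuous_map_fst g] in \<open>simp add: o_def\<close>)
  from continuous_map_compose[OF this H(1)]
  have "continuous_map (prod_topology Z ?I) E (\<lambda>x. H (g (fst x), snd x))" by (simp add: o_def)
  moreover have "\<forall>z\<in>topspace Z. H (g z, 0) = f z" using H(2) gt by (simp add: g_def)
  moreover have "\<forall>z\<in>topspace Z. \<forall>t\<in>{0..1}. p (H (g z, t)) = h (z, t)"
  proof (intro ballI)
    fix z and t :: real assume z: "z \<in> topspace Z" and t: "t \<in> {0..1}"
    then have "p (H (g z, t)) = (\<lambda>x. snd (fst x) (snd x)) (g z, t)" using H(3) gt by blast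
    then show "p (H (g z, t)) = h (z, t)" using t by (simp add: g_def)
  qed
  ultimately show "\<exists>H. continuous_map (prod_topology Z ?I) E H \<and> (\<forall>z\<in>topspace Z. H (z, 0) = f z) \<and>
             (\<forall>z\<in>topspace Z. \<forall>t\<in>{0..1}. p (H (z, t)) = h (z, t))"
    by (intro exI[of _ "\<lambda>x. H (g (fst x), snd x)"]) auto
qed


section \<open>CW complexes\<close>

definition disk :: "nat \<Rightarrow> (nat \<Rightarrow> real) set"
  where "disk n = {x \<in> topspace (Euclidean_space n). (\<Sum>i<n. (x i)\<^sup>2) \<le> 1}"

definition open_disk :: "nat \<Rightarrow> (nat \<Rightarrow> real) set"
  where "open_disk n = {x \<in> topspace (Euclidean_space n). (\<Sum>i<n. (x i)\<^sup>2) < 1}"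

text \<open>\<open>cells n\<close> is the set of open \<open>n\<close>-cells; the last two conjuncts are closure-finiteness
  (part of the condition on the characteristic maps \<open>\<Phi>\<close>) and the weak topology.\<close>

definition CW_complex :: "'a topology \<Rightarrow> bool"
  where "CW_complex X \<longleftrightarrow>
    Hausdorff_space X \<and>
    (\<exists>cells :: nat \<Rightarrow> 'a set set.
       pairwise disjnt (\<Union>n. cells n) \<and>
       \<Union>(\<Union>n. cells n) = topspace X \<and>
       (\<forall>n. \<forall>c\<in>cells n. \<exists>\<Phi>.
          continuous_map (subtopology (Euclidean_space n) (disk n)) X \<Phi> \<and>
          homeomorphic_map (subtopology (Euclidean_space n) (open_disk n)) (subtopology X c) \<Phi> \<and>
          (\<exists>\<F>. finite \<F> \<and> \<F> \<subseteq> (\<Union>m<n. cells m) \<and> \<Phi> ` (disk n - open_disk n) \<subseteq> \<Union>\<F>)) \<and>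
       (\<forall>A. A \<subseteq> topspace X \<longrightarrow>
          (closedin X A \<longleftrightarrow> (\<forall>c\<in>(\<Union>n. cells n). closedin X (A \<inter> X closure_of c)))))"


section \<open>Symmetric products\<close>

definition quotient_topology :: "'a topology \<Rightarrow> ('a \<Rightarrow> 'b) \<Rightarrow> 'b topology"
  where "quotient_topology X q =
    topology (\<lambda>U. U \<subseteq> q ` topspace X \<and> openin X {x \<in> topspace X. q x \<in> U})"

lemma istopology_quotient:
  "istopology (\<lambda>U. U \<subseteq> q ` topspace X \<and> openin X {x \<in> topspace X. q x \<in> U})"
proof -
  have eq1: "{x \<in> topspace X. q x \<in> S \<inter> T} = {x \<in> topspace X. q x \<in> S} \<inter> {x \<in> topspace X. q x \<in> T}" for S T
    by auto
  have eq2: "{x \<in> topspace X. q x \<in> \<Union>\<K>} = \<Union>((\<lambda>K. {x \<in> topspace X. q x \<in> K}) ` \<K>)" for \<K>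
    by auto
  show ?thesis
    unfolding istopology_def eq1 eq2 by (auto intro!: openin_Int openin_Union)
qed

lemma openin_quotient_topology:
  "openin (quotient_topology X q) U \<longleftrightarrow> U \<subseteq> q ` topspace X \<and> openin X {x \<in> topspace X. q x \<in> U}"
  unfolding quotient_topology_def by (subst topology_inverse'[OF istopology_quotient]) simp

lemma topspace_quotient_topology [simp]: "topspace (quotient_topology X q) = q ` topspace X"
proof -
  have "{x \<in> topspace X. q x \<in> q ` topspace X} = topspace X" by auto
  then have "openin (quotient_topology X q) (q ` topspace X)"
    by (simp add: openin_quotient_topology)
  then show ?thesis
    by (metis openin_quotient_topology openin_subset openin_topspace subset_antisym)
qed

lemma quotient_map_quotient_topology: "quotient_map X (quotient_topology X q) q"
  by (simp add: quotient_map_def openin_quotient_topology)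

definition permutation_orbit :: "nat \<Rightarrow> (nat \<Rightarrow> 'a) \<Rightarrow> (nat \<Rightarrow> 'a) set"
  where "permutation_orbit k x = {x \<circ> \<sigma> |\<sigma>. \<sigma> permutes {..<k}}"

definition symmetric_product :: "nat \<Rightarrow> 'a topology \<Rightarrow> (nat \<Rightarrow> 'a) set topology"
  where "symmetric_product k X =
    quotient_topology (product_topology (\<lambda>_. X) {..<k}) (permutation_orbit k)"

definition symmetric_diagonal :: "nat \<Rightarrow> 'a \<Rightarrow> (nat \<Rightarrow> 'a) set"
  where "symmetric_diagonal k x = permutation_orbit k (\<lambda>i\<in>{..<k}. x)"


section \<open>Distributional sectional category\<close>

text \<open>A probability measure supported on finitely many points is discrete, so it is represented by
  an element of type \<open>'a pmf\<close>; its support is \<^const>\<open>set_pmf\<close>.\<close>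

definition Levy_Prokhorov_dist :: "'a metric \<Rightarrow> 'a pmf \<Rightarrow> 'a pmf \<Rightarrow> real"
  where "Levy_Prokhorov_dist m \<mu> \<nu> =
    Inf {\<epsilon>. \<epsilon> > 0 \<and>
         (\<forall>A \<in> sigma_sets (mspace m) {U. openin (mtopology_of m) U}.
            measure_pmf.prob \<mu> A \<le> measure_pmf.prob \<nu> (\<Union>a\<in>A. mball_of m a \<epsilon>) + \<epsilon> \<and>
            measure_pmf.prob \<nu> A \<le> measure_pmf.prob \<mu> (\<Union>a\<in>A. mball_of m a \<epsilon>) + \<epsilon>)}"

definition fin_supp_measures :: "nat \<Rightarrow> 'a metric \<Rightarrow> 'a pmf metric"
  where "fin_supp_measures k m =
    metric ({\<mu>. set_pmf \<mu> \<subseteq> mspace m \<and> finite (set_pmf \<mu>) \<and> card (set_pmf \<mu>) \<le> k},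
            Levy_Prokhorov_dist m)"

definition fibrewise_measures :: "nat \<Rightarrow> 'a metric \<Rightarrow> 'b topology \<Rightarrow> ('a \<Rightarrow> 'b) \<Rightarrow> 'a pmf topology"
  where "fibrewise_measures k E B p =
    subtopology (mtopology_of (fin_supp_measures k E))
      {\<mu>. \<exists>x\<in>topspace B. set_pmf \<mu> \<subseteq> {e \<in> mspace E. p e = x}}"

definition fibrewise_measures_proj :: "'b topology \<Rightarrow> ('a \<Rightarrow> 'b) \<Rightarrow> 'a pmf \<Rightarrow> 'b"
  where "fibrewise_measures_proj B p \<mu> = (THE x. x \<in> topspace B \<and> set_pmf \<mu> \<subseteq> p -` {x})"

definition admits_section :: "'a topology \<Rightarrow> 'b topology \<Rightarrow> ('a \<Rightarrow> 'b) \<Rightarrow> bool"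
  where "admits_section X Y q \<longleftrightarrow>
    (\<exists>s. continuous_map Y X s \<and> (\<forall>y\<in>topspace Y. q (s y) = y))"

text \<open>The value is \<open>\<infinity>\<close> if there is no \<open>n\<close> such that a section exists.\<close>

definition dsecat :: "'a metric \<Rightarrow> 'b topology \<Rightarrow> ('a \<Rightarrow> 'b) \<Rightarrow> enat"
  where "dsecat E B p =
    Inf {enat n |n. admits_section (fibrewise_measures (n + 1) E B p) B
                      (fibrewise_measures_proj B p)}"


lemma Metric_space_Levy_Prokhorov:
  "Metric_space {\<mu>. set_pmf \<mu> \<subseteq> mspace m \<and> finite (set_pmf \<mu>) \<and> card (set_pmf \<mu>) \<le> k}
     (Levy_Prokhorov_dist m)"
proof -
  let ?P = "measure_pmf.prob"
  define nb where "nb \<epsilon> A = (\<Union>a\<in>A. mball_of m a \<epsilon>)" for \<epsilon> A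
  define Bo where "Bo = sigma_sets (mspace m) {U. openin (mtopology_of m) U}"
  define S where "S \<mu> \<nu> = {\<epsilon>. \<epsilon> > 0 \<and> (\<forall>A\<in>Bo. ?P \<mu> A \<le> ?P \<nu> (nb \<epsilon> A) + \<epsilon> \<and> ?P \<nu> A \<le> ?P \<mu> (nb \<epsilon> A) + \<epsilon>)}" for \<mu> \<nu>
  have LP: "Levy_Prokhorov_dist m \<mu> \<nu> = Inf (S \<mu> \<nu>)" for \<mu> \<nu>
    by (simp add: Levy_Prokhorov_dist_def S_def nb_def Bo_def)
  interpret M: Metric_space "mspace m" "mdist m" by simp
  have Bosub: "A \<subseteq> mspace m" if "A \<in> Bo" for A
  proof -
    have "{U. openin (mtopology_of m) U} \<subseteq> Pow (mspace m)"
      using openin_subset by fastforce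
    then show ?thesis using that sigma_sets_into_sp unfolding Bo_def by blast
  qed
  have nbBo: "nb \<epsilon> A \<in> Bo" for \<epsilon> A
    unfolding nb_def Bo_def
    by (intro sigma_sets.Basic) (auto simp: mtopology_of_def mball_of_def intro!: openin_Union)
  have sgBo: "{x} \<in> Bo" if "x \<in> mspace m" for x
  proof -
    have "openin (mtopology_of m) (mspace m - {x})"
      using M.t1_space_mtopology that t1_space_openin_delete_alt
      by (metis M.topspace_mtopology mtopology_of_def openin_topspace)
    then have "mspace m - (mspace m - {x}) \<in> Bo"
      unfolding Bo_def by (intro sigma_sets.Compl sigma_sets.Basic) simp
    moreover have "mspace m - (mspace m - {x}) = {x}" using that by auto
    ultimately show ?thesis by simp
  qed
  have one: "1 \<in> S \<mu> \<nu>" for \<mu> \<nu>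
  proof -
    have "?P \<mu> A \<le> ?P \<nu> B + 1" for \<mu> \<nu> :: "'a pmf" and A B
      using measure_pmf.prob_le_1[of \<mu> A] measure_nonneg[of "measure_pmf \<nu>" B] by linarith
    then show ?thesis by (simp add: S_def)
  qed
  have bdd: "bdd_below (S \<mu> \<nu>)" for \<mu> \<nu>
    unfolding S_def by (intro bdd_belowI[of _ 0]) auto
  have nonneg: "0 \<le> Inf (S \<mu> \<nu>)" for \<mu> \<nu>
  proof (rule cInf_greatest)
    show "S \<mu> \<nu> \<noteq> {}" using one[of \<mu> \<nu>] by blast
  qed (auto simp: S_def)
  have comm: "S \<mu> \<nu> = S \<nu> \<mu>" for \<mu> \<nu>
    unfolding S_def by blast
  have refl: "\<epsilon> \<in> S \<mu> \<mu>" if "\<epsilon> > 0" for \<epsilon> \<mu>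
  proof -
    have "?P \<mu> A \<le> ?P \<mu> (nb \<epsilon> A) + \<epsilon>" if "A \<in> Bo" for A
    proof -
      have "A \<subseteq> nb \<epsilon> A" using Bosub[OF that] \<open>\<epsilon> > 0\<close> by (force simp: nb_def)
      then have "?P \<mu> A \<le> ?P \<mu> (nb \<epsilon> A)" by (intro measure_pmf.finite_measure_mono) auto
      then show ?thesis using \<open>\<epsilon> > 0\<close> by linarith
    qed
    then show ?thesis using that by (simp add: S_def)
  qed
  have tri: "\<epsilon> + \<delta> \<in> S \<mu> \<rho>" if e: "\<epsilon> \<in> S \<mu> \<nu>" and d: "\<delta> \<in> S \<nu> \<rho>" for \<epsilon> \<delta> \<mu> \<nu> \<rho>
  proof -
    have nn: "nb \<delta> (nb \<epsilon> A) \<subseteq> nb (\<epsilon> + \<delta>) A" for \<epsilon> \<delta> A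
    proof
      fix y assume "y \<in> nb \<delta> (nb \<epsilon> A)"
      then obtain a b where "a \<in> A" "b \<in> mball_of m a \<epsilon>" "y \<in> mball_of m b \<delta>" by (auto simp: nb_def)
      moreover then have "mdist m a y \<le> mdist m a b + mdist m b y"
        by (intro M.triangle) auto
      ultimately show "y \<in> nb (\<epsilon> + \<delta>) A" by (auto simp: nb_def intro!: bexI[of _ a])
    qed
    have "?P \<mu> A \<le> ?P \<rho> (nb (\<epsilon> + \<delta>) A) + (\<epsilon> + \<delta>)"
      if A: "A \<in> Bo" and e: "\<epsilon> \<in> S \<mu> \<nu>" and d: "\<delta> \<in> S \<nu> \<rho>" for \<epsilon> \<delta> \<mu> \<nu> \<rho> A
    proof -
      have "?P \<mu> A \<le> ?P \<nu> (nb \<epsilon> A) + \<epsilon>" using e A by (simp add: S_def)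
      moreover have "?P \<nu> (nb \<epsilon> A) \<le> ?P \<rho> (nb \<delta> (nb \<epsilon> A)) + \<delta>"
        using d nbBo[of \<epsilon> A] unfolding S_def by blast
      moreover have "?P \<rho> (nb \<delta> (nb \<epsilon> A)) \<le> ?P \<rho> (nb (\<epsilon> + \<delta>) A)"
        by (intro measure_pmf.finite_measure_mono nn) auto
      ultimately show ?thesis by linarith
    qed
    from this[OF _ e d] this[OF _ d[unfolded comm[of \<nu> \<rho>]] e[unfolded comm[of \<mu> \<nu>]]]
    have "\<forall>A\<in>Bo. ?P \<mu> A \<le> ?P \<rho> (nb (\<epsilon> + \<delta>) A) + (\<epsilon> + \<delta>) \<and> ?P \<rho> A \<le> ?P \<mu> (nb (\<epsilon> + \<delta>) A) + (\<epsilon> + \<delta>)"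
      by (simp add: add.commute)
    then show ?thesis using e d by (simp add: S_def)
  qed
  have less: "\<exists>\<delta>\<in>S \<mu> \<nu>. \<delta> < \<epsilon>" if "Inf (S \<mu> \<nu>) < \<epsilon>" for \<mu> \<nu> \<epsilon>
    using that one[of \<mu> \<nu>] bdd[of \<mu> \<nu>] cInf_less_iff[of "S \<mu> \<nu>" \<epsilon>] by blast
  have eqI: "pmf \<mu> x \<le> pmf \<nu> x" if z: "Inf (S \<mu> \<nu>) = 0" and fin: "finite (set_pmf \<nu>)" and x: "x \<in> mspace m" for \<mu> \<nu> x
  proof (rule field_le_epsilon)
    fix \<epsilon> :: real assume e: "\<epsilon> > 0"
    define D where "D = insert \<epsilon> (mdist m x ` (set_pmf \<nu> \<inter> mspace m - {x}))"
    have D: "finite D" "D \<noteq> {}" using fin by (auto simp: D_def)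
    have "Min D > 0" unfolding Min_gr_iff[OF D] using e x
      by (auto simp: D_def order_less_le)
    then obtain \<delta> where d: "\<delta> \<in> S \<mu> \<nu>" "\<delta> < Min D" using less[of \<mu> \<nu> "Min D"] z by auto
    have de: "\<delta> < \<epsilon>" using d(2) unfolding Min_gr_iff[OF D] by (auto simp: D_def)
    have sub: "nb \<delta> {x} \<inter> set_pmf \<nu> \<subseteq> {x}"
      using d(2) unfolding Min_gr_iff[OF D] by (force simp: D_def nb_def)
    have "?P \<mu> {x} \<le> ?P \<nu> (nb \<delta> {x}) + \<delta>" using d(1) sgBo[OF x] by (simp add: S_def)
    also have "?P \<nu> (nb \<delta> {x}) = ?P \<nu> (nb \<delta> {x} \<inter> set_pmf \<nu>)" by (simp add: measure_Int_set_pmf)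
    also have "\<dots> \<le> ?P \<nu> {x}" by (intro measure_pmf.finite_measure_mono sub) auto
    finally show "pmf \<mu> x \<le> pmf \<nu> x + \<epsilon>" using de by (simp add: measure_pmf_single)
  qed
  show ?thesis
    unfolding LP
  proof (unfold_locales)
    show "0 \<le> Inf (S \<mu> \<nu>)" for \<mu> \<nu> by (rule nonneg)
    show "Inf (S \<mu> \<nu>) = Inf (S \<nu> \<mu>)" for \<mu> \<nu> by (simp add: comm)
    show "Inf (S \<mu> \<nu>) = 0 \<longleftrightarrow> \<mu> = \<nu>"
      if m: "\<mu> \<in> {\<mu>. set_pmf \<mu> \<subseteq> mspace m \<and> finite (set_pmf \<mu>) \<and> card (set_pmf \<mu>) \<le> k}"
        and n: "\<nu> \<in> {\<mu>. set_pmf \<mu> \<subseteq> mspace m \<and> finite (set_pmf \<mu>) \<and> card (set_pmf \<mu>) \<le> k}" for \<mu> \<nu>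
    proof
      assume z: "Inf (S \<mu> \<nu>) = 0"
      show "\<mu> = \<nu>"
      proof (rule pmf_eqI)
        fix x show "pmf \<mu> x = pmf \<nu> x"
        proof (cases "x \<in> mspace m")
          case True
          then show ?thesis
            using eqI[of \<mu> \<nu> x] eqI[of \<nu> \<mu> x] z m n by (auto simp: comm[of \<nu> \<mu>])
        next
          case False
          then have "x \<notin> set_pmf \<mu>" "x \<notin> set_pmf \<nu>" using m n by auto
          then show ?thesis by (simp add: set_pmf_iff)
        qed
      qed
    next
      assume "\<mu> = \<nu>"
      have "Inf (S \<mu> \<mu>) \<le> 0"
        by (rule field_le_epsilon) (use refl bdd cInf_lower in fastforce)
      with nonneg[of \<mu> \<mu>] \<open>\<mu> = \<nu>\<close> show "Inf (S \<mu> \<nu>) = 0" by auto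
    qed
    show "Inf (S \<mu> \<rho>) \<le> Inf (S \<mu> \<nu>) + Inf (S \<nu> \<rho>)" for \<mu> \<nu> \<rho>
    proof (rule field_le_epsilon)
      fix e :: real assume "e > 0"
      then obtain a b where "a \<in> S \<mu> \<nu>" "a < Inf (S \<mu> \<nu>) + e/2" "b \<in> S \<nu> \<rho>" "b < Inf (S \<nu> \<rho>) + e/2"
        using less[of \<mu> \<nu> "Inf (S \<mu> \<nu>) + e/2"] less[of \<nu> \<rho> "Inf (S \<nu> \<rho>) + e/2"] by auto
      moreover then have "Inf (S \<mu> \<rho>) \<le> a + b" using tri bdd cInf_lower by meson
      ultimately show "Inf (S \<mu> \<rho>) \<le> Inf (S \<mu> \<nu>) + Inf (S \<nu> \<rho>) + e" by linarith
    qed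
  qed
qed

lemma mspace_fin_supp_measures [simp]:
  "mspace (fin_supp_measures k m) =
     {\<mu>. set_pmf \<mu> \<subseteq> mspace m \<and> finite (set_pmf \<mu>) \<and> card (set_pmf \<mu>) \<le> k}"
  unfolding fin_supp_measures_def by (rule Metric_space.mspace_metric[OF Metric_space_Levy_Prokhorov])

lemma mdist_fin_supp_measures [simp]: "mdist (fin_supp_measures k m) = Levy_Prokhorov_dist m"
  unfolding fin_supp_measures_def by (rule Metric_space.mdist_metric[OF Metric_space_Levy_Prokhorov])

lemma fibrewise_measures_proj_eq:
  assumes "x \<in> topspace B" "set_pmf \<mu> \<subseteq> p -` {x}"
  shows "fibrewise_measures_proj B p \<mu> = x"
  unfolding fibrewise_measures_proj_def
proof (rule the_equality)
  obtain e where "e \<in> set_pmf \<mu>" using set_pmf_not_empty[of \<mu>] by blast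
  then show "y = x" if "y \<in> topspace B \<and> set_pmf \<mu> \<subseteq> p -` {y}" for y
    using assms that by auto
qed (use assms in simp)


section \<open>Distributional parametrized topological complexity\<close>

text \<open>\<open>E\<^sup>I\<^sub>B\<close> with the supremum metric, whose topology is the compact-open topology:
  see \<open>mtopology_of_fibrewise_path_space\<close> below.\<close>

definition fibrewise_path_space :: "'a metric \<Rightarrow> ('a \<Rightarrow> 'b) \<Rightarrow> (real \<Rightarrow> 'a) metric"
  where "fibrewise_path_space E p =
    submetric (cfunspace unit_interval E) {\<gamma>. (p \<circ> \<gamma>) constant_on {0..1}}"

definition fibrewise_power :: "nat \<Rightarrow> 'a topology \<Rightarrow> ('a \<Rightarrow> 'b) \<Rightarrow> (nat \<Rightarrow> 'a) topology"
  where "fibrewise_power r E p =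
    subtopology (product_topology (\<lambda>_. E) {..<r}) {e. \<forall>i<r. \<forall>j<r. p (e i) = p (e j)}"

definition fibrewise_diagonal :: "nat \<Rightarrow> 'a \<Rightarrow> nat \<Rightarrow> 'a"
  where "fibrewise_diagonal r e = (\<lambda>i\<in>{..<r}. e)"

definition path_evaluation :: "nat \<Rightarrow> (real \<Rightarrow> 'a) \<Rightarrow> nat \<Rightarrow> 'a"
  where "path_evaluation r \<gamma> = (\<lambda>i\<in>{..<r}. \<gamma> (real i / real (r - 1)))"

definition dTC :: "nat \<Rightarrow> 'a metric \<Rightarrow> ('a \<Rightarrow> 'b) \<Rightarrow> enat"
  where "dTC r E p =
    dsecat (fibrewise_path_space E p) (fibrewise_power r (mtopology_of E) p) (path_evaluation r)"


lemma mtopology_of_fibrewise_path_space: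
  "mtopology_of (fibrewise_path_space E p) =
     subtopology (compact_open_topology unit_interval (mtopology_of E))
       {\<gamma>. (p \<circ> \<gamma>) constant_on {0..1}}"
proof -
  have "compact_space unit_interval" by (simp add: compact_space_subtopology)
  moreover have "regular_space unit_interval"
    by (simp add: regular_space_euclidean regular_space_subtopology)
  ultimately show ?thesis
    by (simp add: fibrewise_path_space_def mtopology_of_submetric mtopology_of_cfunspace)
qed


section \<open>Alexander--Spanier cohomology\<close>

definition AS_tuples :: "nat \<Rightarrow> 'a topology \<Rightarrow> 'a list set"
  where "AS_tuples q X = {xs. length xs = Suc q \<and> set xs \<subseteq> topspace X}"

text \<open>Functions \<open>X\<^sup>q\<^sup>+\<^sup>1 \<rightarrow> R\<close>, extended by \<open>0\<close>.\<close>

definition AS_cochains :: "nat \<Rightarrow> 'a topology \<Rightarrow> ('a list \<Rightarrow> 'r::comm_ring_1) set"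
  where "AS_cochains q X = {\<phi>. \<forall>xs. xs \<notin> AS_tuples q X \<longrightarrow> \<phi> xs = 0}"

definition AS_locally_zero :: "nat \<Rightarrow> 'a topology \<Rightarrow> ('a list \<Rightarrow> 'r::comm_ring_1) set"
  where "AS_locally_zero q X =
    {\<phi> \<in> AS_cochains q X. \<exists>\<U>. (\<forall>U\<in>\<U>. openin X U) \<and> topspace X = \<Union>\<U> \<and>
       (\<forall>U\<in>\<U>. \<forall>xs. length xs = Suc q \<and> set xs \<subseteq> U \<longrightarrow> \<phi> xs = 0)}"

definition AS_coboundary :: "nat \<Rightarrow> 'a topology \<Rightarrow> ('a list \<Rightarrow> 'r) \<Rightarrow> 'a list \<Rightarrow> 'r::comm_ring_1"
  where "AS_coboundary q X \<phi> xs =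
    (if xs \<in> AS_tuples (Suc q) X
     then \<Sum>i\<le>Suc q. (-1) ^ i * \<phi> (take i xs @ drop (Suc i) xs) else 0)"

text \<open>The Alexander--Spanier complex is the quotient of the cochains by the locally zero ones.
  Its cocycles and coboundaries are given by their preimages in the cochains, so that
  \<open>AS_cohomology q X\<close> is the cohomology of the quotient complex through the canonical
  isomorphism \<open>(Z/C\<^sub>0)/(B/C\<^sub>0) = Z/B\<close>.\<close>

definition AS_cocycles :: "nat \<Rightarrow> 'a topology \<Rightarrow> ('a list \<Rightarrow> 'r::comm_ring_1) set"
  where "AS_cocycles q X =
    {\<phi> \<in> AS_cochains q X. AS_coboundary q X \<phi> \<in> AS_locally_zero (Suc q) X}"

definition AS_coboundaries :: "nat \<Rightarrow> 'a topology \<Rightarrow> ('a list \<Rightarrow> 'r::comm_ring_1) set"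
  where "AS_coboundaries q X =
    {(\<lambda>xs. \<zeta> xs + \<beta> xs) |\<zeta> \<beta>. \<zeta> \<in> AS_locally_zero q X \<and>
       \<beta> \<in> (case q of 0 \<Rightarrow> {\<lambda>_. 0} | Suc q' \<Rightarrow> AS_coboundary q' X ` AS_cochains q' X)}"

definition AS_cocycle_group :: "nat \<Rightarrow> 'a topology \<Rightarrow> ('a list \<Rightarrow> 'r::comm_ring_1) monoid"
  where "AS_cocycle_group q X =
    \<lparr>carrier = AS_cocycles q X, monoid.mult = (\<lambda>\<phi> \<psi> xs. \<phi> xs + \<psi> xs), one = (\<lambda>_. 0)\<rparr>"

text \<open>The additive group of \<open>H\<^sup>q(X; R)\<close> in the multiplicative notation of \<^typ>\<open>'a monoid\<close>:
  the zero class is \<open>\<one>\<^bsub>AS_cohomology q X\<^esub>\<close>.  The ring of coefficients is the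
  type \<open>'r\<close>.\<close>

definition AS_cohomology :: "nat \<Rightarrow> 'a topology \<Rightarrow> ('a list \<Rightarrow> 'r::comm_ring_1) set monoid"
  where "AS_cohomology q X = AS_cocycle_group q X Mod AS_coboundaries q X"

definition AS_class :: "nat \<Rightarrow> 'a topology \<Rightarrow> ('a list \<Rightarrow> 'r::comm_ring_1) \<Rightarrow> ('a list \<Rightarrow> 'r) set"
  where "AS_class q X \<phi> = AS_coboundaries q X #>\<^bsub>AS_cocycle_group q X\<^esub> \<phi>"

definition AS_pullback_cochain ::
    "nat \<Rightarrow> 'a topology \<Rightarrow> ('a \<Rightarrow> 'b) \<Rightarrow> ('b list \<Rightarrow> 'r) \<Rightarrow> 'a list \<Rightarrow> 'r::comm_ring_1"
  where "AS_pullback_cochain q X f \<phi> xs = (if xs \<in> AS_tuples q X then \<phi> (map f xs) else 0)"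

text \<open>\<open>f\<^sup>* : H\<^sup>q(Y; R) \<rightarrow> H\<^sup>q(X; R)\<close> for \<open>f : X \<rightarrow> Y\<close>, and the cup product, are defined on all
  representatives at once; see \<open>AS_pullback_class\<close> and \<open>AS_cup_class\<close> below.\<close>

definition AS_pullback ::
    "nat \<Rightarrow> 'a topology \<Rightarrow> ('a \<Rightarrow> 'b) \<Rightarrow> ('b list \<Rightarrow> 'r) set \<Rightarrow> ('a list \<Rightarrow> 'r::comm_ring_1) set"
  where "AS_pullback q X f a = (\<Union>\<phi>\<in>a. AS_class q X (AS_pullback_cochain q X f \<phi>))"

definition AS_cup_cochain ::
    "nat \<Rightarrow> ('a list \<Rightarrow> 'r) \<Rightarrow> ('a list \<Rightarrow> 'r) \<Rightarrow> 'a list \<Rightarrow> 'r::comm_ring_1"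
  where "AS_cup_cochain p \<phi> \<psi> xs = \<phi> (take (Suc p) xs) * \<psi> (drop p xs)"

definition AS_cup ::
    "nat \<Rightarrow> nat \<Rightarrow> 'a topology \<Rightarrow> ('a list \<Rightarrow> 'r) set \<Rightarrow> ('a list \<Rightarrow> 'r) set \<Rightarrow>
     ('a list \<Rightarrow> 'r::comm_ring_1) set"
  where "AS_cup p q X a b = (\<Union>\<phi>\<in>a. \<Union>\<psi>\<in>b. AS_class (p + q) X (AS_cup_cochain p \<phi> \<psi>))"

definition AS_unit :: "'a topology \<Rightarrow> ('a list \<Rightarrow> 'r::comm_ring_1) set"
  where "AS_unit X = AS_class 0 X (\<lambda>xs. if xs \<in> AS_tuples 0 X then 1 else 0)"

text \<open>The product \<open>a 1 \<smile> \<dots> \<smile> a n\<close> of classes \<open>a i\<close> of degree \<open>k i\<close>.\<close>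

primrec AS_cup_prod ::
    "'a topology \<Rightarrow> (nat \<Rightarrow> nat) \<Rightarrow> (nat \<Rightarrow> ('a list \<Rightarrow> 'r) set) \<Rightarrow> nat \<Rightarrow>
     ('a list \<Rightarrow> 'r::comm_ring_1) set"
  where
    "AS_cup_prod X k a 0 = AS_unit X"
  | "AS_cup_prod X k a (Suc n) =
       AS_cup (\<Sum>i=1..n. k i) (k (Suc n)) X (AS_cup_prod X k a n) (a (Suc n))"

lemma AS_cochains_lincomb:
  assumes "\<phi> \<in> AS_cochains q X" "\<psi> \<in> AS_cochains q X"
  shows "(\<lambda>xs. \<phi> xs + c * \<psi> xs) \<in> AS_cochains q X"
  using assms by (simp add: AS_cochains_def)

lemma AS_cochains_zero: "(\<lambda>_. 0) \<in> AS_cochains q X"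
  by (simp add: AS_cochains_def)

lemma AS_locally_zeroI:
  assumes "\<phi> \<in> AS_cochains q X" "\<And>U. U \<in> \<U> \<Longrightarrow> openin X U" "topspace X = \<Union>\<U>"
    "\<And>U xs. \<lbrakk>U \<in> \<U>; length xs = Suc q; set xs \<subseteq> U\<rbrakk> \<Longrightarrow> \<phi> xs = 0"
  shows "\<phi> \<in> AS_locally_zero q X"
  unfolding AS_locally_zero_def
  by (intro CollectI conjI exI[of _ \<U>]) (use assms in simp_all)

lemma AS_locally_zeroD:
  assumes "\<phi> \<in> AS_locally_zero q X"
  shows "\<exists>\<U>. (\<forall>U\<in>\<U>. openin X U) \<and> topspace X = \<Union>\<U> \<and>
       (\<forall>U xs. U \<in> \<U> \<longrightarrow> length xs = Suc q \<longrightarrow> set xs \<subseteq> U \<longrightarrow> \<phi> xs = 0)"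
  using assms by (auto simp only: AS_locally_zero_def mem_Collect_eq)

lemma AS_locally_zero_lincomb:
  assumes "\<phi> \<in> AS_locally_zero q X" "\<psi> \<in> AS_locally_zero q X"
  shows "(\<lambda>xs. \<phi> xs + c * \<psi> xs) \<in> AS_locally_zero q X"
proof -
  obtain \<U> where U': "\<forall>U\<in>\<U>. openin X U" and U2: "topspace X = \<Union>\<U>"
    and U3: "\<forall>U xs. U \<in> \<U> \<longrightarrow> length xs = Suc q \<longrightarrow> set xs \<subseteq> U \<longrightarrow> \<phi> xs = 0"
    using AS_locally_zeroD[OF assms(1)] by (elim exE conjE) (rule that)
  note U = U'[rule_format] U2 U3[rule_format]
  obtain \<V> where V': "\<forall>U\<in>\<V>. openin X U" and V2: "topspace X = \<Union>\<V>"
    and V3: "\<forall>U xs. U \<in> \<V> \<longrightarrow> length xs = Suc q \<longrightarrow> set xs \<subseteq> U \<longrightarrow> \<psi> xs = 0"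
    using AS_locally_zeroD[OF assms(2)] by (elim exE conjE) (rule that)
  note V = V'[rule_format] V2 V3[rule_format]
  let ?W = "{U \<inter> V |U V. U \<in> \<U> \<and> V \<in> \<V>}"
  show ?thesis
  proof (rule AS_locally_zeroI[of _ _ _ ?W])
    show "(\<lambda>xs. \<phi> xs + c * \<psi> xs) \<in> AS_cochains q X"
      using assms by (intro AS_cochains_lincomb) (simp_all add: AS_locally_zero_def)
    have "\<Union>?W = \<Union>\<U> \<inter> \<Union>\<V>" by blast
    then show "topspace X = \<Union>?W" by (simp only: U(2)[symmetric] V(2)[symmetric] Int_absorb)
    show "openin X W" if "W \<in> ?W" for W using that U(1) V(1) by blast
    fix W xs assume "W \<in> ?W" "length xs = Suc q" "set xs \<subseteq> W"
    moreover from \<open>W \<in> ?W\<close> obtain S T where "W = S \<inter> T" "S \<in> \<U>" "T \<in> \<V>" by blast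
    ultimately show "\<phi> xs + c * \<psi> xs = 0" using U(3) V(3) by simp
  qed
qed

lemma AS_locally_zero_zero: "(\<lambda>_. 0) \<in> AS_locally_zero q X"
  by (rule AS_locally_zeroI[of _ _ _ "{topspace X}"]) (simp_all add: AS_cochains_zero)

lemma AS_locally_zero_cochain: "\<phi> \<in> AS_locally_zero q X \<Longrightarrow> \<phi> \<in> AS_cochains q X"
  by (simp add: AS_locally_zero_def)

lemma AS_coboundary_cochain: "AS_coboundary q X \<phi> \<in> AS_cochains (Suc q) X"
  by (simp add: AS_cochains_def AS_coboundary_def)

lemma AS_coboundary_lincomb:
  "AS_coboundary q X (\<lambda>xs. \<phi> xs + c * \<psi> xs) =
     (\<lambda>xs. AS_coboundary q X \<phi> xs + c * AS_coboundary q X \<psi> xs)"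
  by (rule ext) (simp add: AS_coboundary_def algebra_simps sum.distrib sum_distrib_left)

lemma AS_coboundary_locally_zero:
  assumes "\<phi> \<in> AS_locally_zero q X"
  shows "AS_coboundary q X \<phi> \<in> AS_locally_zero (Suc q) X"
proof -
  obtain \<U> where U': "\<forall>U\<in>\<U>. openin X U" and U2: "topspace X = \<Union>\<U>"
    and U3: "\<forall>U xs. U \<in> \<U> \<longrightarrow> length xs = Suc q \<longrightarrow> set xs \<subseteq> U \<longrightarrow> \<phi> xs = 0"
    using AS_locally_zeroD[OF assms] by (elim exE conjE) (rule that)
  note U = U'[rule_format] U2 U3[rule_format]
  have "AS_coboundary q X \<phi> xs = 0" if "U \<in> \<U>" "length xs = Suc (Suc q)" "set xs \<subseteq> U" for U xs
  proof -
    have "\<phi> (take i xs @ drop (Suc i) xs) = 0" if "i \<le> Suc q" for i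
      by (rule U(3)[OF \<open>U \<in> \<U>\<close>])
        (use that \<open>set xs \<subseteq> U\<close> \<open>length xs = _\<close> in \<open>auto dest: in_set_takeD in_set_dropD\<close>)
    then show ?thesis by (simp add: AS_coboundary_def)
  qed
  note z = this
  show ?thesis
    by (rule AS_locally_zeroI[of _ _ _ \<U>]) (use AS_coboundary_cochain[of q X \<phi>] U z in simp_all)
qed

lemma face_face:
  assumes "j < i" "i < length xs"
  shows "take j (take i xs @ drop (Suc i) xs) @ drop (Suc j) (take i xs @ drop (Suc i) xs) =
         take (i - 1) (take j xs @ drop (Suc j) xs) @ drop (Suc (i - 1)) (take j xs @ drop (Suc j) xs)"
  by (rule nth_equalityI) (use assms in \<open>auto simp: nth_append\<close>)

lemma AS_coboundary_coboundary:
  "AS_coboundary (Suc q) X (AS_coboundary q X \<phi>) = (\<lambda>_. 0)"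
proof
  fix xs
  show "AS_coboundary (Suc q) X (AS_coboundary q X \<phi>) xs = 0"
  proof (cases "xs \<in> AS_tuples (Suc (Suc q)) X")
    case True
    then have len: "length xs = Suc (Suc (Suc q))" by (simp add: AS_tuples_def)
    define d where "d i ys = take i ys @ drop (Suc i) ys" for i and ys :: "'a list"
    define T where "T = (\<lambda>(i, j). (-1) ^ i * ((-1) ^ j * \<phi> (d j (d i xs))))"
    have in_t: "d i xs \<in> AS_tuples (Suc q) X" if "i \<le> Suc (Suc q)" for i
      using True that by (auto simp: AS_tuples_def d_def dest: in_set_takeD in_set_dropD)
    have "AS_coboundary (Suc q) X (AS_coboundary q X \<phi>) xs =
        (\<Sum>i\<le>Suc (Suc q). (-1) ^ i * (\<Sum>j\<le>Suc q. (-1) ^ j * \<phi> (d j (d i xs))))"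
      using True in_t by (simp add: AS_coboundary_def d_def[symmetric] del: sum.atMost_Suc)
    also have "\<dots> = sum T ({..Suc (Suc q)} \<times> {..Suc q})"
      by (simp add: T_def sum.cartesian_product sum_distrib_left del: sum.atMost_Suc)
    also have "\<dots> = sum T {(i, j). i \<le> Suc (Suc q) \<and> j < i} + sum T {(i, j). i \<le> j \<and> j \<le> Suc q}"
    proof (subst sum.union_disjoint[symmetric])
      show "finite {(i, j). i \<le> Suc (Suc q) \<and> j < i}"
        by (rule finite_subset[of _ "{..Suc (Suc q)} \<times> {..Suc (Suc q)}"]) auto
      show "finite {(i, j). i \<le> j \<and> j \<le> Suc q}"
        by (rule finite_subset[of _ "{..Suc (Suc q)} \<times> {..Suc (Suc q)}"]) auto
    qed (auto intro!: sum.cong)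
    also have "sum T {(i, j). i \<le> Suc (Suc q) \<and> j < i} = sum (\<lambda>x. - T x) {(i, j). i \<le> j \<and> j \<le> Suc q}"
    proof (rule sum.reindex_bij_witness[of _ "\<lambda>(j, i). (Suc i, j)" "\<lambda>(i, j). (j, i - 1)"])
      fix x assume "x \<in> {(i, j). i \<le> Suc (Suc q) \<and> j < i}"
      then obtain i j where x: "x = (i, j)" "i \<le> Suc (Suc q)" "j < i" by auto
      then have "d j (d i xs) = d (i - 1) (d j xs)"
        unfolding d_def by (intro face_face) (simp_all add: len)
      moreover have "(-1 :: 'b) ^ i = - ((-1) ^ (i - 1))"
        using x by (cases i) auto
      ultimately show "- T (case x of (i, j) \<Rightarrow> (j, i - 1)) = T x"
        using x by (simp add: T_def mult.left_commute)
    qed auto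
    finally show ?thesis by (simp add: sum_negf)
  qed (simp add: AS_coboundary_def)
qed

lemma AS_cocycles_lincomb:
  assumes "\<phi> \<in> AS_cocycles q X" "\<psi> \<in> AS_cocycles q X"
  shows "(\<lambda>xs. \<phi> xs + c * \<psi> xs) \<in> AS_cocycles q X"
  using assms unfolding AS_cocycles_def
  by (simp add: AS_coboundary_lincomb AS_cochains_lincomb AS_locally_zero_lincomb)

lemma AS_cocycles_zero: "(\<lambda>_. 0 :: 'r::comm_ring_1) \<in> AS_cocycles q X"
proof -
  have "AS_coboundary q X (\<lambda>_. 0 :: 'r) = (\<lambda>_. 0)"
    by (rule ext) (simp add: AS_coboundary_def)
  then show ?thesis
    by (simp add: AS_cocycles_def AS_cochains_zero AS_locally_zero_zero)
qed

lemma AS_coboundariesI: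
  assumes "\<zeta> \<in> AS_locally_zero q X"
    "\<beta> \<in> (case q of 0 \<Rightarrow> {\<lambda>_. 0} | Suc q' \<Rightarrow> AS_coboundary q' X ` AS_cochains q' X)"
    "\<And>xs. \<phi> xs = \<zeta> xs + \<beta> xs"
  shows "\<phi> \<in> AS_coboundaries q X"
proof -
  have "\<phi> = (\<lambda>xs. \<zeta> xs + \<beta> xs)" using assms(3) by (rule ext)
  with assms(1,2) show ?thesis unfolding AS_coboundaries_def by blast
qed

lemma AS_coboundaries_locally_zero:
  fixes \<phi> :: "'a list \<Rightarrow> 'r::comm_ring_1"
  assumes "\<phi> \<in> AS_locally_zero q X"
  shows "\<phi> \<in> AS_coboundaries q X"
proof -
  have "(\<lambda>_. 0 :: 'r) \<in> (case q of 0 \<Rightarrow> {\<lambda>_. 0} | Suc q' \<Rightarrow> AS_coboundary q' X ` AS_cochains q' X)"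
  proof (cases q)
    case (Suc q')
    have "(\<lambda>_. 0 :: 'r) = AS_coboundary q' X (\<lambda>_. 0)"
      by (rule ext) (simp add: AS_coboundary_def)
    with Suc show ?thesis using AS_cochains_zero by auto
  qed auto
  from AS_coboundariesI[OF assms this] show ?thesis by simp
qed

lemma AS_coboundaries_coboundary:
  assumes "\<beta> \<in> AS_cochains q X"
  shows "AS_coboundary q X \<beta> \<in> AS_coboundaries (Suc q) X"
proof -
  have "AS_coboundary q X \<beta> \<in>
      (case Suc q of 0 \<Rightarrow> {\<lambda>_. 0} | Suc q' \<Rightarrow> AS_coboundary q' X ` AS_cochains q' X)"
    using assms by simp
  from AS_coboundariesI[OF AS_locally_zero_zero this] show ?thesis by simp
qed

lemma AS_coboundaries_lincomb:
  assumes "\<phi> \<in> AS_coboundaries q X" "\<psi> \<in> AS_coboundaries q X"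
  shows "(\<lambda>xs. \<phi> xs + c * \<psi> xs) \<in> AS_coboundaries q X"
proof -
  let ?B = "case q of 0 \<Rightarrow> {\<lambda>_. 0} | Suc q' \<Rightarrow> AS_coboundary q' X ` AS_cochains q' X"
  obtain \<zeta> \<beta> where 1: "\<zeta> \<in> AS_locally_zero q X" "\<beta> \<in> ?B" "\<phi> = (\<lambda>xs. \<zeta> xs + \<beta> xs)"
    using assms(1) unfolding AS_coboundaries_def by blast
  obtain \<eta> \<gamma> where 2: "\<eta> \<in> AS_locally_zero q X" "\<gamma> \<in> ?B" "\<psi> = (\<lambda>xs. \<eta> xs + \<gamma> xs)"
    using assms(2) unfolding AS_coboundaries_def by blast
  have "(\<lambda>xs. \<beta> xs + c * \<gamma> xs) \<in> ?B"
  proof (cases q)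
    case (Suc q')
    with 1(2) 2(2) obtain b g where "b \<in> AS_cochains q' X" "g \<in> AS_cochains q' X"
      "\<beta> = AS_coboundary q' X b" "\<gamma> = AS_coboundary q' X g" by auto
    moreover from this have "(\<lambda>xs. b xs + c * g xs) \<in> AS_cochains q' X"
      by (intro AS_cochains_lincomb)
    ultimately show ?thesis
      by (auto simp: Suc AS_coboundary_lincomb[symmetric])
  qed (use 1 2 in auto)
  from AS_coboundariesI[OF AS_locally_zero_lincomb[OF 1(1) 2(1)] this] show ?thesis
    by (simp add: 1(3) 2(3) algebra_simps)
qed

lemma AS_locally_zero_subset_cocycles: "AS_locally_zero q X \<subseteq> AS_cocycles q X"
  unfolding AS_cocycles_def using AS_coboundary_locally_zero AS_locally_zero_cochain by blast

lemma AS_coboundaries_subset_cocycles: "AS_coboundaries q X \<subseteq> AS_cocycles q X"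
proof
  let ?B = "case q of 0 \<Rightarrow> {\<lambda>_. 0} | Suc q' \<Rightarrow> AS_coboundary q' X ` AS_cochains q' X"
  fix \<phi> :: "'a list \<Rightarrow> 'b" assume "\<phi> \<in> AS_coboundaries q X"
  then obtain \<zeta> \<beta> where 1: "\<zeta> \<in> AS_locally_zero q X" "\<beta> \<in> ?B" "\<phi> = (\<lambda>xs. \<zeta> xs + \<beta> xs)"
    unfolding AS_coboundaries_def by blast
  have "\<beta> \<in> AS_cocycles q X"
    using 1(2)
    by (cases q) (auto simp: AS_cocycles_zero, auto simp: AS_cocycles_def AS_coboundary_cochain
        AS_coboundary_coboundary AS_locally_zero_zero)
  moreover have "\<zeta> \<in> AS_cocycles q X" using 1(1) AS_locally_zero_subset_cocycles by blast
  ultimately have "(\<lambda>xs. \<zeta> xs + 1 * \<beta> xs) \<in> AS_cocycles q X" by (rule AS_cocycles_lincomb[rotated])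
  then show "\<phi> \<in> AS_cocycles q X" using 1(3) by simp
qed

lemma comm_group_AS_cocycle_group: "comm_group (AS_cocycle_group q X)"
proof (rule comm_groupI)
  fix \<phi> \<psi> :: "'a list \<Rightarrow> 'b"
  assume 1: "\<phi> \<in> carrier (AS_cocycle_group q X)" and 2: "\<psi> \<in> carrier (AS_cocycle_group q X)"
  show "\<phi> \<otimes>\<^bsub>AS_cocycle_group q X\<^esub> \<psi> \<in> carrier (AS_cocycle_group q X)"
    using 1 2 AS_cocycles_lincomb[of \<phi> q X \<psi> 1] by (simp add: AS_cocycle_group_def)
next
  fix \<phi> :: "'a list \<Rightarrow> 'b"
  assume 1: "\<phi> \<in> carrier (AS_cocycle_group q X)"
  have "(\<lambda>xs. - \<phi> xs) \<in> AS_cocycles q X"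
    using 1 AS_cocycles_lincomb[OF AS_cocycles_zero, of \<phi> q X "-1"] by (simp add: AS_cocycle_group_def)
  then show "\<exists>\<psi>\<in>carrier (AS_cocycle_group q X). \<psi> \<otimes>\<^bsub>AS_cocycle_group q X\<^esub> \<phi> = \<one>\<^bsub>AS_cocycle_group q X\<^esub>"
    by (intro bexI[of _ "\<lambda>xs. - \<phi> xs"]) (auto simp: AS_cocycle_group_def)
qed (simp_all add: AS_cocycle_group_def AS_cocycles_zero ac_simps)

lemma subgroup_AS_coboundaries:
  "subgroup (AS_coboundaries q X :: ('a list \<Rightarrow> 'r::comm_ring_1) set) (AS_cocycle_group q X)"
proof -
  interpret comm_group "AS_cocycle_group q X :: ('a list \<Rightarrow> 'r) monoid"
    by (rule comm_group_AS_cocycle_group)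
  have minus: "(\<lambda>xs. - \<phi> xs) \<in> AS_coboundaries q X"
    if "\<phi> \<in> AS_coboundaries q X" for \<phi> :: "'a list \<Rightarrow> 'r"
    using that AS_coboundaries_lincomb[OF AS_coboundaries_locally_zero[OF AS_locally_zero_zero], of \<phi> q X "-1"]
    by simp
  show ?thesis
  proof (rule subgroupI)
    show "AS_coboundaries q X \<subseteq> carrier (AS_cocycle_group q X)"
      using AS_coboundaries_subset_cocycles by (simp add: AS_cocycle_group_def)
    show "(AS_coboundaries q X :: ('a list \<Rightarrow> 'r) set) \<noteq> {}"
      using AS_coboundaries_locally_zero[OF AS_locally_zero_zero] by blast
  next
    fix \<phi> :: "'a list \<Rightarrow> 'r" assume p: "\<phi> \<in> AS_coboundaries q X"
    have "inv\<^bsub>AS_cocycle_group q X\<^esub> \<phi> = (\<lambda>xs. - \<phi> xs)"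
      by (rule inv_equality)
        (use p minus AS_coboundaries_subset_cocycles in \<open>auto simp: AS_cocycle_group_def\<close>)
    then show "inv\<^bsub>AS_cocycle_group q X\<^esub> \<phi> \<in> AS_coboundaries q X" using minus p by simp
  next
    fix \<phi> \<psi> :: "'a list \<Rightarrow> 'r" assume "\<phi> \<in> AS_coboundaries q X" "\<psi> \<in> AS_coboundaries q X"
    from AS_coboundaries_lincomb[OF this, of 1]
    show "\<phi> \<otimes>\<^bsub>AS_cocycle_group q X\<^esub> \<psi> \<in> AS_coboundaries q X" by (simp add: AS_cocycle_group_def)
  qed
qed

lemma comm_group_AS_cohomology: "comm_group (AS_cohomology q X)"
  unfolding AS_cohomology_def
  by (rule comm_group.abelian_FactGroup[OF comm_group_AS_cocycle_group subgroup_AS_coboundaries])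

lemma AS_class_eq: "AS_class q X \<phi> = {\<psi>. (\<lambda>xs. \<psi> xs - \<phi> xs) \<in> AS_coboundaries q X}"
proof -
  have "AS_class q X \<phi> = (\<Union>h\<in>AS_coboundaries q X. {\<lambda>xs. h xs + \<phi> xs})"
    by (simp add: AS_class_def r_coset_def AS_cocycle_group_def)
  also have "\<dots> = {\<psi>. (\<lambda>xs. \<psi> xs - \<phi> xs) \<in> AS_coboundaries q X}"
  proof (intro Set.set_eqI iffI)
    fix \<psi> assume "\<psi> \<in> {\<psi>. (\<lambda>xs. \<psi> xs - \<phi> xs) \<in> AS_coboundaries q X}"
    then show "\<psi> \<in> (\<Union>h\<in>AS_coboundaries q X. {\<lambda>xs. h xs + \<phi> xs})"
      by (intro UN_I[of "\<lambda>xs. \<psi> xs - \<phi> xs"]) simp_all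
  next
    fix \<psi> assume "\<psi> \<in> (\<Union>h\<in>AS_coboundaries q X. {\<lambda>xs. h xs + \<phi> xs})"
    then obtain h where "h \<in> AS_coboundaries q X" "\<psi> = (\<lambda>xs. h xs + \<phi> xs)" by blast
    then show "\<psi> \<in> {\<psi>. (\<lambda>xs. \<psi> xs - \<phi> xs) \<in> AS_coboundaries q X}" by simp
  qed
  finally show ?thesis .
qed

lemma carrier_AS_cohomology:
  "carrier (AS_cohomology q X) = AS_class q X ` AS_cocycles q X"
  by (auto simp: AS_cohomology_def AS_class_def FactGroup_def RCOSETS_def AS_cocycle_group_def)

lemma one_AS_cohomology: "\<one>\<^bsub>AS_cohomology q X\<^esub> = AS_coboundaries q X"
  by (simp add: AS_cohomology_def)

lemma AS_class_eqI:
  assumes "(\<lambda>xs. \<psi> xs - \<phi> xs) \<in> AS_coboundaries q X"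
  shows "AS_class q X \<psi> = AS_class q X \<phi>"
proof -
  have "(\<lambda>xs. \<chi>' xs - \<phi> xs) \<in> AS_coboundaries q X" if "(\<lambda>xs. \<chi>' xs - \<psi> xs) \<in> AS_coboundaries q X" for \<chi>'
    using AS_coboundaries_lincomb[OF that assms, of 1] by simp
  moreover have "(\<lambda>xs. \<chi>' xs - \<psi> xs) \<in> AS_coboundaries q X" if "(\<lambda>xs. \<chi>' xs - \<phi> xs) \<in> AS_coboundaries q X" for \<chi>'
    using AS_coboundaries_lincomb[OF that assms, of "-1"] by simp
  ultimately show ?thesis unfolding AS_class_eq by blast
qed

lemma AS_class_self: "\<phi> \<in> AS_class q X \<phi>"
  using AS_coboundaries_locally_zero[OF AS_locally_zero_zero] by (simp add: AS_class_eq)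

lemma AS_class_eq_one:
  "AS_class q X \<phi> = \<one>\<^bsub>AS_cohomology q X\<^esub> \<longleftrightarrow> \<phi> \<in> AS_coboundaries q X"
proof
  show "\<phi> \<in> AS_coboundaries q X" if "AS_class q X \<phi> = \<one>\<^bsub>AS_cohomology q X\<^esub>"
    using that AS_class_self[of \<phi> q X] by (simp add: one_AS_cohomology)
  assume "\<phi> \<in> AS_coboundaries q X"
  then have "AS_class q X \<phi> = AS_class q X (\<lambda>_. 0)" by (intro AS_class_eqI) simp
  then show "AS_class q X \<phi> = \<one>\<^bsub>AS_cohomology q X\<^esub>"
    by (simp add: one_AS_cohomology AS_class_eq)
qed

lemma AS_pullback_locally_zero:
  assumes f: "continuous_map X Y f" and "\<phi> \<in> AS_locally_zero q Y"
  shows "AS_pullback_cochain q X f \<phi> \<in> AS_locally_zero q X"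
proof -
  obtain \<U> where U': "\<forall>U\<in>\<U>. openin Y U" and U2: "topspace Y = \<Union>\<U>"
    and U3: "\<forall>U xs. U \<in> \<U> \<longrightarrow> length xs = Suc q \<longrightarrow> set xs \<subseteq> U \<longrightarrow> \<phi> xs = 0"
    using AS_locally_zeroD[OF assms(2)] by (elim exE conjE) (rule that)
  note U = U'[rule_format] U2 U3[rule_format]
  let ?V = "(\<lambda>U. {x \<in> topspace X. f x \<in> U}) ` \<U>"
  show ?thesis
  proof (rule AS_locally_zeroI[of _ _ _ ?V])
    show "AS_pullback_cochain q X f \<phi> \<in> AS_cochains q X"
      by (simp add: AS_cochains_def AS_pullback_cochain_def)
    show "openin X V" if "V \<in> ?V" for V
      using that U(1) openin_continuous_map_preimage[OF f] by blast
    show "topspace X = \<Union>?V"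
      using continuous_map_image_subset_topspace[OF f] U(2) by auto
    fix V xs assume "V \<in> ?V" "length xs = Suc q" "set xs \<subseteq> V"
    moreover from this obtain S where "S \<in> \<U>" "V = {x \<in> topspace X. f x \<in> S}" by blast
    ultimately have "\<phi> (map f xs) = 0" by (intro U(3)[of S]) auto
    then show "AS_pullback_cochain q X f \<phi> xs = 0" by (simp add: AS_pullback_cochain_def)
  qed
qed

lemma AS_pullback_coboundary:
  assumes f: "continuous_map X Y f"
  shows "AS_coboundary q X (AS_pullback_cochain q X f \<phi>) =
         AS_pullback_cochain (Suc q) X f (AS_coboundary q Y \<phi>)"
proof
  fix xs
  show "AS_coboundary q X (AS_pullback_cochain q X f \<phi>) xs =
        AS_pullback_cochain (Suc q) X f (AS_coboundary q Y \<phi>) xs"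
  proof (cases "xs \<in> AS_tuples (Suc q) X")
    case True
    then have "map f xs \<in> AS_tuples (Suc q) Y"
      using continuous_map_image_subset_topspace[OF f] by (auto simp: AS_tuples_def)
    moreover have "take i xs @ drop (Suc i) xs \<in> AS_tuples q X" if "i \<le> Suc q" for i
      using True that by (auto simp: AS_tuples_def dest: in_set_takeD in_set_dropD)
    ultimately show ?thesis using True
      by (simp add: AS_coboundary_def AS_pullback_cochain_def take_map drop_map del: sum.atMost_Suc)
  qed (simp add: AS_coboundary_def AS_pullback_cochain_def)
qed

lemma AS_pullback_coboundaries:
  assumes f: "continuous_map X Y f" and "\<phi> \<in> AS_coboundaries q Y"
  shows "AS_pullback_cochain q X f \<phi> \<in> AS_coboundaries q X"
proof -
  let ?B = "case q of 0 \<Rightarrow> {\<lambda>_. 0} | Suc q' \<Rightarrow> AS_coboundary q' Y ` AS_cochains q' Y"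
  obtain \<zeta> \<beta> where 1: "\<zeta> \<in> AS_locally_zero q Y" "\<beta> \<in> ?B" "\<phi> = (\<lambda>xs. \<zeta> xs + \<beta> xs)"
    using assms(2) unfolding AS_coboundaries_def by blast
  have "AS_pullback_cochain q X f \<beta> \<in> AS_coboundaries q X"
  proof (cases q)
    case 0
    then have "AS_pullback_cochain q X f \<beta> = (\<lambda>_. 0)"
      using 1(2) by (auto simp: AS_pullback_cochain_def)
    then show ?thesis using AS_coboundaries_locally_zero[OF AS_locally_zero_zero] by simp
  next
    case (Suc q')
    with 1(2) obtain b where b: "\<beta> = AS_coboundary q' Y b" by auto
    have "AS_pullback_cochain q' X f b \<in> AS_cochains q' X"
      by (simp add: AS_cochains_def AS_pullback_cochain_def)
    from AS_coboundaries_coboundary[OF this] show ?thesis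
      by (simp add: Suc b AS_pullback_coboundary[OF f])
  qed
  from AS_coboundaries_lincomb[OF AS_coboundaries_locally_zero[OF AS_pullback_locally_zero[OF f 1(1)]] this, of 1]
  have "(\<lambda>xs. AS_pullback_cochain q X f \<zeta> xs + AS_pullback_cochain q X f \<beta> xs) \<in> AS_coboundaries q X" by simp
  moreover have "(\<lambda>xs. AS_pullback_cochain q X f \<zeta> xs + AS_pullback_cochain q X f \<beta> xs) = AS_pullback_cochain q X f \<phi>"
    by (auto simp: AS_pullback_cochain_def 1(3))
  ultimately show ?thesis by simp
qed

lemma AS_pullback_cocycle:
  assumes f: "continuous_map X Y f" and "\<phi> \<in> AS_cocycles q Y"
  shows "AS_pullback_cochain q X f \<phi> \<in> AS_cocycles q X"
  using assms unfolding AS_cocycles_def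
  by (auto simp: AS_pullback_coboundary[OF f] intro: AS_pullback_locally_zero)
    (simp add: AS_cochains_def AS_pullback_cochain_def)

lemma AS_pullback_class:
  assumes f: "continuous_map X Y f"
  shows "AS_pullback q X f (AS_class q Y \<phi>) = AS_class q X (AS_pullback_cochain q X f \<phi>)"
proof -
  have "AS_class q X (AS_pullback_cochain q X f \<psi>) = AS_class q X (AS_pullback_cochain q X f \<phi>)"
    if "\<psi> \<in> AS_class q Y \<phi>" for \<psi>
  proof (rule AS_class_eqI)
    have "AS_pullback_cochain q X f (\<lambda>xs. \<psi> xs - \<phi> xs) \<in> AS_coboundaries q X"
      using that AS_pullback_coboundaries[OF f] by (simp add: AS_class_eq)
    moreover have "AS_pullback_cochain q X f (\<lambda>xs. \<psi> xs - \<phi> xs) =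
        (\<lambda>xs. AS_pullback_cochain q X f \<psi> xs - AS_pullback_cochain q X f \<phi> xs)"
      by (auto simp: AS_pullback_cochain_def)
    ultimately show "(\<lambda>xs. AS_pullback_cochain q X f \<psi> xs - AS_pullback_cochain q X f \<phi> xs) \<in> AS_coboundaries q X"
      by simp
  qed
  then show ?thesis
    unfolding AS_pullback_def using AS_class_self[of \<phi> q Y] by blast
qed

lemma AS_cup_cochain:
  assumes "\<phi> \<in> AS_cochains p X" "\<psi> \<in> AS_cochains q X"
  shows "AS_cup_cochain p \<phi> \<psi> \<in> AS_cochains (p + q) X"
proof -
  have "\<phi> (take (Suc p) xs) * \<psi> (drop p xs) = 0" if "xs \<notin> AS_tuples (p + q) X" for xs
  proof (cases "take (Suc p) xs \<in> AS_tuples p X \<and> drop p xs \<in> AS_tuples q X")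
    case True
    then have l: "length xs = Suc (p + q)" by (auto simp: AS_tuples_def)
    have "set xs = set (take p xs) \<union> set (drop p xs)"
      by (metis append_take_drop_id set_append)
    moreover have "set (take p xs) \<subseteq> set (take (Suc p) xs)" by (simp add: set_take_subset_set_take)
    ultimately have "xs \<in> AS_tuples (p + q) X" using True l by (auto simp: AS_tuples_def)
    with that show ?thesis by simp
  next
    case False
    then show ?thesis using assms by (auto simp: AS_cochains_def)
  qed
  then show ?thesis by (auto simp: AS_cochains_def AS_cup_cochain_def)
qed

lemma AS_cup_locally_zero_left:
  assumes "\<phi> \<in> AS_locally_zero p X" "\<psi> \<in> AS_cochains q X"
  shows "AS_cup_cochain p \<phi> \<psi> \<in> AS_locally_zero (p + q) X"
proof -
  obtain \<U> where U': "\<forall>U\<in>\<U>. openin X U" and U2: "topspace X = \<Union>\<U>"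
    and U3: "\<forall>U xs. U \<in> \<U> \<longrightarrow> length xs = Suc p \<longrightarrow> set xs \<subseteq> U \<longrightarrow> \<phi> xs = 0"
    using AS_locally_zeroD[OF assms(1)] by (elim exE conjE) (rule that)
  note U = U'[rule_format] U2 U3[rule_format]
  have "AS_cup_cochain p \<phi> \<psi> xs = 0" if "U \<in> \<U>" "length xs = Suc (p + q)" "set xs \<subseteq> U" for U xs
  proof -
    have "\<phi> (take (Suc p) xs) = 0"
      by (rule U(3)[OF that(1)]) (use that in \<open>auto dest: in_set_takeD\<close>)
    then show ?thesis by (simp add: AS_cup_cochain_def)
  qed
  note z = this
  show ?thesis
    by (rule AS_locally_zeroI[of _ _ _ \<U>]) (use AS_cup_cochain[OF AS_locally_zero_cochain[OF assms(1)] assms(2)] U z in simp_all)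
qed

lemma AS_cup_locally_zero_right:
  assumes "\<phi> \<in> AS_cochains p X" "\<psi> \<in> AS_locally_zero q X"
  shows "AS_cup_cochain p \<phi> \<psi> \<in> AS_locally_zero (p + q) X"
proof -
  obtain \<U> where U': "\<forall>U\<in>\<U>. openin X U" and U2: "topspace X = \<Union>\<U>"
    and U3: "\<forall>U xs. U \<in> \<U> \<longrightarrow> length xs = Suc q \<longrightarrow> set xs \<subseteq> U \<longrightarrow> \<psi> xs = 0"
    using AS_locally_zeroD[OF assms(2)] by (elim exE conjE) (rule that)
  note U = U'[rule_format] U2 U3[rule_format]
  have "AS_cup_cochain p \<phi> \<psi> xs = 0" if "U \<in> \<U>" "length xs = Suc (p + q)" "set xs \<subseteq> U" for U xs
  proof -
    have "\<psi> (drop p xs) = 0"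
      by (rule U(3)[OF that(1)]) (use that in \<open>auto dest: in_set_dropD\<close>)
    then show ?thesis by (simp add: AS_cup_cochain_def)
  qed
  note z = this
  show ?thesis
    by (rule AS_locally_zeroI[of _ _ _ \<U>]) (use AS_cup_cochain[OF assms(1) AS_locally_zero_cochain[OF assms(2)]] U z in simp_all)
qed

lemma AS_coboundary_cup:
  assumes \<phi>: "\<phi> \<in> AS_cochains p X" and \<psi>: "\<psi> \<in> AS_cochains q X"
  shows "AS_coboundary (p + q) X (AS_cup_cochain p \<phi> \<psi>) =
    (\<lambda>xs. AS_cup_cochain (Suc p) (AS_coboundary p X \<phi>) \<psi> xs +
          (-1) ^ p * AS_cup_cochain p \<phi> (AS_coboundary q X \<psi>) xs)"
proof
  fix xs
  let ?L = "AS_coboundary (p + q) X (AS_cup_cochain p \<phi> \<psi>) xs"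
  let ?R = "AS_cup_cochain (Suc p) (AS_coboundary p X \<phi>) \<psi> xs + (-1) ^ p * AS_cup_cochain p \<phi> (AS_coboundary q X \<psi>) xs"
  show "?L = ?R"
  proof (cases "xs \<in> AS_tuples (Suc (p + q)) X")
    case False
    then show ?thesis
      using AS_cup_cochain[OF AS_coboundary_cochain[of p X \<phi>] \<psi>] AS_cup_cochain[OF \<phi> AS_coboundary_cochain[of q X \<psi>]]
      by (simp add: AS_cochains_def AS_coboundary_def)
  next
    case True
    then have len: "length xs = Suc (Suc (p + q))" and sX: "set xs \<subseteq> topspace X" by (auto simp: AS_tuples_def)
    define d where "d i ys = take i ys @ drop (Suc i) ys" for i and ys :: "'a list"
    define a where "a i = (-1) ^ i * \<phi> (d i (take (Suc (Suc p)) xs)) * \<psi> (drop (Suc p) xs)" for i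
    define b where "b j = (-1) ^ (p + j) * \<phi> (take (Suc p) xs) * \<psi> (d j (drop p xs))" for j
    have t1: "take (Suc (Suc p)) xs \<in> AS_tuples (Suc p) X"
      using len sX by (auto simp: AS_tuples_def dest: in_set_takeD)
    have t2: "drop p xs \<in> AS_tuples (Suc q) X"
      using len sX by (auto simp: AS_tuples_def dest: in_set_dropD)
    have R: "?R = (\<Sum>i\<le>Suc p. a i) + (\<Sum>j\<le>Suc q. b j)"
      using t1 t2
      by (simp add: AS_cup_cochain_def AS_coboundary_def a_def b_def d_def
          sum_distrib_left sum_distrib_right power_add mult.assoc mult.left_commute del: sum.atMost_Suc)
    have e1: "take (Suc p) (d i xs) = d i (take (Suc (Suc p)) xs)" "drop p (d i xs) = drop (Suc p) xs"
      if "i \<le> p" for i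
      using that len by (simp_all add: d_def min_def drop_take)
    have e2: "take (Suc p) (d (p + j) xs) = take (Suc p) xs" "drop p (d (p + j) xs) = d j (drop p xs)"
      if "1 \<le> j" "j \<le> Suc q" for j
      using that len by (simp_all add: d_def min_def drop_take add.commute)
    have "?L = (\<Sum>i\<le>Suc (p + q). (-1) ^ i * (\<phi> (take (Suc p) (d i xs)) * \<psi> (drop p (d i xs))))"
      using True by (simp add: AS_cup_cochain_def AS_coboundary_def d_def del: sum.atMost_Suc)
    also have "\<dots> = (\<Sum>i\<le>p. (-1) ^ i * (\<phi> (take (Suc p) (d i xs)) * \<psi> (drop p (d i xs)))) +
        (\<Sum>i\<in>{p+1..p+Suc q}. (-1) ^ i * (\<phi> (take (Suc p) (d i xs)) * \<psi> (drop p (d i xs))))"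
    proof -
      have "{..Suc (p + q)} = {..p} \<union> {p+1..p+Suc q}" by auto
      then show ?thesis by (simp only:) (rule sum.union_disjoint; auto)
    qed
    also have "(\<Sum>i\<in>{p+1..p+Suc q}. (-1) ^ i * (\<phi> (take (Suc p) (d i xs)) * \<psi> (drop p (d i xs)))) =
        (\<Sum>j\<in>{1..Suc q}. b j)"
    proof (rule sum.reindex_bij_witness[of _ "\<lambda>j. p + j" "\<lambda>i. i - p"])
      fix i assume i: "i \<in> {p+1..p+Suc q}"
      then have "1 \<le> i - p" "i - p \<le> Suc q" "p + (i - p) = i" by auto
      then show "b (i - p) = (-1) ^ i * (\<phi> (take (Suc p) (d i xs)) * \<psi> (drop p (d i xs)))"
        using e2[of "i - p"] by (simp add: b_def mult.assoc)
    qed auto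
    also have "(\<Sum>i\<le>p. (-1) ^ i * (\<phi> (take (Suc p) (d i xs)) * \<psi> (drop p (d i xs)))) = (\<Sum>i\<le>p. a i)"
      by (intro sum.cong) (auto simp: a_def e1 mult.assoc)
    finally have L: "?L = (\<Sum>i\<le>p. a i) + (\<Sum>j\<in>{1..Suc q}. b j)" .
    have "(\<Sum>j\<le>Suc q. b j) = b 0 + (\<Sum>j\<in>{1..Suc q}. b j)"
      by (simp add: atMost_atLeast0 sum.atLeast_Suc_atMost del: sum.cl_ivl_Suc)
    moreover have "(\<Sum>i\<le>Suc p. a i) = (\<Sum>i\<le>p. a i) + a (Suc p)" by simp
    moreover have "a (Suc p) + b 0 = 0"
      using len by (simp add: a_def b_def d_def min_def)
    ultimately show ?thesis using L R by (simp add: algebra_simps)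
  qed
qed

lemma AS_cup_cocycles:
  assumes \<phi>: "\<phi> \<in> AS_cocycles p X" and \<psi>: "\<psi> \<in> AS_cocycles q X"
  shows "AS_cup_cochain p \<phi> \<psi> \<in> AS_cocycles (p + q) X"
proof -
  have c: "\<phi> \<in> AS_cochains p X" "\<psi> \<in> AS_cochains q X" using assms by (auto simp: AS_cocycles_def)
  have "AS_cup_cochain (Suc p) (AS_coboundary p X \<phi>) \<psi> \<in> AS_locally_zero (Suc (p + q)) X"
    using AS_cup_locally_zero_left[of "AS_coboundary p X \<phi>" "Suc p" X \<psi> q] \<phi> c by (simp add: AS_cocycles_def)
  moreover have "AS_cup_cochain p \<phi> (AS_coboundary q X \<psi>) \<in> AS_locally_zero (Suc (p + q)) X"
    using AS_cup_locally_zero_right[of \<phi> p X "AS_coboundary q X \<psi>" "Suc q"] \<psi> c by (simp add: AS_cocycles_def)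
  ultimately show ?thesis
    using AS_cup_cochain[OF c]
    by (simp add: AS_cocycles_def AS_coboundary_cup[OF c] AS_locally_zero_lincomb)
qed

lemma AS_cup_coboundaries_left:
  assumes \<phi>: "\<phi> \<in> AS_coboundaries p X" and \<psi>: "\<psi> \<in> AS_cocycles q X"
  shows "AS_cup_cochain p \<phi> \<psi> \<in> AS_coboundaries (p + q) X"
proof -
  have c: "\<psi> \<in> AS_cochains q X" and d\<psi>: "AS_coboundary q X \<psi> \<in> AS_locally_zero (Suc q) X"
    using assms by (auto simp: AS_cocycles_def)
  obtain \<zeta> \<beta> where 1: "\<zeta> \<in> AS_locally_zero p X" "\<phi> = (\<lambda>xs. \<zeta> xs + \<beta> xs)"
      "\<beta> \<in> (case p of 0 \<Rightarrow> {\<lambda>_. 0} | Suc q' \<Rightarrow> AS_coboundary q' X ` AS_cochains q' X)"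
    using \<phi> unfolding AS_coboundaries_def by blast
  have "AS_cup_cochain p \<beta> \<psi> \<in> AS_coboundaries (p + q) X"
  proof (cases p)
    case 0
    then have "AS_cup_cochain p \<beta> \<psi> = (\<lambda>_. 0)" using 1(3) by (auto simp: AS_cup_cochain_def)
    then show ?thesis using AS_coboundaries_locally_zero[OF AS_locally_zero_zero] by simp
  next
    case (Suc p')
    with 1(3) obtain b where b: "b \<in> AS_cochains p' X" "\<beta> = AS_coboundary p' X b" by auto
    have "AS_cup_cochain p' b (AS_coboundary q X \<psi>) \<in> AS_coboundaries (Suc (p' + q)) X"
      using AS_coboundaries_locally_zero AS_cup_locally_zero_right[OF b(1) d\<psi>] by fastforce
    from AS_coboundaries_lincomb[OF AS_coboundaries_coboundary[OF AS_cup_cochain[OF b(1) c]] this, of "- ((-1) ^ p')"]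
    show ?thesis by (simp add: AS_coboundary_cup[OF b(1) c] Suc b(2))
  qed
  from AS_coboundaries_lincomb[OF AS_coboundaries_locally_zero[OF AS_cup_locally_zero_left[OF 1(1) c]] this, of 1]
  have "(\<lambda>xs. AS_cup_cochain p \<zeta> \<psi> xs + AS_cup_cochain p \<beta> \<psi> xs) \<in> AS_coboundaries (p + q) X" by simp
  moreover have "(\<lambda>xs. AS_cup_cochain p \<zeta> \<psi> xs + AS_cup_cochain p \<beta> \<psi> xs) = AS_cup_cochain p \<phi> \<psi>"
    by (auto simp: AS_cup_cochain_def 1(2) algebra_simps)
  ultimately show ?thesis by simp
qed

lemma AS_cup_coboundaries_right:
  assumes \<phi>: "\<phi> \<in> AS_cocycles p X" and \<psi>: "\<psi> \<in> AS_coboundaries q X"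
  shows "AS_cup_cochain p \<phi> \<psi> \<in> AS_coboundaries (p + q) X"
proof -
  have c: "\<phi> \<in> AS_cochains p X" and d\<phi>: "AS_coboundary p X \<phi> \<in> AS_locally_zero (Suc p) X"
    using assms by (auto simp: AS_cocycles_def)
  obtain \<zeta> \<beta> where 1: "\<zeta> \<in> AS_locally_zero q X" "\<psi> = (\<lambda>xs. \<zeta> xs + \<beta> xs)"
      "\<beta> \<in> (case q of 0 \<Rightarrow> {\<lambda>_. 0} | Suc q' \<Rightarrow> AS_coboundary q' X ` AS_cochains q' X)"
    using \<psi> unfolding AS_coboundaries_def by blast
  have "AS_cup_cochain p \<phi> \<beta> \<in> AS_coboundaries (p + q) X"
  proof (cases q)
    case 0
    then have "AS_cup_cochain p \<phi> \<beta> = (\<lambda>_. 0)" using 1(3) by (auto simp: AS_cup_cochain_def)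
    then show ?thesis using AS_coboundaries_locally_zero[OF AS_locally_zero_zero] by simp
  next
    case (Suc q')
    with 1(3) obtain b where b: "b \<in> AS_cochains q' X" "\<beta> = AS_coboundary q' X b" by auto
    have z: "AS_cup_cochain (Suc p) (AS_coboundary p X \<phi>) b \<in> AS_coboundaries (Suc (p + q')) X"
      using AS_coboundaries_locally_zero AS_cup_locally_zero_left[OF d\<phi> b(1)] by fastforce
    from AS_coboundaries_lincomb[OF AS_coboundaries_coboundary[OF AS_cup_cochain[OF c b(1)]] z, of "-1"]
    have w: "(\<lambda>xs. (-1) ^ p * AS_cup_cochain p \<phi> \<beta> xs) \<in> AS_coboundaries (Suc (p + q')) X"
      by (simp add: AS_coboundary_cup[OF c b(1)] b(2))
    have "(-1) ^ p * ((-1) ^ p * r) = r" for r :: 'b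
      by (simp add: power_mult_distrib[symmetric] mult.assoc[symmetric])
    with AS_coboundaries_lincomb[OF AS_coboundaries_locally_zero[OF AS_locally_zero_zero] w, of "(-1) ^ p"]
    show ?thesis by (simp add: Suc)
  qed
  from AS_coboundaries_lincomb[OF AS_coboundaries_locally_zero[OF AS_cup_locally_zero_right[OF c 1(1)]] this, of 1]
  have "(\<lambda>xs. AS_cup_cochain p \<phi> \<zeta> xs + AS_cup_cochain p \<phi> \<beta> xs) \<in> AS_coboundaries (p + q) X" by simp
  moreover have "(\<lambda>xs. AS_cup_cochain p \<phi> \<zeta> xs + AS_cup_cochain p \<phi> \<beta> xs) = AS_cup_cochain p \<phi> \<psi>"
    by (auto simp: AS_cup_cochain_def 1(2) algebra_simps)
  ultimately show ?thesis by simp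
qed

lemma AS_cup_class:
  assumes \<phi>: "\<phi> \<in> AS_cocycles p X" and \<psi>: "\<psi> \<in> AS_cocycles q X"
  shows "AS_cup p q X (AS_class p X \<phi>) (AS_class q X \<psi>) = AS_class (p + q) X (AS_cup_cochain p \<phi> \<psi>)"
proof -
  have "AS_class (p + q) X (AS_cup_cochain p \<phi>' \<psi>') = AS_class (p + q) X (AS_cup_cochain p \<phi> \<psi>)"
    if 1: "\<phi>' \<in> AS_class p X \<phi>" and 2: "\<psi>' \<in> AS_class q X \<psi>" for \<phi>' \<psi>'
  proof (rule AS_class_eqI)
    have b: "(\<lambda>xs. \<phi>' xs - \<phi> xs) \<in> AS_coboundaries p X" and c: "(\<lambda>xs. \<psi>' xs - \<psi> xs) \<in> AS_coboundaries q X"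
      using 1 2 by (auto simp: AS_class_eq)
    have "(\<lambda>xs. \<psi> xs + 1 * (\<psi>' xs - \<psi> xs)) \<in> AS_cocycles q X"
      by (rule AS_cocycles_lincomb[OF \<psi>]) (use c AS_coboundaries_subset_cocycles in blast)
    then have "\<psi>' \<in> AS_cocycles q X" by simp
    from AS_coboundaries_lincomb[OF AS_cup_coboundaries_left[OF b this] AS_cup_coboundaries_right[OF \<phi> c], of 1]
    show "(\<lambda>xs. AS_cup_cochain p \<phi>' \<psi>' xs - AS_cup_cochain p \<phi> \<psi> xs) \<in> AS_coboundaries (p + q) X"
      by (simp add: AS_cup_cochain_def algebra_simps)
  qed
  then show ?thesis
    unfolding AS_cup_def using AS_class_self[of \<phi> p X] AS_class_self[of \<psi> q X] by blast
qed

lemma AS_unit_cocycle: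
  "(\<lambda>xs. if xs \<in> AS_tuples 0 X then 1 else 0 :: 'r::comm_ring_1) \<in> AS_cocycles 0 X"
proof -
  have "AS_coboundary 0 X (\<lambda>xs. if xs \<in> AS_tuples 0 X then 1 else 0 :: 'r) = (\<lambda>_. 0)"
  proof
    fix xs show "AS_coboundary 0 X (\<lambda>xs. if xs \<in> AS_tuples 0 X then 1 else 0 :: 'r) xs = 0"
    proof (cases "xs \<in> AS_tuples (Suc 0) X")
      case True
      then obtain x y where "xs = [x, y]" "x \<in> topspace X" "y \<in> topspace X"
        by (auto simp: AS_tuples_def length_Suc_conv)
      then show ?thesis by (simp add: AS_coboundary_def AS_tuples_def)
    qed (simp add: AS_coboundary_def)
  qed
  then show ?thesis
    by (simp add: AS_cocycles_def AS_cochains_def AS_locally_zero_zero)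
qed

lemma AS_cup_unit:
  assumes "a \<in> carrier (AS_cohomology q X)"
  shows "AS_cup 0 q X (AS_unit X) a = a"
proof -
  obtain \<phi> where \<phi>: "\<phi> \<in> AS_cocycles q X" "a = AS_class q X \<phi>"
    using assms by (auto simp: carrier_AS_cohomology)
  let ?u = "\<lambda>xs. if xs \<in> AS_tuples 0 X then 1 else 0"
  have "\<phi> xs = 0" if "take (Suc 0) xs \<notin> AS_tuples 0 X" for xs
  proof -
    have "xs \<notin> AS_tuples q X" using that by (cases xs) (auto simp: AS_tuples_def)
    then show ?thesis using \<phi>(1) by (simp add: AS_cocycles_def AS_cochains_def)
  qed
  then have "AS_cup_cochain 0 ?u \<phi> = \<phi>"
    by (intro ext) (simp add: AS_cup_cochain_def)
  then show ?thesis
    using AS_cup_class[OF AS_unit_cocycle \<phi>(1)] by (simp add: AS_unit_def \<phi>(2))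
qed

lemma AS_cup_closed:
  assumes "a \<in> carrier (AS_cohomology p X)" "b \<in> carrier (AS_cohomology q X)"
  shows "AS_cup p q X a b \<in> carrier (AS_cohomology (p + q) X)"
  using assms AS_cup_class AS_cup_cocycles by (fastforce simp: carrier_AS_cohomology)

end

theory Submission
  imports Defs
begin

text \<open>Suppose \<open>dTC < n\<close>: there is a continuous map \<open>s\<close> assigning to every \<open>y \<in> E\<^sup>r\<^sub>B\<close> a measure with at most
  \<open>n\<close> support points, which are fibrewise paths \<open>\<gamma>\<close> with \<open>\<Pi>\<^sub>r \<gamma> = y\<close>.  On the set \<open>A\<^sub>i\<close> where the support
  has exactly \<open>i\<close> points, count each of them \<open>n! / i\<close> times and shrink all these paths to their common
  starting point.  This is a homotopy in \<open>SP\<^sup>n\<^sup>!(E\<^sup>r\<^sub>B)\<close> from the restriction of \<open>\<delta>\<close> to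
  \<open>\<delta> \<circ> \<Delta>\<^sub>r \<circ> ev\<^sub>0\<close>, so that \<open>\<alpha>\<^sub>i = \<delta>\<^sup>* \<alpha>\<^sub>i\<^sup>*\<close> vanishes on \<open>A\<^sub>i\<close>.  Since Alexander--Spanier cohomology is
  taut on subspaces of metric spaces, \<open>\<alpha>\<^sub>i\<close> has a representative that vanishes on small tuples near
  \<open>A\<^sub>i\<close>.  As \<open>A\<^sub>1, \<dots>, A\<^sub>n\<close> cover \<open>E\<^sup>r\<^sub>B\<close>, the product of these representatives is locally zero.\<close>

section \<open>Prism operators on Alexander--Spanier cochains\<close>

text \<open>The coboundary without degree and membership test. The recursion passes on the cochain
  with the head already inserted, so identities follow by induction on the list with the cochain
  arbitrary.\<close>

primrec face_sum :: "'a list \<Rightarrow> ('a list \<Rightarrow> 'r::comm_ring_1) \<Rightarrow> 'r"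
  where
    "face_sum [] \<phi> = 0"
  | "face_sum (x # xs) \<phi> = \<phi> xs - face_sum xs (\<lambda>ys. \<phi> (x # ys))"

text \<open>Unfolded, this is the sum of
  \<open>(-1)^i * \<phi> [f x0, ..., f xi, g xi, ..., g xq]\<close>, the usual simplicial prism
  between \<open>f\<close> and \<open>g\<close>.\<close>

primrec prism :: "('a \<Rightarrow> 'b) \<Rightarrow> ('a \<Rightarrow> 'b) \<Rightarrow> 'a list \<Rightarrow> ('b list \<Rightarrow> 'r::comm_ring_1) \<Rightarrow> 'r"
  where
    "prism f g [] \<phi> = 0"
  | "prism f g (x # xs) \<phi> = \<phi> (f x # g x # map g xs) - prism f g xs (\<lambda>ys. \<phi> (f x # ys))"

lemma face_sum_eq_sum:
  "face_sum xs \<phi> = (\<Sum>i<length xs. (-1) ^ i * \<phi> (take i xs @ drop (Suc i) xs))"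
  by (induction xs arbitrary: \<phi>) (simp_all add: sum.lessThan_Suc_shift sum_negf del: sum.lessThan_Suc)

lemma AS_coboundary_eq_face_sum:
  "AS_coboundary q X \<phi> xs = (if xs \<in> AS_tuples (Suc q) X then face_sum xs \<phi> else 0)"
  by (simp add: AS_coboundary_def face_sum_eq_sum AS_tuples_def lessThan_Suc_atMost del: sum.lessThan_Suc sum.atMost_Suc)

lemma face_sum_cong:
  assumes "\<And>ys. Suc (length ys) = length xs \<Longrightarrow> set ys \<subseteq> set xs \<Longrightarrow> \<phi> ys = \<psi> ys"
  shows "face_sum xs \<phi> = face_sum xs \<psi>"
  using assms
proof (induction xs arbitrary: \<phi> \<psi>)
  case (Cons x xs)
  have "face_sum xs (\<lambda>ys. \<phi> (x # ys)) = face_sum xs (\<lambda>ys. \<psi> (x # ys))"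
    by (rule Cons.IH) (rule Cons.prems; auto)
  moreover have "\<phi> xs = \<psi> xs" by (rule Cons.prems) auto
  ultimately show ?case by simp
qed simp

lemma face_sum_add: "face_sum xs (\<lambda>ys. \<phi> ys + \<psi> ys) = face_sum xs \<phi> + face_sum xs \<psi>"
  by (induction xs arbitrary: \<phi> \<psi>) simp_all

lemma face_sum_diff: "face_sum xs (\<lambda>ys. \<phi> ys - \<psi> ys) = face_sum xs \<phi> - face_sum xs \<psi>"
  by (induction xs arbitrary: \<phi> \<psi>) simp_all

lemma face_sum_sum:
  "finite K \<Longrightarrow> face_sum xs (\<lambda>ys. \<Sum>k\<in>K. \<phi> k ys) = (\<Sum>k\<in>K. face_sum xs (\<phi> k))"
  by (induction K rule: finite_induct) (simp_all add: face_sum_add, simp add: face_sum_eq_sum)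

lemma face_sum_map: "face_sum (map f xs) \<phi> = face_sum xs (\<lambda>ys. \<phi> (map f ys))"
  by (induction xs arbitrary: \<phi>) simp_all

lemma prism_cong:
  assumes "\<And>x. x \<in> set xs \<Longrightarrow> f x = f' x" "\<And>x. x \<in> set xs \<Longrightarrow> g x = g' x"
  shows "prism f g xs \<phi> = prism f' g' xs \<phi>"
  using assms
proof (induction xs arbitrary: \<phi>)
  case (Cons x xs)
  then have "map g xs = map g' xs" by simp
  moreover have "prism f g xs (\<lambda>ys. \<phi> (f x # ys)) = prism f' g' xs (\<lambda>ys. \<phi> (f x # ys))"
    by (rule Cons.IH) (use Cons.prems in simp_all)
  ultimately show ?case using Cons.prems by (simp del: map_eq_conv)
qed simp

text \<open>Locality: the prism evaluates \<open>\<phi>\<close> only at tuples of images of entries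
  of \<open>xs\<close>. Applied to the coboundary of a cocycle, this removes the second term of
  \<open>prism_identity\<close> on small tuples.\<close>

lemma prism_zero:
  assumes "\<And>ys. length ys = Suc (length xs) \<Longrightarrow> set ys \<subseteq> f ` set xs \<union> g ` set xs \<Longrightarrow> \<phi> ys = 0"
  shows "prism f g xs \<phi> = 0"
  using assms
proof (induction xs arbitrary: \<phi>)
  case (Cons x xs)
  have "prism f g xs (\<lambda>ys. \<phi> (f x # ys)) = 0"
    by (rule Cons.IH) (rule Cons.prems; auto)
  moreover have "\<phi> (f x # g x # map g xs) = 0" by (rule Cons.prems) auto
  ultimately show ?case by simp
qed simp

lemma prism_diff: "prism f g xs (\<lambda>ys. \<phi> ys - \<psi> ys) = prism f g xs \<phi> - prism f g xs \<psi>"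
  by (induction xs arbitrary: \<phi> \<psi>) simp_all

text \<open>The chain homotopy formula dP + Pd = g^* - f^* on tuples. It is purely algebraic, so
  discontinuous \<open>f\<close> and \<open>g\<close> are allowed; the induction hypothesis is
  applied to the cochain with \<open>f x\<close> inserted in front.\<close>

lemma prism_identity:
  "face_sum xs (\<lambda>ys. prism f g ys \<phi>) + prism f g xs (\<lambda>ys. face_sum ys \<phi>) = \<phi> (map g xs) - \<phi> (map f xs)"
proof (induction xs arbitrary: \<phi>)
  case (Cons x xs)
  from Cons[of "\<lambda>ys. \<phi> (f x # ys)"] show ?case
    by (simp add: face_sum_diff prism_diff face_sum_map algebra_simps)
qed simp

text \<open>Subtracting \<^term>\<open>prism f f\<close> keeps the prism identity and makes the operator vanish on tuples
  where \<open>f\<close> and \<open>g\<close> agree, so that infinitely many prisms can be stacked when the sequence \<open>f\<close>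
  is pointwise eventually constant.\<close>

definition prism_tower :: "(nat \<Rightarrow> 'a \<Rightarrow> 'b) \<Rightarrow> ('a \<Rightarrow> nat) \<Rightarrow> ('b list \<Rightarrow> 'r::comm_ring_1) \<Rightarrow> 'a list \<Rightarrow> 'r"
  where "prism_tower f N \<phi> xs =
    (\<Sum>k<sum_list (map N xs). prism (f k) (f (Suc k)) xs \<phi> - prism (f k) (f k) xs \<phi>)"

text \<open>Once all entries have reached their index \<open>N\<close>, consecutive maps agree on
  them and the two prisms cancel. Hence every common bound \<open>M\<close> gives the same sum, and
  \<open>sum_list\<close> is one such bound.\<close>

lemma prism_tower_eq:
  assumes N: "\<And>x k. x \<in> set xs \<Longrightarrow> N x \<le> k \<Longrightarrow> f k x = f (N x) x"
    and M: "\<And>x. x \<in> set xs \<Longrightarrow> N x \<le> M"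
  shows "prism_tower f N \<phi> xs = (\<Sum>k<M. prism (f k) (f (Suc k)) xs \<phi> - prism (f k) (f k) xs \<phi>)"
proof -
  let ?t = "\<lambda>k. prism (f k) (f (Suc k)) xs \<phi> - prism (f k) (f k) xs \<phi>"
  have z: "?t k = 0" if "\<And>x. x \<in> set xs \<Longrightarrow> N x \<le> k" for k
  proof -
    have "f (Suc k) x = f k x" if "x \<in> set xs" for x
      using N[OF that, of "Suc k"] N[OF that, of k] \<open>\<And>x. x \<in> set xs \<Longrightarrow> N x \<le> k\<close>[OF that] by (metis le_SucI)
    then have "prism (f k) (f (Suc k)) xs \<phi> = prism (f k) (f k) xs \<phi>" by (intro prism_cong refl)
    then show ?thesis by (rule right_minus_eq[THEN iffD2])
  qed
  have S: "N x \<le> sum_list (map N xs)" if "x \<in> set xs" for x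
    using that by (simp add: member_le_sum_list)
  have eq: "(\<Sum>k<a. ?t k) = (\<Sum>k<b. ?t k)" if "a \<le> b" "\<And>x. x \<in> set xs \<Longrightarrow> N x \<le> a" for a b
  proof (rule sum.mono_neutral_left)
    show "\<forall>i\<in>{..<b} - {..<a}. ?t i = 0"
    proof
      fix i assume i: "i \<in> {..<b} - {..<a}"
      have "N x \<le> i" if "x \<in> set xs" for x
        using \<open>\<And>x. x \<in> set xs \<Longrightarrow> N x \<le> a\<close>[OF that] i by auto
      then show "?t i = 0" by (rule z)
    qed
  qed (use \<open>a \<le> b\<close> in auto)
  show ?thesis
    unfolding prism_tower_def
    using eq[OF _ M, of "sum_list (map N xs)"] eq[OF _ S, of M] nat_le_linear by metis
qed

lemma prism_tower_identity:
  assumes N: "\<And>x k. x \<in> set xs \<Longrightarrow> N x \<le> k \<Longrightarrow> f k x = f (N x) x"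
  shows "face_sum xs (prism_tower f N \<phi>) + prism_tower f N (\<lambda>ys. face_sum ys \<phi>) xs =
    \<phi> (map (\<lambda>x. f (N x) x) xs) - \<phi> (map (f 0) xs)"
proof -
  define M where "M = sum_list (map N xs)"
  have M: "N x \<le> M" if "x \<in> set xs" for x
    using that by (simp add: member_le_sum_list M_def)
  let ?t = "\<lambda>k \<phi> xs. prism (f k) (f (Suc k)) xs \<phi> - prism (f k) (f k) xs \<phi>"
  \<comment> \<open>Each face of \<open>xs\<close> has its own upper limit of summation;
    \<open>M\<close> bounds \<open>N\<close> on the entries of every face, so all of them may be
    summed up to \<open>M\<close>.\<close>
  have "face_sum xs (prism_tower f N \<phi>) = face_sum xs (\<lambda>ys. \<Sum>k<M. ?t k \<phi> ys)"
  proof (rule face_sum_cong, rule prism_tower_eq)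
    fix ys x assume "set ys \<subseteq> set xs" "x \<in> set ys"
    then have x: "x \<in> set xs" by blast
    show "N x \<le> M" by (rule M[OF x])
    show "f k x = f (N x) x" if "N x \<le> k" for k by (rule N[OF x that])
  qed
  also have "\<dots> = (\<Sum>k<M. face_sum xs (?t k \<phi>))" by (rule face_sum_sum) simp
  finally have "face_sum xs (prism_tower f N \<phi>) + prism_tower f N (\<lambda>ys. face_sum ys \<phi>) xs =
      (\<Sum>k<M. face_sum xs (?t k \<phi>) + ?t k (\<lambda>ys. face_sum ys \<phi>) xs)"
    by (simp add: prism_tower_def M_def sum.distrib)
  also have "\<dots> = (\<Sum>k<M. \<phi> (map (f (Suc k)) xs) - \<phi> (map (f k) xs))"
  proof (rule sum.cong[OF refl])
    fix k
    show "face_sum xs (?t k \<phi>) + ?t k (\<lambda>ys. face_sum ys \<phi>) xs = \<phi> (map (f (Suc k)) xs) - \<phi> (map (f k) xs)"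
      \<comment> \<open>The second instance has right-hand side zero, so subtracting the degenerate
        prism leaves the telescoping term unchanged.\<close>
      using prism_identity[of xs "f k" "f (Suc k)" \<phi>] prism_identity[of xs "f k" "f k" \<phi>]
      by (simp add: face_sum_diff algebra_simps)
  qed
  also have "\<dots> = \<phi> (map (f M) xs) - \<phi> (map (f 0) xs)"
    by (rule sum_lessThan_telescope)
  also have "map (f M) xs = map (\<lambda>x. f (N x) x) xs" by (rule map_cong[OF refl N[OF _ M]])
  finally show ?thesis .
qed

section \<open>Cocycles and coboundaries tested on small tuples\<close>

lemma AS_cocycles_iff:
  assumes "\<phi> \<in> AS_cochains q X"
  shows "\<phi> \<in> AS_cocycles q X \<longleftrightarrow>
    (\<exists>\<U>. (\<forall>U\<in>\<U>. openin X U) \<and> topspace X = \<Union>\<U> \<and>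
       (\<forall>U\<in>\<U>. \<forall>xs. length xs = Suc (Suc q) \<and> set xs \<subseteq> U \<longrightarrow> face_sum xs \<phi> = 0))"
proof -
  have eq: "AS_coboundary q X \<phi> xs = face_sum xs \<phi>"
    if "openin X U" "length xs = Suc (Suc q)" "set xs \<subseteq> U" for U xs
    using that openin_subset[OF that(1)] by (simp add: AS_coboundary_eq_face_sum AS_tuples_def)
  have "(\<forall>U\<in>\<U>. openin X U) \<and> topspace X = \<Union>\<U> \<and>
       (\<forall>U\<in>\<U>. \<forall>xs. length xs = Suc (Suc q) \<and> set xs \<subseteq> U \<longrightarrow> AS_coboundary q X \<phi> xs = 0) \<longleftrightarrow>
     (\<forall>U\<in>\<U>. openin X U) \<and> topspace X = \<Union>\<U> \<and>
       (\<forall>U\<in>\<U>. \<forall>xs. length xs = Suc (Suc q) \<and> set xs \<subseteq> U \<longrightarrow> face_sum xs \<phi> = 0)" for \<U>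
    by (intro conj_cong refl ball_cong all_cong) (metis eq)
  then show ?thesis
    using assms by (simp only: AS_cocycles_def AS_locally_zero_def mem_Collect_eq AS_coboundary_cochain simp_thms)
qed

text \<open>The condition \<open>\<beta> [] = 0\<close> only matters in degree \<open>0\<close>, where it expresses that there are no
  cochains of degree \<open>-1\<close>.\<close>

lemma AS_coboundaries_iff:
  assumes \<phi>: "\<phi> \<in> AS_cochains q X"
  shows "\<phi> \<in> AS_coboundaries q X \<longleftrightarrow>
    (\<exists>\<beta> \<U>. \<beta> [] = 0 \<and> (\<forall>U\<in>\<U>. openin X U) \<and> topspace X = \<Union>\<U> \<and>
       (\<forall>U\<in>\<U>. \<forall>xs. length xs = Suc q \<and> set xs \<subseteq> U \<longrightarrow> \<phi> xs = face_sum xs \<beta>))" (is "_ \<longleftrightarrow> ?R")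
proof
  assume "\<phi> \<in> AS_coboundaries q X"
  then obtain \<zeta> \<beta>' where 1: "\<zeta> \<in> AS_locally_zero q X" "\<phi> = (\<lambda>xs. \<zeta> xs + \<beta>' xs)"
      "\<beta>' \<in> (case q of 0 \<Rightarrow> {\<lambda>_. 0} | Suc q' \<Rightarrow> AS_coboundary q' X ` AS_cochains q' X)"
    unfolding AS_coboundaries_def by blast
  obtain \<U> where U: "\<forall>U\<in>\<U>. openin X U" "topspace X = \<Union>\<U>"
     "\<forall>U xs. U \<in> \<U> \<longrightarrow> length xs = Suc q \<longrightarrow> set xs \<subseteq> U \<longrightarrow> \<zeta> xs = 0"
    using AS_locally_zeroD[OF 1(1)] by (elim exE conjE) (rule that)
  \<comment> \<open>In degree 0 the zero function serves. In positive degree the given cochain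
    vanishes at \<open>[]\<close>, because the empty list is not a tuple.\<close>
  have "\<exists>\<beta>. \<beta> [] = 0 \<and> (\<forall>xs\<in>AS_tuples q X. \<beta>' xs = face_sum xs \<beta>)"
  proof (cases q)
    case 0
    with 1(3) show ?thesis by (intro exI[of _ "\<lambda>_. 0"]) (simp add: face_sum_eq_sum)
  next
    case (Suc q')
    with 1(3) obtain b where "b \<in> AS_cochains q' X" "\<beta>' = AS_coboundary q' X b" by auto
    then show ?thesis using Suc
      by (intro exI[of _ b]) (auto simp: AS_coboundary_eq_face_sum AS_cochains_def AS_tuples_def)
  qed
  then obtain \<beta> where b: "\<beta> [] = 0" "\<And>xs. xs \<in> AS_tuples q X \<Longrightarrow> \<beta>' xs = face_sum xs \<beta>" by blast
  have "\<phi> xs = face_sum xs \<beta>" if "U \<in> \<U>" "length xs = Suc q" "set xs \<subseteq> U" for U xs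
  proof -
    have "U \<subseteq> topspace X" using U(1) that(1) openin_subset by blast
    then have "xs \<in> AS_tuples q X" using that by (simp add: AS_tuples_def)
    with b U(3) that show ?thesis by (simp add: 1(2))
  qed
  with b(1) U(1,2) show ?R by (intro exI[of _ \<beta>] exI[of _ \<U>]) simp
next
  assume ?R
  then obtain \<beta> \<U> where b': "\<beta> [] = 0" "\<forall>U\<in>\<U>. openin X U" "topspace X = \<Union>\<U>"
     "\<forall>U\<in>\<U>. \<forall>xs. length xs = Suc q \<and> set xs \<subseteq> U \<longrightarrow> \<phi> xs = face_sum xs \<beta>"
    by (elim exE conjE) (rule that)
  note b = b'(1) b'(2)[rule_format] b'(3) b'(4)[rule_format, OF _ conjI]
  have t: "xs \<in> AS_tuples q X" if "U \<in> \<U>" "length xs = Suc q" "set xs \<subseteq> U" for U xs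
    using openin_subset[OF b(2)[OF that(1)]] that by (simp add: AS_tuples_def)
  show "\<phi> \<in> AS_coboundaries q X"
  proof (cases q)
    case 0
    \<comment> \<open>The only face of a tuple of length one is \<open>[]\<close>, where
      \<open>\<beta>\<close> is zero, so \<open>\<phi>\<close> itself is locally zero.\<close>
    have "\<phi> \<in> AS_locally_zero q X"
    proof (rule AS_locally_zeroI[of _ _ _ \<U>])
      fix U xs assume "U \<in> \<U>" "length xs = Suc q" "set xs \<subseteq> U"
      then show "\<phi> xs = 0" using b(1) b(4)[of U xs] 0 by (auto simp: length_Suc_conv)
    qed (use \<phi> b in simp_all)
    then show ?thesis by (rule AS_coboundaries_locally_zero)
  next
    case (Suc q')
    \<comment> \<open>\<open>\<beta>\<close> may be nonzero outside the tuples of \<open>X\<close>;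
      cutting it off gives a cochain with the same face sums on tuples.\<close>
    define \<beta>' where "\<beta>' xs = (if xs \<in> AS_tuples q' X then \<beta> xs else 0)" for xs
    have b': "\<beta>' \<in> AS_cochains q' X" by (simp add: AS_cochains_def \<beta>'_def)
    have eq: "face_sum xs \<beta>' = face_sum xs \<beta>" if "xs \<in> AS_tuples q X" for xs
      by (rule face_sum_cong) (use that Suc in \<open>auto simp: \<beta>'_def AS_tuples_def\<close>)
    have "(\<lambda>xs. \<phi> xs + (-1) * AS_coboundary q' X \<beta>' xs) \<in> AS_locally_zero q X"
    proof (rule AS_locally_zeroI[of _ _ _ \<U>])
      show "(\<lambda>xs. \<phi> xs + (-1) * AS_coboundary q' X \<beta>' xs) \<in> AS_cochains q X"
        by (rule AS_cochains_lincomb[OF \<phi>]) (simp add: Suc AS_coboundary_cochain)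
      fix U xs assume U: "U \<in> \<U>" "length xs = Suc q" "set xs \<subseteq> U"
      show "\<phi> xs + (-1) * AS_coboundary q' X \<beta>' xs = 0"
        using b(4)[OF U] t[OF U] eq[OF t[OF U]] Suc by (simp add: AS_coboundary_eq_face_sum)
    qed (use b in simp_all)
    from AS_coboundaries_lincomb[OF AS_coboundaries_locally_zero[OF this], of "AS_coboundary q' X \<beta>'" 1]
    show ?thesis using AS_coboundaries_coboundary[OF b'] by (simp add: Suc)
  qed
qed


section \<open>Homotopy invariance and tautness\<close>

text \<open>Take half the supremum of the admissible radii up to 1. By \<open>shrink\<close>, a
  radius \<open>r\<close> admissible at \<open>b\<close> yields \<open>r - d a b\<close> at
  \<open>a\<close>, whence the Lipschitz bound; halving puts the value below an admissible radius,
  so that it is admissible itself.\<close>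

lemma (in Metric_space) lipschitz_radius:
  assumes A: "A \<subseteq> M"
    and pos: "\<And>a. a \<in> A \<Longrightarrow> \<exists>r>0. Q a r"
    and shrink: "\<And>a b r s. \<lbrakk>a \<in> A; b \<in> A; Q a r; 0 < s; d a b + s \<le> r\<rbrakk> \<Longrightarrow> Q b s"
  obtains e where "\<And>a. a \<in> A \<Longrightarrow> 0 < e a" "\<And>a. a \<in> A \<Longrightarrow> Q a (e a)"
    "\<And>a b. a \<in> A \<Longrightarrow> b \<in> A \<Longrightarrow> e b \<le> e a + d a b"
proof -
  define S where "S a = {r. 0 < r \<and> r \<le> 1 \<and> Q a r}" for a
  have self: "Q a s" if "a \<in> A" "Q a r" "0 < s" "s \<le> r" for a r s
    using shrink[of a a r s] that A by auto
  have bdd: "bdd_above (S a)" for a by (auto simp: S_def bdd_above_def)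
  have ne: "S a \<noteq> {}" if a: "a \<in> A" for a
  proof -
    obtain r where "r > 0" "Q a r" using pos[OF a] by blast
    then have "min r 1 \<in> S a" using self[OF a, of r "min r 1"] by (simp add: S_def)
    then show ?thesis by blast
  qed
  have Spos: "Sup (S a) > 0" if a: "a \<in> A" for a
  proof -
    obtain r where "r \<in> S a" using ne[OF a] by blast
    then show ?thesis using cSup_upper[OF _ bdd, of r a] by (simp add: S_def)
  qed
  show ?thesis
  proof (rule that[of "\<lambda>a. Sup (S a) / 2"])
    fix a assume a: "a \<in> A"
    show "0 < Sup (S a) / 2" using Spos[OF a] by simp
    have "Sup (S a) / 2 < Sup (S a)" using Spos[OF a] by simp
    then obtain r where "r \<in> S a" "Sup (S a) / 2 < r"
      using less_cSup_iff[OF ne[OF a] bdd] by blast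
    then show "Q a (Sup (S a) / 2)"
      using self[OF a, of r] Spos[OF a] by (simp add: S_def)
    fix b assume b: "b \<in> A"
    have "r \<le> Sup (S a) + d a b" if r: "r \<in> S b" for r
    proof (cases "r \<le> d a b")
      case True
      then show ?thesis using Spos[OF a] by simp
    next
      case False
      have "r \<le> 1" "Q b r" using r by (auto simp: S_def)
      moreover have "0 \<le> d a b" by simp
      ultimately have "r - d a b \<le> 1" "Q a (r - d a b)"
        using shrink[OF b a, of r "r - d a b"] False by (linarith, simp add: commute)
      with False have "r - d a b \<in> S a" by (simp add: S_def)
      then show ?thesis using cSup_upper[OF _ bdd, of "r - d a b" a] by simp
    qed
    then have "Sup (S b) \<le> Sup (S a) + d a b" by (rule cSup_least[OF ne[OF b]])
    moreover have "0 \<le> d a b" by simp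
    ultimately show "Sup (S b) / 2 \<le> Sup (S a) / 2 + d a b" by linarith
  qed
qed

text \<open>A tube lemma combined with a Lebesgue number: continuity gives a radius for each time,
  and compactness of the interval makes it uniform in time.\<close>

lemma (in Metric_space) homotopy_radius:
  assumes H: "continuous_map (prod_topology mtopology unit_interval) Y H"
    and W: "\<And>W. W \<in> \<W> \<Longrightarrow> openin Y W" "topspace Y = \<Union>\<W>" and a: "a \<in> M"
  shows "\<exists>r>0. \<forall>t\<in>{0..1}. \<exists>W\<in>\<W>. \<forall>b\<in>mball a r. \<forall>s\<in>{0..1}. \<bar>s - t\<bar> < r \<longrightarrow> H (b, s) \<in> W"
proof -
  define G where "G r u t W \<longleftrightarrow> (\<forall>b\<in>mball a r. \<forall>s\<in>{0..1}. \<bar>s - t\<bar> < u \<longrightarrow> H (b, s) \<in> W)" for r u t W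
  \<comment> \<open>The time window is doubled: one half is used for the distance from a time to the
    centre of its covering ball, the other for the final window.\<close>
  have "\<exists>r>0. \<exists>W\<in>\<W>. G r (2 * r) t W" if t: "t \<in> {0..1}" for t
  proof -
    have p: "(a, t) \<in> topspace (prod_topology mtopology unit_interval)" using a t by simp
    then have "H (a, t) \<in> \<Union>\<W>"
      using continuous_map_image_subset_topspace[OF H] unfolding W(2) by (rule subsetD[OF _ imageI, rotated])
    then obtain W where WW: "W \<in> \<W>" "H (a, t) \<in> W" by (rule UnionE)
    have "openin (prod_topology mtopology unit_interval)
        {x \<in> topspace (prod_topology mtopology unit_interval). H x \<in> W}" (is "openin _ ?P")
      by (rule openin_continuous_map_preimage[OF H W(1)[OF WW(1)]])
    moreover have "(a, t) \<in> ?P" using p WW(2) by simp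
    ultimately obtain U T where UT: "openin mtopology U" "openin unit_interval T" "a \<in> U" "t \<in> T" "U \<times> T \<subseteq> ?P"
      unfolding openin_prod_topology_alt by meson
    obtain r1 where r1: "r1 > 0" "mball a r1 \<subseteq> U" using UT(1,3) unfolding openin_mtopology by blast
    obtain r2 where r2: "r2 > 0" "\<And>s. s \<in> {0..1} \<Longrightarrow> dist s t < r2 \<Longrightarrow> s \<in> T"
      using UT(2,4) unfolding openin_euclidean_subtopology_iff by metis
    define r where "r = min r1 (r2 / 2)"
    have "H (b, s) \<in> W" if b: "b \<in> mball a r" and s: "s \<in> {0..1}" "\<bar>s - t\<bar> < 2 * r" for b s
    proof -
      have "b \<in> mball a r1" using b by (simp add: r_def)
      then have "b \<in> U" using r1(2) by blast
      moreover have "s \<in> T" by (rule r2(2)) (use s in \<open>simp_all add: r_def dist_real_def\<close>)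
      ultimately have "(b, s) \<in> ?P" using UT(5) by blast
      then show ?thesis by simp
    qed
    then have "G r (2 * r) t W" by (simp add: G_def)
    moreover have "r > 0" using r1 r2 by (simp add: r_def)
    ultimately show ?thesis using WW(1) by blast
  qed
  then obtain r where r: "\<And>t. t \<in> {0..1} \<Longrightarrow> r t > 0 \<and> (\<exists>W\<in>\<W>. G (r t) (2 * r t) t W)"
    by metis
  have c: "compact {0..1::real}" by simp
  have cov: "{0..1} \<subseteq> (\<Union>t\<in>{0..1::real}. ball t (r t))"
  proof
    fix t :: real assume "t \<in> {0..1}"
    with r[OF this] show "t \<in> (\<Union>t\<in>{0..1}. ball t (r t))" by (intro UN_I[of t]) simp_all
  qed
  obtain T where T: "T \<subseteq> {0..1}" "finite T" "{0..1} \<subseteq> (\<Union>t\<in>T. ball t (r t))"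
    by (rule compactE_image[OF c _ cov]) auto
  have Tne: "T \<noteq> {}" using T(3) by auto
  have "\<exists>W\<in>\<W>. G (Min (r ` T)) (Min (r ` T)) t W" if t: "t \<in> {0..1}" for t
  proof -
    obtain u where u: "u \<in> T" "t \<in> ball u (r u)" using subsetD[OF T(3) t] by (rule UN_E)
    obtain W where W': "W \<in> \<W>" "G (r u) (2 * r u) u W"
      using r[of u] u(1) T(1) by blast
    have le: "Min (r ` T) \<le> r u" using u T(2) by simp
    have "H (b, s) \<in> W" if b: "b \<in> mball a (Min (r ` T))" and s: "s \<in> {0..1}" "\<bar>s - t\<bar> < Min (r ` T)" for b s
    proof -
      have "b \<in> mball a (r u)" using b le by simp
      moreover have "\<bar>s - u\<bar> < 2 * r u" using s(2) le u(2) by (simp add: dist_real_def)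
      ultimately show ?thesis using W'(2) s(1) unfolding G_def by blast
    qed
    with W'(1) show ?thesis unfolding G_def by blast
  qed
  moreover have "Min (r ` T) > 0" using r T by (subst Min_gr_iff) (use Tne in auto)
  ultimately show ?thesis unfolding G_def by (intro exI[of _ "Min (r ` T)"] conjI ballI) simp_all
qed

lemma AS_tuplesI:
  assumes "openin X U" "length xs = Suc q" "set xs \<subseteq> U"
  shows "xs \<in> AS_tuples q X"
  using openin_subset[OF assms(1)] assms(2,3) by (simp add: AS_tuples_def)

lemma AS_pullback_cochain_cochain: "AS_pullback_cochain q X f \<phi> \<in> AS_cochains q X"
  by (simp add: AS_cochains_def AS_pullback_cochain_def)

text \<open>With a Lipschitz step size \<open>e\<close>, the unit interval over \<open>x\<close> is crossed in about \<open>4 / e x\<close> steps,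
  each of them small with respect to the cover on which the cocycle identity holds.\<close>

lemma AS_homotopy_invariance:
  assumes X: "metrizable_space X" and H: "continuous_map (prod_topology X unit_interval) Y H"
    and \<phi>: "\<phi> \<in> AS_cocycles q Y"
  shows "(\<lambda>xs. AS_pullback_cochain q X (\<lambda>x. H (x, 1)) \<phi> xs - AS_pullback_cochain q X (\<lambda>x. H (x, 0)) \<phi> xs)
    \<in> AS_coboundaries q X"
proof -
  obtain M d where "Metric_space M d" and X_eq: "X = Metric_space.mtopology M d"
    using X unfolding metrizable_space_def by blast
  then interpret Metric_space M d by simp
  have "\<phi> \<in> AS_cochains q Y" using \<phi> by (simp add: AS_cocycles_def)
  from \<phi>[unfolded AS_cocycles_iff[OF this]]
  obtain \<W> where W': "\<forall>W\<in>\<W>. openin Y W" "topspace Y = \<Union>\<W>"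
      "\<forall>W\<in>\<W>. \<forall>xs. length xs = Suc (Suc q) \<and> set xs \<subseteq> W \<longrightarrow> face_sum xs \<phi> = 0"
    by (elim exE conjE) (rule that)
  note W = W'(1)[rule_format] W'(2) W'(3)[rule_format, OF _ conjI]
  define Q where "Q a r \<longleftrightarrow> (\<forall>t\<in>{0..1}. \<exists>W\<in>\<W>. \<forall>b\<in>mball a r. \<forall>s\<in>{0..1}. \<bar>s - t\<bar> < r \<longrightarrow> H (b, s) \<in> W)"
    for a r
  have Q_pos: "\<exists>r>0. Q a r" if "a \<in> M" for a
    unfolding Q_def by (rule homotopy_radius[OF H[unfolded X_eq] W(1,2) that])
  have Q_shrink: "Q b s" if as: "a \<in> M" "b \<in> M" "Q a r" "0 < s" "d a b + s \<le> r" for a b r s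
  proof -
    have 1: "mball b s \<subseteq> mball a r" using as by (intro mball_subset) (auto simp: commute)
    have "0 \<le> d a b" by simp
    then have 2: "s \<le> r" using as(5) by linarith
    show ?thesis unfolding Q_def
    proof
      fix t :: real assume t: "t \<in> {0..1}"
      obtain W where W3: "W \<in> \<W>" "\<forall>b\<in>mball a r. \<forall>u\<in>{0..1}. \<bar>u - t\<bar> < r \<longrightarrow> H (b, u) \<in> W"
        using bspec[OF as(3)[unfolded Q_def] t] by (elim bexE) (rule that)
      show "\<exists>W\<in>\<W>. \<forall>b\<in>mball b s. \<forall>u\<in>{0..1}. \<bar>u - t\<bar> < s \<longrightarrow> H (b, u) \<in> W"
      proof (intro bexI[OF _ W3(1)] ballI impI)
        fix c u assume c: "c \<in> mball b s" "u \<in> {0..1}" "\<bar>u - t\<bar> < s"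
        show "H (c, u) \<in> W"
          by (rule W3(2)[rule_format, OF subsetD[OF 1 c(1)] c(2)]) (use c(3) 2 in simp)
      qed
    qed
  qed
  obtain e where e: "\<And>a. a \<in> M \<Longrightarrow> 0 < e a" "\<And>a. a \<in> M \<Longrightarrow> Q a (e a)"
    "\<And>a b. a \<in> M \<Longrightarrow> b \<in> M \<Longrightarrow> e b \<le> e a + d a b"
    by (rule lipschitz_radius[of M Q, OF order_refl Q_pos Q_shrink]) (assumption+, rule that)
  \<comment> \<open>The time over \<open>x\<close> after \<open>k\<close> steps of length
    \<open>e x / 4\<close>. Truncation at 1 makes \<open>f k x\<close> constant from
    \<open>N x\<close> on, as the tower requires.\<close>
  define T where "T k x = min 1 (real k * (e x / 4))" for k x
  define f where "f k x = H (x, T k x)" for k x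
  define N where "N x = nat \<lceil>4 / e x\<rceil>" for x
  have T1: "T k x = 1" if "x \<in> M" "4 / e x \<le> real k" for k x
    using that e(1)[of x] by (simp add: T_def field_simps)
  have T01: "T k x \<in> {0..1}" if "x \<in> M" for k x
    using e(1)[OF that] by (simp add: T_def)
  have TS: "\<bar>T (Suc k) x - T k x\<bar> \<le> e x / 4" if "x \<in> M" for k x
    using e(1)[OF that] by (simp add: T_def field_simps min_def)
  have TN: "T k x = 1" if "x \<in> M" "N x \<le> k" for k x
    by (rule T1[OF that(1)]) (use that in \<open>simp add: N_def nat_le_iff ceiling_le_iff\<close>)
  have fN: "f k x = H (x, 1)" if "x \<in> M" "N x \<le> k" for k x
    using TN[OF that] by (simp add: f_def)
  have "\<exists>\<rho>>0. \<forall>k. \<exists>W\<in>\<W>. f k ` mball a \<rho> \<union> f (Suc k) ` mball a \<rho> \<subseteq> W" if a: "a \<in> M" for a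
  proof -
    \<comment> \<open>On the ball of radius \<open>\<rho>\<close> one has
      \<open>e x \<ge> e a / 2\<close>, so from step \<open>K\<close> on all times are 1. Before
      that, the times over \<open>x\<close> and \<open>a\<close> differ by at most
      \<open>k * \<bar>e x - e a\<bar> / 4 \<le> K * \<rho> / 4\<close>.\<close>
    define K where "K = 8 / e a"
    define \<rho> where "\<rho> = min (e a / 2) (e a / (K + 1))"
    have ea: "e a > 0" by (rule e(1)[OF a])
    have K: "K > 0" using ea by (simp add: K_def)
    have \<rho>: "\<rho> > 0" "\<rho> \<le> e a / 2" "K * \<rho> \<le> e a"
    proof -
      show "\<rho> > 0" using ea K by (simp add: \<rho>_def)
      have "K * \<rho> \<le> K * (e a / (K + 1))" using K by (intro mult_left_mono) (auto simp: \<rho>_def)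
      also have "\<dots> \<le> e a" using ea K by (simp add: field_simps)
      finally show "K * \<rho> \<le> e a" .
      show "\<rho> \<le> e a / 2" unfolding \<rho>_def by (rule min.cobounded1)
    qed
    have near: "\<bar>T k x - T k a\<bar> \<le> e a / 4" if x: "x \<in> mball a \<rho>" for k x
    proof (cases "K \<le> real k")
      case True
      have xM: "x \<in> M" and dx: "d a x < \<rho>" using x by auto
      have "e x \<ge> e a / 2" using e(3)[OF xM a] dx \<rho>(2) by (simp add: commute)
      then have "4 / e x \<le> 8 / e a" using ea by (simp add: field_simps)
      moreover have "4 / e a \<le> 8 / e a" using ea by (simp add: field_simps)
      ultimately have "T k x = 1" "T k a = 1" using True a xM by (auto simp: K_def intro!: T1)
      then show ?thesis using ea by simp
    next
      case False
      have xM: "x \<in> M" and dx: "d a x < \<rho>" using x by auto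
      have "\<bar>e x - e a\<bar> \<le> \<rho>"
        using e(3)[OF xM a] e(3)[OF a xM] dx by (simp add: commute abs_le_iff)
      then have "real k * \<bar>e x - e a\<bar> \<le> K * \<rho>" using False K by (intro mult_mono) auto
      moreover have "\<bar>T k x - T k a\<bar> \<le> \<bar>real k * (e x / 4) - real k * (e a / 4)\<bar>"
        unfolding T_def by linarith
      moreover have "\<bar>real k * (e x / 4) - real k * (e a / 4)\<bar> = real k * \<bar>e x - e a\<bar> / 4"
        by (simp add: abs_mult right_diff_distrib[symmetric] diff_divide_distrib[symmetric])
      ultimately show ?thesis using \<rho>(3) by simp
    qed
    have "\<exists>W\<in>\<W>. f k ` mball a \<rho> \<union> f (Suc k) ` mball a \<rho> \<subseteq> W" for k
    proof -
      obtain W where W2': "W \<in> \<W>" "\<forall>b\<in>mball a (e a). \<forall>s\<in>{0..1}. \<bar>s - T k a\<bar> < e a \<longrightarrow> H (b, s) \<in> W"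
        using bspec[OF e(2)[OF a, unfolded Q_def] T01[OF a, of k]] by (elim bexE) (rule that)
      note W2 = W2'(1) W2'(2)[rule_format]
      \<comment> \<open>The drift of at most \<open>e a / 4\<close> and one step of at most
        \<open>e a / 4\<close> together fit into the time window \<open>e a\<close> around
        \<open>T k a\<close>.\<close>
      have "f k x \<in> W \<and> f (Suc k) x \<in> W" if x: "x \<in> mball a \<rho>" for x
      proof -
        have xM: "x \<in> M" using x by auto
        have "x \<in> mball a (e a)" using x \<rho>(2) ea by auto
        moreover have "\<bar>T k x - T k a\<bar> < e a" using near[OF x, of k] ea by simp
        moreover have "\<bar>T (Suc k) x - T k a\<bar> < e a"
          using near[OF x, of "Suc k"] TS[OF a, of k] ea by linarith
        ultimately show ?thesis using T01[OF xM] by (auto simp: f_def intro!: W2(2))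
      qed
      with W2(1) show ?thesis by blast
    qed
    with \<rho>(1) show ?thesis by blast
  qed
  then obtain \<rho> where \<rho>: "\<And>a. a \<in> M \<Longrightarrow> \<rho> a > 0"
    "\<And>a k. a \<in> M \<Longrightarrow> \<exists>W\<in>\<W>. f k ` mball a (\<rho> a) \<union> f (Suc k) ` mball a (\<rho> a) \<subseteq> W"
    by metis
  have c: "(\<lambda>xs. AS_pullback_cochain q X (\<lambda>x. H (x, 1)) \<phi> xs - AS_pullback_cochain q X (\<lambda>x. H (x, 0)) \<phi> xs) \<in> AS_cochains q X"
    by (simp add: AS_cochains_def AS_pullback_cochain_def)
  show ?thesis
    unfolding AS_coboundaries_iff[OF c]
  proof (intro exI[of _ "prism_tower f N \<phi>"] exI[of _ "(\<lambda>a. mball a (\<rho> a)) ` M"] conjI ballI allI impI)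
    show "prism_tower f N \<phi> [] = 0" by (simp add: prism_tower_def)
    show "openin X U" if "U \<in> (\<lambda>a. mball a (\<rho> a)) ` M" for U using that by (auto simp: X_eq)
    show "topspace X = \<Union> ((\<lambda>a. mball a (\<rho> a)) ` M)" using \<rho>(1) by (auto simp: X_eq)
    fix U xs assume "U \<in> (\<lambda>a. mball a (\<rho> a)) ` M" and xs: "length xs = Suc q \<and> set xs \<subseteq> U"
    then obtain a where a: "a \<in> M" "U = mball a (\<rho> a)" by blast
    then have xM: "x \<in> M" if "x \<in> set xs" for x using xs that by auto
    have t: "xs \<in> AS_tuples q X" by (rule AS_tuplesI[of X U]) (use a xs in \<open>auto simp: X_eq\<close>)
    \<comment> \<open>Consecutive maps send the whole ball into one \<open>W\<close>, where
      \<open>\<phi>\<close> satisfies the cocycle identity. The two choices of \<open>g\<close>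
      cover both prisms in a summand of the tower.\<close>
    have z: "prism (f k) g xs (\<lambda>ys. face_sum ys \<phi>) = 0" if g: "g = f k \<or> g = f (Suc k)" for k g
    proof (rule prism_zero)
      fix ys assume ys: "length ys = Suc (length xs)" "set ys \<subseteq> f k ` set xs \<union> g ` set xs"
      obtain W where "W \<in> \<W>" "f k ` mball a (\<rho> a) \<union> f (Suc k) ` mball a (\<rho> a) \<subseteq> W"
        using \<rho>(2)[OF a(1)] by blast
      then show "face_sum ys \<phi> = 0"
        using ys xs g a(2) by (intro W(3)[of W]) (simp, simp, blast)
    qed
    have "face_sum xs (prism_tower f N \<phi>) + prism_tower f N (\<lambda>ys. face_sum ys \<phi>) xs =
      \<phi> (map (\<lambda>x. f (N x) x) xs) - \<phi> (map (f 0) xs)"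
    proof (rule prism_tower_identity)
      fix x k assume "x \<in> set xs" "N x \<le> k"
      with xM show "f k x = f (N x) x" using fN[of x k] fN[of x "N x"] by simp
    qed
    moreover have "prism_tower f N (\<lambda>ys. face_sum ys \<phi>) xs = 0"
      by (simp add: prism_tower_def z)
    moreover have "map (\<lambda>x. f (N x) x) xs = map (\<lambda>x. H (x, 1)) xs" using fN xM by simp
    moreover have "map (f 0) xs = map (\<lambda>x. H (x, 0)) xs" by (simp add: f_def T_def)
    ultimately show "AS_pullback_cochain q X (\<lambda>x. H (x, 1)) \<phi> xs - AS_pullback_cochain q X (\<lambda>x. H (x, 0)) \<phi> xs =
        face_sum xs (prism_tower f N \<phi>)"
      using t by (simp add: AS_pullback_cochain_def)
  qed
qed

text \<open>A possibly discontinuous retraction onto \<open>A\<close> that moves points only a little induces the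
  identity in cohomology near \<open>A\<close>.\<close>

lemma AS_tautness:
  fixes \<phi> :: "'a list \<Rightarrow> 'r::comm_ring_1"
  assumes X: "metrizable_space X" and A: "A \<subseteq> topspace X" and \<phi>: "\<phi> \<in> AS_cocycles q X"
    and triv: "AS_pullback_cochain q (subtopology X A) id \<phi> \<in> AS_coboundaries q (subtopology X A)"
  obtains \<phi>' \<V> where "\<phi>' \<in> AS_cocycles q X" "AS_class q X \<phi>' = AS_class q X \<phi>"
    "\<And>V. V \<in> \<V> \<Longrightarrow> openin X V" "A \<subseteq> \<Union>\<V>"
    "\<And>V xs. \<lbrakk>V \<in> \<V>; length xs = Suc q; set xs \<subseteq> V\<rbrakk> \<Longrightarrow> \<phi>' xs = 0"
proof -
  obtain M d where "Metric_space M d" and X_eq: "X = Metric_space.mtopology M d"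
    using X unfolding metrizable_space_def by blast
  then interpret Metric_space M d by simp
  have AM: "A \<subseteq> M" using A by (simp add: X_eq)
  have \<phi>c: "\<phi> \<in> AS_cochains q X" using \<phi> by (simp add: AS_cocycles_def)
  from \<phi>[unfolded AS_cocycles_iff[OF this]]
  obtain \<W> where W': "\<forall>W\<in>\<W>. openin X W" "topspace X = \<Union>\<W>"
      "\<forall>W\<in>\<W>. \<forall>xs. length xs = Suc (Suc q) \<and> set xs \<subseteq> W \<longrightarrow> face_sum xs \<phi> = 0"
    by (elim exE conjE) (rule that)
  note W = W'(1)[rule_format] W'(2) W'(3)[rule_format, OF _ conjI]
  from triv[unfolded AS_coboundaries_iff[OF AS_pullback_cochain_cochain]]
  obtain \<beta> \<U> where U': "\<beta> [] = 0" "\<forall>U\<in>\<U>. openin (subtopology X A) U" "topspace (subtopology X A) = \<Union>\<U>"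
     "\<forall>U\<in>\<U>. \<forall>xs. length xs = Suc q \<and> set xs \<subseteq> U \<longrightarrow>
        AS_pullback_cochain q (subtopology X A) id \<phi> xs = face_sum xs \<beta>"
    by (elim exE conjE) (rule that)
  have U: "\<phi> xs = face_sum xs \<beta>" if U: "U \<in> \<U>" and xs: "length xs = Suc q" "set xs \<subseteq> U" for U xs
    using U'(4)[rule_format, OF U conjI, OF xs] AS_tuplesI[OF U'(2)[rule_format, OF U] xs]
    by (simp add: AS_pullback_cochain_def)
  \<comment> \<open>Two requirements at once: \<open>\<phi>\<close> is a cocycle on small tuples of
    the ball, and on tuples of its trace on \<open>A\<close> it is the coboundary of
    \<open>\<beta>\<close>.\<close>
  define Q where "Q a r \<longleftrightarrow> (\<exists>W\<in>\<W>. mball a r \<subseteq> W) \<and> (\<exists>U\<in>\<U>. mball a r \<inter> A \<subseteq> U)" for a r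
  have Q_pos: "\<exists>r>0. Q a r" if a: "a \<in> A" for a
  proof -
    have "a \<in> \<Union>\<W>" using a A W(2) by blast
    then obtain W1 where W1: "W1 \<in> \<W>" "a \<in> W1" by (rule UnionE)
    have "a \<in> \<Union>\<U>" using a A unfolding U'(3)[symmetric] by auto
    then obtain U1 where U1: "U1 \<in> \<U>" "a \<in> U1" by (rule UnionE)
    obtain r1 where r1: "r1 > 0" "mball a r1 \<subseteq> W1"
      using W(1)[OF W1(1)] W1(2) unfolding X_eq openin_mtopology by blast
    obtain S where S: "openin X S" "U1 = S \<inter> A"
      using U'(2)[rule_format, OF U1(1)] unfolding openin_subtopology by blast
    obtain r2 where r2: "r2 > 0" "mball a r2 \<subseteq> S"
      using S U1(2) unfolding X_eq openin_mtopology by blast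
    have "mball a (min r1 r2) \<subseteq> W1" using r1(2) mball_subset_concentric[of "min r1 r2" r1 a] by simp
    moreover have "mball a (min r1 r2) \<inter> A \<subseteq> U1"
      using r2(2) mball_subset_concentric[of "min r1 r2" r2 a] S(2) by auto
    ultimately show ?thesis
      using W1(1) U1(1) r1(1) r2(1) unfolding Q_def by (intro exI[of _ "min r1 r2"]) auto
  qed
  have Q_shrink: "Q b s" if as: "a \<in> A" "b \<in> A" "Q a r" "0 < s" "d a b + s \<le> r" for a b r s
  proof -
    have "mball b s \<subseteq> mball a r" using as AM by (intro mball_subset) (auto simp: commute)
    with as(3) show ?thesis unfolding Q_def by (meson Int_mono order_refl order_trans)
  qed
  obtain e where e: "\<And>a. a \<in> A \<Longrightarrow> 0 < e a" "\<And>a. a \<in> A \<Longrightarrow> Q a (e a)"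
    "\<And>a b. a \<in> A \<Longrightarrow> b \<in> A \<Longrightarrow> e b \<le> e a + d a b"
    by (rule lipschitz_radius[of A Q, OF AM Q_pos Q_shrink]) (assumption+, rule that)
  \<comment> \<open>If \<open>x\<close> lies in \<open>V a\<close> and in \<open>V (f x)\<close>,
    then \<open>d a (f x) < e a / 8 + e (f x) / 8\<close>, and the Lipschitz bound on
    \<open>e (f x)\<close> turns this into \<open>d a (f x) < e a\<close>.\<close>
  define V where "V a = mball a (e a / 8)" for a
  define f where "f x = (if \<exists>a\<in>A. x \<in> V a then SOME a. a \<in> A \<and> x \<in> V a else x)" for x
  have f: "f x \<in> A \<and> x \<in> V (f x)" if "a \<in> A" "x \<in> V a" for a x
    using that someI[of "\<lambda>a. a \<in> A \<and> x \<in> V a" a] by (auto simp: f_def)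
  have near: "x \<in> mball a (e a) \<and> f x \<in> mball a (e a) \<inter> A" if a: "a \<in> A" and x: "x \<in> V a" for a x
  proof -
    have fA: "f x \<in> A" and fx: "x \<in> V (f x)" using f[OF a x] by auto
    have M: "a \<in> M" "x \<in> M" "f x \<in> M" using a fA x AM by (auto simp: V_def)
    have d1: "d a x < e a / 8" and d2: "d (f x) x < e (f x) / 8" using x fx by (auto simp: V_def)
    have "d a (f x) \<le> d a x + d (f x) x" using triangle[OF M] by (simp add: commute)
    then have "d a (f x) < e a" using d1 d2 e(3)[OF a fA] e(1)[OF a] by linarith
    moreover have "d a x < e a" using d1 e(1)[OF a] by linarith
    ultimately show ?thesis using M fA by simp
  qed
  \<comment> \<open>Near \<open>A\<close>, the prism between \<open>id\<close> and \<open>f\<close>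
    gives \<phi> = f^*\<phi> - dP\<phi>. As \<open>f\<close> sends these points into
    \<open>A\<close>, f^*\<phi> is the coboundary of \<open>\<beta>\<close> composed with
    \<open>map f\<close>, so \<open>\<beta>'\<close> is a primitive of \<open>\<phi>\<close> on
    small tuples.\<close>
  define \<beta>' where "\<beta>' ys = \<beta> (map f ys) - prism id f ys \<phi>" for ys
  have nil: "\<beta>' [] = 0" by (simp add: \<beta>'_def U'(1))
  have bd: "\<phi> xs = face_sum xs \<beta>'" if a: "a \<in> A" and xs: "length xs = Suc q" "set xs \<subseteq> V a" for a xs
  proof -
    obtain W1 U1 where W1: "W1 \<in> \<W>" "mball a (e a) \<subseteq> W1" and U1: "U1 \<in> \<U>" "mball a (e a) \<inter> A \<subseteq> U1"
      using e(2)[OF a] unfolding Q_def by blast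
    have xs_in: "set xs \<subseteq> W1" "f ` set xs \<subseteq> W1" "f ` set xs \<subseteq> U1"
      using near[OF a] xs(2) W1(2) U1(2) by blast+
    have "prism id f xs (\<lambda>ys. face_sum ys \<phi>) = 0"
    proof (rule prism_zero)
      fix ys assume "length ys = Suc (length xs)" "set ys \<subseteq> id ` set xs \<union> f ` set xs"
      then show "face_sum ys \<phi> = 0" using xs(1) xs_in by (intro W(3)[OF W1(1)]) auto
    qed
    with prism_identity[of xs id f \<phi>]
    have "\<phi> xs = \<phi> (map f xs) - face_sum xs (\<lambda>ys. prism id f ys \<phi>)" by simp
    also have "\<phi> (map f xs) = face_sum xs (\<lambda>ys. \<beta> (map f ys))"
      using U[OF U1(1), of "map f xs"] xs(1) xs_in(3) by (simp add: face_sum_map)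
    finally show ?thesis by (simp add: \<beta>'_def[abs_def] face_sum_diff id_def)
  qed
  \<comment> \<open>The coboundary of \<open>\<beta>'\<close> on all of \<open>X\<close>.
    Subtracting it preserves the class of \<open>\<phi>\<close> and makes the representative zero on
    tuples inside a single \<open>V a\<close>.\<close>
  define b where "b xs = (if xs \<in> AS_tuples q X then face_sum xs \<beta>' else 0)" for xs
  have b_cochain: "b \<in> AS_cochains q X" by (simp add: b_def AS_cochains_def)
  have b: "b \<in> AS_coboundaries q X"
    unfolding AS_coboundaries_iff[OF b_cochain]
    by (rule exI[of _ \<beta>'], rule exI[of _ "{topspace X}"]) (simp add: nil b_def AS_tuples_def)
  show thesis
  proof (rule that[of "\<lambda>xs. \<phi> xs + (-1) * b xs" "V ` A"])
    show "(\<lambda>xs. \<phi> xs + (-1) * b xs) \<in> AS_cocycles q X"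
      by (rule AS_cocycles_lincomb[OF \<phi>]) (use b AS_coboundaries_subset_cocycles in blast)
    show "AS_class q X (\<lambda>xs. \<phi> xs + (-1) * b xs) = AS_class q X \<phi>"
      using AS_coboundaries_lincomb[OF AS_coboundaries_locally_zero[OF AS_locally_zero_zero] b, of "-1"]
      by (intro AS_class_eqI) simp
    show V: "openin X V'" if "V' \<in> V ` A" for V' using that by (auto simp: V_def X_eq)
    show "A \<subseteq> \<Union> (V ` A)" using e(1) AM by (auto simp: V_def)
    fix V' xs assume V': "V' \<in> V ` A" and xs: "length xs = Suc q" "set xs \<subseteq> V'"
    then show "\<phi> xs + (-1) * b xs = 0"
      using bd AS_tuplesI[OF V[OF V'] xs] by (auto simp: b_def)
  qed
qed

section \<open>Products of classes that vanish near the members of a cover\<close>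

text \<open>The front and back faces of a tuple in \<open>V\<close> again lie in \<open>V\<close>,
  so a cup product vanishes wherever one factor does. In the induction the last factor handles the
  new family \<open>\<V> (Suc m)\<close> and the previous product handles the earlier ones.\<close>

lemma AS_cup_prod_eq_one:
  fixes \<phi> :: "nat \<Rightarrow> 'a list \<Rightarrow> 'r::comm_ring_1"
  assumes \<phi>: "\<And>i. i \<in> {1..n} \<Longrightarrow> \<phi> i \<in> AS_cocycles (k i) X"
    and a: "\<And>i. i \<in> {1..n} \<Longrightarrow> a i = AS_class (k i) X (\<phi> i)"
    and V: "\<And>i V. i \<in> {1..n} \<Longrightarrow> V \<in> \<V> i \<Longrightarrow> openin X V" "topspace X \<subseteq> (\<Union>i\<in>{1..n}. \<Union>(\<V> i))"
    and zero: "\<And>i V xs. \<lbrakk>i \<in> {1..n}; V \<in> \<V> i; length xs = Suc (k i); set xs \<subseteq> V\<rbrakk> \<Longrightarrow> \<phi> i xs = 0"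
  shows "AS_cup_prod X k a n = \<one>\<^bsub>AS_cohomology (\<Sum>i=1..n. k i) X\<^esub>"
proof -
  have "m \<le> n \<Longrightarrow> \<exists>\<Phi>\<in>AS_cocycles (\<Sum>i=1..m. k i) X. AS_cup_prod X k a m = AS_class (\<Sum>i=1..m. k i) X \<Phi> \<and>
    (\<forall>i\<in>{1..m}. \<forall>V\<in>\<V> i. \<forall>xs. length xs = Suc (\<Sum>i=1..m. k i) \<longrightarrow> set xs \<subseteq> V \<longrightarrow> \<Phi> xs = 0)" for m
  proof (induction m)
    case 0
    show ?case using AS_unit_cocycle by (intro bexI) (auto simp: AS_unit_def)
  next
    case (Suc m)
    let ?s = "\<Sum>i=1..m. k i"
    from Suc.IH[OF Suc_leD[OF Suc.prems]]
    obtain \<Phi> where \<Phi>': "\<Phi> \<in> AS_cocycles ?s X" "AS_cup_prod X k a m = AS_class ?s X \<Phi>"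
      "\<forall>i\<in>{1..m}. \<forall>V\<in>\<V> i. \<forall>xs. length xs = Suc ?s \<longrightarrow> set xs \<subseteq> V \<longrightarrow> \<Phi> xs = 0"
      by (elim bexE conjE) (rule that)
    note \<Phi> = \<Phi>'(1,2) \<Phi>'(3)[rule_format]
    have m: "Suc m \<in> {1..n}" using Suc.prems by simp
    show ?case
    proof (intro bexI conjI ballI allI impI)
      show "AS_cup_cochain ?s \<Phi> (\<phi> (Suc m)) \<in> AS_cocycles (\<Sum>i=1..Suc m. k i) X"
        using AS_cup_cocycles[OF \<Phi>(1) \<phi>[OF m]] by simp
      show "AS_cup_prod X k a (Suc m) = AS_class (\<Sum>i=1..Suc m. k i) X (AS_cup_cochain ?s \<Phi> (\<phi> (Suc m)))"
        using AS_cup_class[OF \<Phi>(1) \<phi>[OF m]] by (simp add: \<Phi>(2)[simplified] a[OF m])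
      fix i V xs assume i: "i \<in> {1..Suc m}" "V \<in> \<V> i" and xs: "length xs = Suc (\<Sum>i=1..Suc m. k i)" "set xs \<subseteq> V"
      have sub: "set (take (Suc ?s) xs) \<subseteq> V" "set (drop ?s xs) \<subseteq> V"
        using xs(2) set_take_subset set_drop_subset by fast+
      show "AS_cup_cochain ?s \<Phi> (\<phi> (Suc m)) xs = 0"
      proof (cases "i = Suc m")
        case True
        then show ?thesis
          using zero[OF m _ _ sub(2)] i(2) xs(1) by (simp add: AS_cup_cochain_def)
      next
        case False
        then show ?thesis
          using \<Phi>(3)[OF _ i(2) _ sub(1)] i(1) xs(1) by (simp add: AS_cup_cochain_def)
      qed
    qed
  qed
  from this[OF order_refl] obtain \<Phi> where \<Phi>': "\<Phi> \<in> AS_cocycles (\<Sum>i=1..n. k i) X"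
    "AS_cup_prod X k a n = AS_class (\<Sum>i=1..n. k i) X \<Phi>"
    "\<forall>i\<in>{1..n}. \<forall>V\<in>\<V> i. \<forall>xs. length xs = Suc (\<Sum>i=1..n. k i) \<longrightarrow> set xs \<subseteq> V \<longrightarrow> \<Phi> xs = 0"
    by (elim bexE conjE) (rule that)
  note \<Phi> = \<Phi>'(1,2) \<Phi>'(3)[rule_format]
  have "\<Phi> \<in> AS_locally_zero (\<Sum>i=1..n. k i) X"
  proof (rule AS_locally_zeroI[of _ _ _ "\<Union>i\<in>{1..n}. \<V> i"])
    show "\<Phi> \<in> AS_cochains (\<Sum>i=1..n. k i) X" using \<Phi>(1) by (simp add: AS_cocycles_def)
    show op: "openin X U" if "U \<in> (\<Union>i\<in>{1..n}. \<V> i)" for U using that V(1) by blast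
    have "\<Union> (\<Union>i\<in>{1..n}. \<V> i) \<subseteq> topspace X" by (rule Union_least) (rule openin_subset[OF op])
    moreover have "topspace X \<subseteq> \<Union> (\<Union>i\<in>{1..n}. \<V> i)" using V(2) by (fastforce dest: subsetD)
    ultimately show "topspace X = \<Union> (\<Union>i\<in>{1..n}. \<V> i)" by (rule subset_antisym[rotated])
    show "\<Phi> xs = 0" if "U \<in> (\<Union>i\<in>{1..n}. \<V> i)" "length xs = Suc (\<Sum>i=1..n. k i)" "set xs \<subseteq> U" for U xs
      using that(1) by (elim UN_E) (rule \<Phi>(3)[OF _ _ that(2,3)])
  qed
  then show ?thesis
    by (simp add: \<Phi>(2) AS_class_eq_one AS_coboundaries_locally_zero)
qed


section \<open>Measures with a fixed number of support points\<close>

text \<open>If \<open>\<nu>\<close> is closer to \<open>\<mu>\<close> than the mass of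
  \<open>x\<close>, the ball around \<open>x\<close> must carry positive \<open>\<nu>\<close>-mass.
  The support is finite, so the least mass gives one \<open>\<epsilon>\<close> for all its
  points.\<close>

lemma Levy_Prokhorov_support:
  assumes \<mu>: "\<mu> \<in> mspace (fin_supp_measures k m)" and \<eta>: "\<eta> > 0"
  obtains \<epsilon> where "\<epsilon> > 0"
    "\<And>\<nu> x. \<lbrakk>Levy_Prokhorov_dist m \<mu> \<nu> < \<epsilon>; x \<in> set_pmf \<mu>\<rbrakk> \<Longrightarrow> \<exists>y\<in>set_pmf \<nu>. mdist m x y < \<eta>"
proof -
  interpret M: Metric_space "mspace m" "mdist m" by simp
  have sub: "set_pmf \<mu> \<subseteq> mspace m" and fin: "finite (set_pmf \<mu>)" using \<mu> by auto
  define \<epsilon> where "\<epsilon> = Min (insert \<eta> (pmf \<mu> ` set_pmf \<mu>))"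
  have "\<epsilon> > 0" unfolding \<epsilon>_def using fin \<eta> by (subst Min_gr_iff) (auto simp: pmf_positive)
  moreover have "\<exists>y\<in>set_pmf \<nu>. mdist m x y < \<eta>"
    if lp: "Levy_Prokhorov_dist m \<mu> \<nu> < \<epsilon>" and x: "x \<in> set_pmf \<mu>" for \<nu> x
  proof (rule ccontr)
    assume far: "\<not> (\<exists>y\<in>set_pmf \<nu>. mdist m x y < \<eta>)"
    \<comment> \<open>The number 1 is always admissible in the Levy-Prokhorov infimum, so the set is
      nonempty and contains some \<open>\<delta> < \<epsilon>\<close>.\<close>
    have "measure_pmf.prob \<mu> A \<le> measure_pmf.prob \<nu> B + 1" for \<mu> \<nu> :: "'a pmf" and A B
      using measure_pmf.prob_le_1[of \<mu> A] measure_nonneg[of "measure_pmf \<nu>" B] by linarith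
    then have "1 \<in> {\<epsilon>. \<epsilon> > 0 \<and>
         (\<forall>A \<in> sigma_sets (mspace m) {U. openin (mtopology_of m) U}.
            measure_pmf.prob \<mu> A \<le> measure_pmf.prob \<nu> (\<Union>a\<in>A. mball_of m a \<epsilon>) + \<epsilon> \<and>
            measure_pmf.prob \<nu> A \<le> measure_pmf.prob \<mu> (\<Union>a\<in>A. mball_of m a \<epsilon>) + \<epsilon>)}" by simp
    from cInf_lessD[OF _ lp[unfolded Levy_Prokhorov_dist_def]] this
    obtain \<delta> where \<delta>: "\<delta> < \<epsilon>" "\<And>A. A \<in> sigma_sets (mspace m) {U. openin (mtopology_of m) U} \<Longrightarrow>
            measure_pmf.prob \<mu> A \<le> measure_pmf.prob \<nu> (\<Union>a\<in>A. mball_of m a \<delta>) + \<delta>" by blast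
    have "openin (mtopology_of m) (mspace m - {x})"
      using M.t1_space_mtopology x sub t1_space_openin_delete_alt
      by (metis M.topspace_mtopology mtopology_of_def openin_topspace)
    then have "mspace m - (mspace m - {x}) \<in> sigma_sets (mspace m) {U. openin (mtopology_of m) U}"
      by (intro sigma_sets.Compl sigma_sets.Basic) simp
    moreover have "mspace m - (mspace m - {x}) = {x}" using x sub by auto
    ultimately have "measure_pmf.prob \<mu> {x} \<le> measure_pmf.prob \<nu> (mball_of m x \<delta>) + \<delta>"
      using \<delta>(2)[of "{x}"] by simp
    moreover have "\<epsilon> \<le> \<eta>" "\<epsilon> \<le> pmf \<mu> x" unfolding \<epsilon>_def using fin x by auto
    moreover from this(1) have "measure_pmf.prob \<nu> (mball_of m x \<delta>) = 0"
      using far \<delta>(1) by (subst measure_pmf_zero_iff) (force simp: mball_of_def)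
    ultimately show False using \<delta>(1) by (simp add: measure_pmf_single)
  qed
  ultimately show thesis by (rule that)
qed

lemma permutation_orbit_comp:
  assumes "\<tau> permutes {..<k}"
  shows "permutation_orbit k (x \<circ> \<tau>) = permutation_orbit k x"
proof -
  have sub: "permutation_orbit k (x \<circ> \<tau>) \<subseteq> permutation_orbit k x" if "\<tau> permutes {..<k}" for x :: "nat \<Rightarrow> 'a" and \<tau>
    using permutes_compose[OF _ that] by (auto simp: permutation_orbit_def comp_assoc)
  obtain \<tau>' where "\<tau>' permutes {..<k}" "\<tau> \<circ> \<tau>' = id"
    using permutes_inv[OF assms] permutes_inv_o(1)[OF assms] by blast
  with sub[of \<tau>' "x \<circ> \<tau>"] sub[OF assms, of x] show ?thesis by (simp add: comp_assoc)
qed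

lemma continuous_map_symmetric_diagonal:
  "continuous_map X (symmetric_product k X) (symmetric_diagonal k)"
proof -
  have "continuous_map (product_topology (\<lambda>_. X) {..<k}) (symmetric_product k X) (permutation_orbit k)"
    unfolding symmetric_product_def
    by (rule quotient_imp_continuous_map[OF quotient_map_quotient_topology])
  moreover have "continuous_map X (product_topology (\<lambda>_. X) {..<k}) (\<lambda>x. \<lambda>i\<in>{..<k}. x)"
    by (auto simp: continuous_map_componentwise)
  ultimately have "continuous_map X (symmetric_product k X) (permutation_orbit k \<circ> (\<lambda>x. \<lambda>i\<in>{..<k}. x))"
    using continuous_map_compose by blast
  then show ?thesis by (simp add: symmetric_diagonal_def[abs_def] o_def)
qed

text \<open>\<open>\<sigma>\<close> acts inside each block of length \<open>i\<close>; divisibility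
  makes the last block complete. It carries a permutation of \<open>i\<close> support points over to
  the list of their \<open>N\<close> repetitions.\<close>

lemma block_permutes:
  fixes \<sigma> :: "nat \<Rightarrow> nat"
  assumes i: "i > 0" "i dvd N" and \<sigma>: "inj_on \<sigma> {..<i}" "\<sigma> ` {..<i} \<subseteq> {..<i}"
  shows "(\<lambda>j. if j < N then i * (j div i) + \<sigma> (j mod i) else j) permutes {..<N}" (is "?\<tau> permutes _")
proof (rule bij_imp_permutes)
  have lt: "\<sigma> (j mod i) < i" for j using \<sigma>(2) mod_less_divisor[OF i(1), of j] by auto
  obtain c where c: "N = i * c" using i(2) by blast
  have dm: "(i * (j div i) + \<sigma> (j mod i)) div i = j div i" "(i * (j div i) + \<sigma> (j mod i)) mod i = \<sigma> (j mod i)" for j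
    using lt[of j] i by simp_all
  have "?\<tau> j < N" if "j < N" for j
  proof -
    have "j div i < c" using that c i(1) by (simp add: less_mult_imp_div_less mult.commute)
    then have "i * (j div i) + i \<le> i * c" by (metis Suc_leI mult.commute mult_Suc mult_le_mono2 add.commute)
    then show ?thesis using lt[of j] that c by simp
  qed
  then have sub: "?\<tau> ` {..<N} \<subseteq> {..<N}" by blast
  have inj: "inj_on ?\<tau> {..<N}"
  proof (rule inj_onI)
    fix j j' assume "j \<in> {..<N}" "j' \<in> {..<N}" "?\<tau> j = ?\<tau> j'"
    then have eq: "i * (j div i) + \<sigma> (j mod i) = i * (j' div i) + \<sigma> (j' mod i)" by simp
    then have "j div i = j' div i" "\<sigma> (j mod i) = \<sigma> (j' mod i)" using dm by metis+
    moreover from this(2) have "j mod i = j' mod i"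
      using inj_onD[OF \<sigma>(1)] i(1) by simp
    ultimately show "j = j'" by (metis mult_div_mod_eq)
  qed
  show "bij_betw ?\<tau> {..<N} {..<N}"
    unfolding bij_betw_def using inj endo_inj_surj[OF _ sub inj] by simp
qed simp

text \<open>On the set where the support of \<open>s z\<close> has exactly \<open>i\<close> points these points move continuously,
  up to a permutation, so listing each of them \<open>N / i\<close> times gives a continuous map to the
  symmetric product.\<close>

lemma continuous_map_support_orbit:
  assumes s: "continuous_map Z (mtopology_of (fin_supp_measures l m)) s"
    and \<gamma>: "\<And>z. z \<in> topspace Z \<Longrightarrow> bij_betw (\<gamma> z) {..<i} (set_pmf (s z))" and i: "i dvd N"
    and g: "continuous_map (prod_topology (mtopology_of m) T) Y g"
  shows "continuous_map (prod_topology Z T) (symmetric_product N Y)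
    (\<lambda>(z, t). permutation_orbit N (\<lambda>j\<in>{..<N}. g (\<gamma> z (j mod i), t)))"
proof -
  define y where "y z t = (\<lambda>j\<in>{..<N}. g (\<gamma> z (j mod i), t))" for z t
  interpret M: Metric_space "mspace m" "mdist m" by simp
  interpret L: Metric_space "mspace (fin_supp_measures l m)" "mdist (fin_supp_measures l m)"
    by (rule Metric_space_mspace_mdist)
  have s_in: "s z \<in> mspace (fin_supp_measures l m)" if "z \<in> topspace Z" for z
    using continuous_map_image_subset_topspace[OF s] that by auto
  have ipos: "i > 0" if "z \<in> topspace Z" for z
    using \<gamma>[OF that] set_pmf_not_empty[of "s z"] by (cases "i = 0") (auto simp: bij_betw_def)
  have \<gamma>_in: "\<gamma> z a \<in> mspace m" if "z \<in> topspace Z" "a < i" for z a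
    using s_in[OF that(1)] bij_betwE[OF \<gamma>[OF that(1)]] that(2) by auto
  have y_in: "y z t \<in> topspace (product_topology (\<lambda>_. Y) {..<N})" if "z \<in> topspace Z" "t \<in> topspace T" for z t
  proof -
    have "g (\<gamma> z (j mod i), t) \<in> topspace Y" for j
      using continuous_map_image_subset_topspace[OF g] \<gamma>_in[OF that(1)] ipos[OF that(1)] that(2) by auto
    then show ?thesis by (auto simp: y_def)
  qed
  have "\<exists>S. openin (prod_topology Z T) S \<and> x \<in> S \<and>
      S \<subseteq> {x \<in> topspace (prod_topology Z T). (\<lambda>(z, t). permutation_orbit N (y z t)) x \<in> W}"
    if W: "openin (symmetric_product N Y) W" and x: "x \<in> topspace (prod_topology Z T)"
      "(\<lambda>(z, t). permutation_orbit N (y z t)) x \<in> W" for W x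
  proof -
    obtain z0 t0 where x_eq: "x = (z0, t0)" by (cases x)
    have z0: "z0 \<in> topspace Z" and t0: "t0 \<in> topspace T" and y0W: "permutation_orbit N (y z0 t0) \<in> W"
      using x by (auto simp: x_eq)
    have i0: "i > 0" by (rule ipos[OF z0])
    have "openin (product_topology (\<lambda>_. Y) {..<N})
        {y \<in> topspace (product_topology (\<lambda>_. Y) {..<N}). permutation_orbit N y \<in> W}" (is "openin _ ?P")
      using W unfolding symmetric_product_def openin_quotient_topology by blast
    moreover have "y z0 t0 \<in> ?P" using y_in[OF z0 t0] y0W by simp
    ultimately obtain U where U': "\<forall>j\<in>{..<N}. openin Y (U j)" "y z0 t0 \<in> Pi\<^sub>E {..<N} U" "Pi\<^sub>E {..<N} U \<subseteq> ?P"
      unfolding openin_product_topology_alt by (elim ballE[of _ _ "y z0 t0"]) (elim exE conjE, rule that, assumption+, contradiction)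
    have U: "openin Y (U j)" if "j < N" for j using U'(1) that by simp
    note U = this U'(2,3)
    have "\<exists>\<eta> V. \<eta> > 0 \<and> openin T V \<and> t0 \<in> V \<and>
        (\<forall>x t. x \<in> M.mball (\<gamma> z0 (j mod i)) \<eta> \<longrightarrow> t \<in> V \<longrightarrow> g (x, t) \<in> U j)" if j: "j < N" for j
    proof -
      have "openin (prod_topology (mtopology_of m) T) {x \<in> topspace (prod_topology (mtopology_of m) T). g x \<in> U j}"
        (is "openin _ ?Q") by (rule openin_continuous_map_preimage[OF g U(1)[OF j]])
      moreover have "(\<gamma> z0 (j mod i), t0) \<in> ?Q"
        using \<gamma>_in[OF z0, of "j mod i"] i0 t0 U(2) j by (auto simp: y_def PiE_iff)
      ultimately obtain C V where CV: "openin (mtopology_of m) C" "openin T V" "\<gamma> z0 (j mod i) \<in> C" "t0 \<in> V" "C \<times> V \<subseteq> ?Q"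
        unfolding openin_prod_topology_alt by meson
      obtain \<eta> where "\<eta> > 0" "M.mball (\<gamma> z0 (j mod i)) \<eta> \<subseteq> C"
        using CV(1,3) unfolding mtopology_of_def M.openin_mtopology by blast
      with CV show ?thesis by blast
    qed
    then obtain \<eta>' V where \<eta>': "\<And>j. j < N \<Longrightarrow> \<eta>' j > 0" "\<And>j. j < N \<Longrightarrow> openin T (V j)" "\<And>j. j < N \<Longrightarrow> t0 \<in> V j"
      "\<And>j x t. j < N \<Longrightarrow> x \<in> M.mball (\<gamma> z0 (j mod i)) (\<eta>' j) \<Longrightarrow> t \<in> V j \<Longrightarrow> g (x, t) \<in> U j"
      by metis
    \<comment> \<open>Half the distances between distinct support points of \<open>s z0\<close>.
      With \<open>\<eta>\<close> below them, one point of \<open>s z\<close> cannot be close to two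
      of these.\<close>
    define D where "D = (\<lambda>(a, b). mdist m (\<gamma> z0 a) (\<gamma> z0 b) / 2) ` {(a, b). a < i \<and> b < i \<and> a \<noteq> b}"
    define \<eta> where "\<eta> = Min (insert 1 (\<eta>' ` {..<N} \<union> D))"
    have "finite {(a, b). a < i \<and> b < i \<and> a \<noteq> b}"
      by (rule finite_subset[of _ "{..<i} \<times> {..<i}"]) auto
    then have fin: "finite (insert 1 (\<eta>' ` {..<N} \<union> D))" by (simp add: D_def)
    have inj0: "\<gamma> z0 a \<noteq> \<gamma> z0 b" if "a < i" "b < i" "a \<noteq> b" for a b
      using \<gamma>[OF z0] that by (auto simp: bij_betw_def inj_on_def)
    have "mdist m (\<gamma> z0 a) (\<gamma> z0 b) > 0" if "a < i" "b < i" "a \<noteq> b" for a b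
      using inj0[OF that] \<gamma>_in[OF z0] that by (simp add: order_less_le)
    then have "\<eta> > 0" unfolding \<eta>_def using fin \<eta>'(1) by (subst Min_gr_iff) (auto simp: D_def)
    have \<eta>_le: "\<eta> \<le> \<eta>' j" if "j < N" for j unfolding \<eta>_def using fin that by (intro Min_le) auto
    have \<eta>_D: "2 * \<eta> \<le> mdist m (\<gamma> z0 a) (\<gamma> z0 b)" if "a < i" "b < i" "a \<noteq> b" for a b
    proof -
      have "\<eta> \<le> mdist m (\<gamma> z0 a) (\<gamma> z0 b) / 2"
        unfolding \<eta>_def using fin that by (intro Min_le) (force simp: D_def)+
      then show ?thesis by simp
    qed
    obtain \<epsilon> where \<epsilon>: "\<epsilon> > 0"
      "\<And>\<nu> x. \<lbrakk>Levy_Prokhorov_dist m (s z0) \<nu> < \<epsilon>; x \<in> set_pmf (s z0)\<rbrakk> \<Longrightarrow> \<exists>y\<in>set_pmf \<nu>. mdist m x y < \<eta>"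
      using Levy_Prokhorov_support[OF s_in[OF z0] \<open>\<eta> > 0\<close>] by blast
    define S where "S = {z \<in> topspace Z. s z \<in> L.mball (s z0) \<epsilon>}"
    have S: "openin Z S"
      unfolding S_def by (rule openin_continuous_map_preimage[OF s]) (simp only: mtopology_of_def L.openin_mball)
    have z0S: "z0 \<in> S" unfolding S_def using z0 s_in[OF z0] \<epsilon>(1) L.centre_in_mball_iff by blast
    \<comment> \<open>The factor \<open>topspace T\<close> gives an open set also for
      \<open>N = 0\<close>, where the intersection has no members.\<close>
    define V' where "V' = topspace T \<inter> (\<Inter>j\<in>{..<N}. V j)"
    have V': "openin T V'" "t0 \<in> V'"
      unfolding V'_def using \<eta>'(2,3) t0 by (cases "N = 0", auto intro!: openin_Int openin_INT2)
    have "permutation_orbit N (y z t) \<in> W" if z: "z \<in> S" and t: "t \<in> V'" for z t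
    proof -
      have zZ: "z \<in> topspace Z" using z by (simp add: S_def)
      have lp: "Levy_Prokhorov_dist m (s z0) (s z) < \<epsilon>"
      proof -
        have "s z \<in> L.mball (s z0) \<epsilon>" using z by (simp only: S_def mem_Collect_eq)
        then have "mdist (fin_supp_measures l m) (s z0) (s z) < \<epsilon>" by (simp only: L.in_mball)
        then show ?thesis by simp
      qed
      \<comment> \<open>Only this direction comes from the metric. The choice of
        \<open>\<eta>\<close> makes the resulting \<open>\<sigma>\<close> injective, and since both
        supports have \<open>i\<close> points it is a permutation.\<close>
      have "\<exists>b<i. mdist m (\<gamma> z0 a) (\<gamma> z b) < \<eta>" if a: "a < i" for a
        using \<epsilon>(2)[OF lp, of "\<gamma> z0 a"] \<gamma>[OF z0] \<gamma>[OF zZ] a unfolding bij_betw_def by (metis (no_types, lifting) imageE imageI lessThan_iff)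
      then obtain \<sigma> where \<sigma>: "\<And>a. a < i \<Longrightarrow> \<sigma> a < i" "\<And>a. a < i \<Longrightarrow> mdist m (\<gamma> z0 a) (\<gamma> z (\<sigma> a)) < \<eta>"
        by metis
      have inj: "inj_on \<sigma> {..<i}"
      proof (rule inj_onI, rule ccontr)
        fix a b assume ab: "a \<in> {..<i}" "b \<in> {..<i}" "\<sigma> a = \<sigma> b" "a \<noteq> b"
        then have "mdist m (\<gamma> z0 a) (\<gamma> z0 b) \<le> mdist m (\<gamma> z0 a) (\<gamma> z (\<sigma> a)) + mdist m (\<gamma> z (\<sigma> a)) (\<gamma> z0 b)"
          using \<gamma>_in[OF z0] \<gamma>_in[OF zZ] \<sigma>(1) by (intro M.triangle) auto
        also have "mdist m (\<gamma> z (\<sigma> a)) (\<gamma> z0 b) = mdist m (\<gamma> z0 b) (\<gamma> z (\<sigma> b))"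
          using ab by (simp add: M.commute)
        finally show False using \<sigma>(2)[of a] \<sigma>(2)[of b] \<eta>_D[of a b] ab by simp
      qed
      define \<tau> where "\<tau> j = (if j < N then i * (j div i) + \<sigma> (j mod i) else j)" for j
      have \<tau>: "\<tau> permutes {..<N}"
        unfolding \<tau>_def[abs_def] by (rule block_permutes[OF i0 i inj]) (use \<sigma>(1) in auto)
      \<comment> \<open>The enumerations \<open>\<gamma> z\<close> need not vary continuously with
        \<open>z\<close>; after reordering by \<open>\<tau>\<close>, which leaves the orbit
        unchanged, the list lies in the box around \<open>y z0 t0\<close>.\<close>
      have "y z t \<circ> \<tau> \<in> Pi\<^sub>E {..<N} U"
      proof (rule PiE_I)
        fix j assume "j \<in> {..<N}"
        then have j: "j < N" by simp
        have a: "j mod i < i" using i0 by simp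
        have "\<tau> j < N" using permutes_in_image[OF \<tau>, of j] j by simp
        moreover have "\<tau> j mod i = \<sigma> (j mod i)" using j \<sigma>(1)[OF a] by (simp add: \<tau>_def)
        ultimately have "(y z t \<circ> \<tau>) j = g (\<gamma> z (\<sigma> (j mod i)), t)" by (simp add: y_def)
        also have "\<dots> \<in> U j"
        proof (rule \<eta>'(4)[OF j])
          show "\<gamma> z (\<sigma> (j mod i)) \<in> M.mball (\<gamma> z0 (j mod i)) (\<eta>' j)"
            using \<gamma>_in[OF z0 a] \<gamma>_in[OF zZ \<sigma>(1)[OF a]] \<sigma>(2)[OF a] \<eta>_le[OF j] by simp
          show "t \<in> V j" using t j by (simp add: V'_def)
        qed
        finally show "(y z t \<circ> \<tau>) j \<in> U j" .
      next
        fix j assume "j \<notin> {..<N}"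
        then show "(y z t \<circ> \<tau>) j = undefined" by (simp add: \<tau>_def y_def)
      qed
      then have "permutation_orbit N (y z t \<circ> \<tau>) \<in> W" using U(3) by blast
      then show ?thesis by (simp add: permutation_orbit_comp[OF \<tau>])
    qed
    then have "S \<times> V' \<subseteq> {x \<in> topspace (prod_topology Z T). (\<lambda>(z, t). permutation_orbit N (y z t)) x \<in> W}"
      using openin_subset[OF S] openin_subset[OF V'(1)] by auto
    then show ?thesis
      using S V' z0S by (intro exI[of _ "S \<times> V'"]) (simp add: x_eq openin_prod_Times_iff)
  qed
  moreover have "permutation_orbit N (y z t) \<in> topspace (symmetric_product N Y)"
    if "z \<in> topspace Z" "t \<in> topspace T" for z t
    using y_in[OF that] by (simp add: symmetric_product_def)
  ultimately have "continuous_map (prod_topology Z T) (symmetric_product N Y) (\<lambda>(z, t). permutation_orbit N (y z t))"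
    unfolding continuous_map
    by (intro conjI allI impI, force, subst openin_subopen, blast)
  then show ?thesis by (simp add: y_def)
qed


section \<open>The lower bound\<close>

lemma metrizable_space_fibrewise_power: "metrizable_space (fibrewise_power r (mtopology_of E) p)"
  unfolding fibrewise_power_def
  by (intro metrizable_space_subtopology)
    (simp add: metrizable_space_product_topology mtopology_of_def Metric_space.metrizable_space_mtopology)

text \<open>The deformation \<open>t \<mapsto> (\<gamma> ((1 - t) j / (r - 1)))\<^sub>j\<close> joins \<open>\<Pi>\<^sub>r \<gamma>\<close> to the diagonal point of \<open>\<gamma> 0\<close>
  inside \<open>E\<^sup>r\<^sub>B\<close>.\<close>

lemma continuous_map_path_contraction:
  "continuous_map (prod_topology (mtopology_of (fibrewise_path_space E p)) unit_interval)
     (fibrewise_power r (mtopology_of E) p)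
     (\<lambda>(\<gamma>, t). \<lambda>j\<in>{..<r}. \<gamma> ((1 - t) * (real j / real (r - 1))))" (is "continuous_map (prod_topology ?P ?I) _ ?g")
proof -
  \<comment> \<open>For \<open>r = 1\<close> the only quotient is 0 / 0, which is 0 and still lies
    in the interval.\<close>
  have frac: "real j / real (r - 1) \<in> {0..1}" if "j < r" for j
    using that by (cases "r - 1 = 0") (auto simp: divide_le_eq_1)
  have sc: "(1 - t) * c \<in> {0..1}" if "t \<in> {0..1}" "c \<in> {0..1}" for t c :: real
    using that mult_mono[of "1 - t" 1 c 1] by auto
  have P: "?P = subtopology (compact_open_topology ?I (mtopology_of E)) {\<gamma>. (p \<circ> \<gamma>) constant_on {0..1}}"
    by (rule mtopology_of_fibrewise_path_space)
  have "continuous_map (prod_topology ?P ?I) (mtopology_of E) (\<lambda>x. fst x ((1 - snd x) * (real j / real (r - 1))))"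
    if j: "j < r" for j
  proof -
    have 1: "continuous_map (prod_topology ?P ?I) (compact_open_topology ?I (mtopology_of E)) fst"
      unfolding P by (rule continuous_map_compose[of _ _ fst _ id, unfolded id_comp, OF continuous_map_fst continuous_map_from_subtopology[OF continuous_map_id]])
    have "continuous_map ?I euclideanreal (\<lambda>t. (1 - t) * c)" for c :: real
      unfolding continuous_map_iff_continuous by (intro continuous_intros)
    then have "continuous_map ?I ?I (\<lambda>t. (1 - t) * c)" if "c \<in> {0..1}" for c :: real
      using sc[OF _ that] by (auto simp: continuous_map_in_subtopology)
    from continuous_map_compose[OF continuous_map_snd this[OF frac[OF j]]]
    have 2: "continuous_map (prod_topology ?P ?I) ?I (\<lambda>x. (1 - snd x) * (real j / real (r - 1)))"
      by (simp add: o_def)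
    from continuous_map_compose[OF continuous_map_pairedI[OF 1 2] continuous_map_eval_unit_interval]
    show ?thesis by (simp add: o_def)
  qed
  then have "continuous_map (prod_topology ?P ?I) (product_topology (\<lambda>_. mtopology_of E) {..<r}) ?g"
    unfolding continuous_map_componentwise by (simp add: case_prod_beta image_subset_iff)
  moreover have "?g x \<in> {e. \<forall>i<r. \<forall>j<r. p (e i) = p (e j)}" if x: "x \<in> topspace (prod_topology ?P ?I)" for x
  proof -
    obtain \<gamma> t where x_eq: "x = (\<gamma>, t)" by (cases x)
    have "(p \<circ> \<gamma>) constant_on {0..1}" and t: "t \<in> {0..1}" using x unfolding P by (auto simp: x_eq)
    then obtain c where c: "\<forall>u\<in>{0..1}. p (\<gamma> u) = c" unfolding constant_on_def by auto
    have "p (?g x j) = c" if "j < r" for j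
      using bspec[OF c sc[OF t frac[OF that]]] that by (simp add: x_eq)
    then show ?thesis by simp
  qed
  ultimately show ?thesis
    unfolding fibrewise_power_def continuous_map_in_subtopology by blast
qed

text \<open>Contracting the support paths deforms the diagonal embedding into a map that factors
  through the fibrewise diagonal, where the class is assumed trivial. The condition
  \<open>i dvd N\<close> makes the multiplicity of each support point an integer.\<close>

lemma AS_symmetric_diagonal_on_stratum:
  fixes \<phi> :: "(nat \<Rightarrow> nat \<Rightarrow> 'a) set list \<Rightarrow> 'r::comm_ring_1"
  assumes ErB_def: "ErB = fibrewise_power r (mtopology_of E) p" and r: "r > 0"
    and s: "continuous_map ErB (mtopology_of (fin_supp_measures l (fibrewise_path_space E p))) s"
    and s_supp: "\<And>y. y \<in> topspace ErB \<Longrightarrow> set_pmf (s y) \<subseteq> path_evaluation r -` {y}"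
    and A: "A = {y \<in> topspace ErB. card (set_pmf (s y)) = i}" and i: "i dvd N"
    and \<phi>: "\<phi> \<in> AS_cocycles q (symmetric_product N ErB)"
    and diagonal: "AS_pullback_cochain q (mtopology_of E) (fibrewise_diagonal r)
        (AS_pullback_cochain q ErB (symmetric_diagonal N) \<phi>) \<in> AS_coboundaries q (mtopology_of E)"
  shows "AS_pullback_cochain q (subtopology ErB A) (symmetric_diagonal N) \<phi> \<in> AS_coboundaries q (subtopology ErB A)"
proof -
  let ?Z = "subtopology ErB A" and ?P = "fibrewise_path_space E p"
  define g where "g = (\<lambda>(\<gamma>, t). \<lambda>j\<in>{..<r}. \<gamma> ((1 - t) * (real j / real (r - 1))) :: 'a)"
  have topZ: "topspace ?Z = A" using A by auto
  have s_in: "s z \<in> mspace (fin_supp_measures l ?P)" if "z \<in> A" for z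
    using continuous_map_image_subset_topspace[OF s] that A by auto
  have "\<exists>\<gamma>. bij_betw \<gamma> {..<i} (set_pmf (s z))" if z: "z \<in> A" for z
  proof -
    have "finite (set_pmf (s z))" using s_in[OF z] by simp
    from ex_bij_betw_nat_finite[OF this] show ?thesis using z by (auto simp: A atLeast0LessThan)
  qed
  then obtain \<gamma> where \<gamma>: "\<And>z. z \<in> A \<Longrightarrow> bij_betw (\<gamma> z) {..<i} (set_pmf (s z))" by metis
  define H where "H = (\<lambda>(z, t). permutation_orbit N (\<lambda>j\<in>{..<N}. g (\<gamma> z (j mod i), t)))"
  have ipos: "i > 0" if "z \<in> A" for z
    using \<gamma>[OF that] set_pmf_not_empty[of "s z"] by (cases "i = 0") (auto simp: bij_betw_def)
  have \<gamma>_eval: "path_evaluation r (\<gamma> z (j mod i)) = z" if "z \<in> A" for z j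
    using bij_betwE[OF \<gamma>[OF that]] ipos[OF that] s_supp[of z] that A by auto
  have H: "continuous_map (prod_topology ?Z unit_interval) (symmetric_product N ErB) H"
    unfolding H_def
  proof (rule continuous_map_support_orbit)
    show "continuous_map ?Z (mtopology_of (fin_supp_measures l ?P)) s"
      by (rule continuous_map_from_subtopology[OF s])
    show "continuous_map (prod_topology (mtopology_of ?P) unit_interval) ErB g"
      unfolding g_def ErB_def by (rule continuous_map_path_contraction)
  qed (use \<gamma> i topZ in auto)
  \<comment> \<open>Every path in the support evaluates to \<open>z\<close>, so all \<open>N\<close>
    entries equal \<open>z\<close> at time 0.\<close>
  have H0: "H (z, 0) = symmetric_diagonal N z" if z: "z \<in> A" for z
  proof -
    have "g (\<gamma>', 0) = path_evaluation r \<gamma>'" for \<gamma>' by (simp add: g_def path_evaluation_def)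
    then show ?thesis by (simp add: H_def \<gamma>_eval[OF z] symmetric_diagonal_def)
  qed
  \<comment> \<open>At time 1 only the starting points remain. They all equal \<open>z 0\<close>,
    the first entry of the common evaluation, which exists because \<open>r > 0\<close>.\<close>
  have H1: "H (z, 1) = symmetric_diagonal N (fibrewise_diagonal r (z 0))" if z: "z \<in> A" for z
  proof -
    have "\<gamma> z (j mod i) 0 = z 0" for j
      using \<gamma>_eval[OF z, of j] r by (auto simp: path_evaluation_def dest: fun_cong[of _ _ 0])
    then show ?thesis by (simp add: H_def g_def symmetric_diagonal_def fibrewise_diagonal_def)
  qed
  have e0: "continuous_map ?Z (mtopology_of E) (\<lambda>z. z 0)"
    unfolding ErB_def fibrewise_power_def
    by (intro continuous_map_from_subtopology continuous_map_product_projection) (use r in simp)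
  let ?pb = "\<lambda>f. AS_pullback_cochain q ?Z f \<phi>"
  have map_cong: "?pb f = ?pb f'" if "\<And>z. z \<in> A \<Longrightarrow> f z = f' z" for f f'
  proof
    fix xs show "?pb f xs = ?pb f' xs"
    proof (cases "xs \<in> AS_tuples q ?Z")
      case True
      then have "map f xs = map f' xs" using that topZ by (auto simp: AS_tuples_def)
      then show ?thesis by (simp add: AS_pullback_cochain_def del: map_eq_conv)
    qed (simp add: AS_pullback_cochain_def)
  qed
  have hom: "(\<lambda>xs. ?pb (\<lambda>z. H (z, 1)) xs - ?pb (\<lambda>z. H (z, 0)) xs) \<in> AS_coboundaries q ?Z"
    by (rule AS_homotopy_invariance[OF _ H \<phi>])
      (simp add: ErB_def metrizable_space_subtopology metrizable_space_fibrewise_power)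
  have eq: "?pb (\<lambda>z. H (z, 1)) = AS_pullback_cochain q ?Z (\<lambda>z. z 0) (AS_pullback_cochain q (mtopology_of E) (fibrewise_diagonal r)
        (AS_pullback_cochain q ErB (symmetric_diagonal N) \<phi>))"
  proof
    fix xs
    show "?pb (\<lambda>z. H (z, 1)) xs = AS_pullback_cochain q ?Z (\<lambda>z. z 0) (AS_pullback_cochain q (mtopology_of E) (fibrewise_diagonal r)
        (AS_pullback_cochain q ErB (symmetric_diagonal N) \<phi>)) xs"
    proof (cases "xs \<in> AS_tuples q ?Z")
      case True
      then have xs: "set xs \<subseteq> A" "length xs = Suc q" using topZ by (auto simp: AS_tuples_def)
      have "map (\<lambda>z. z 0) xs \<in> AS_tuples q (mtopology_of E)"
        using xs topZ continuous_map_image_subset_topspace[OF e0] by (auto simp: AS_tuples_def)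
      moreover have "fibrewise_diagonal r e \<in> topspace ErB" if "e \<in> mspace E" for e
        using that by (auto simp: ErB_def fibrewise_power_def fibrewise_diagonal_def)
      ultimately have "map (fibrewise_diagonal r) (map (\<lambda>z. z 0) xs) \<in> AS_tuples q ErB"
        by (auto simp: AS_tuples_def)
      moreover have "map (\<lambda>z. H (z, 1)) xs = map (symmetric_diagonal N) (map (fibrewise_diagonal r) (map (\<lambda>z. z 0) xs))"
        using xs H1 by auto
      ultimately show ?thesis
        using True \<open>map (\<lambda>z. z 0) xs \<in> AS_tuples q (mtopology_of E)\<close>
        by (simp only: AS_pullback_cochain_def if_True)
    qed (simp add: AS_pullback_cochain_def)
  qed
  have "?pb (\<lambda>z. H (z, 1)) \<in> AS_coboundaries q ?Z"
    unfolding eq by (rule AS_pullback_coboundaries[OF e0 diagonal])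
  from AS_coboundaries_lincomb[OF this hom, of "-1"]
  have "?pb (\<lambda>z. H (z, 0)) \<in> AS_coboundaries q ?Z" by simp
  then show ?thesis using map_cong[of "\<lambda>z. H (z, 0)" "symmetric_diagonal N"] H0 by simp
qed

theorem theorem5p1:
  fixes E :: "'a metric" and B :: "'b topology" and p :: "'a \<Rightarrow> 'b" and b\<^sub>0 :: 'b
    and X\<^sub>E :: "'c topology" and X\<^sub>B :: "'d topology" and X\<^sub>F :: "'e topology"
    and F :: "'a topology" and ErB :: "(nat \<Rightarrow> 'a) topology"
    and r n :: nat and k :: "nat \<Rightarrow> nat"
    and \<alpha>s :: "nat \<Rightarrow> ((nat \<Rightarrow> nat \<Rightarrow> 'a) set list \<Rightarrow> 'r::comm_ring_1) set"
    and \<alpha> :: "nat \<Rightarrow> ((nat \<Rightarrow> 'a) list \<Rightarrow> 'r) set"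
  assumes fibration: "hurewicz_fibration (mtopology_of E) B p"
    and base_point: "b\<^sub>0 \<in> topspace B"
    and F: "F = subtopology (mtopology_of E) {e. p e = b\<^sub>0}"
    and path_connected: "path_connected_space (mtopology_of E)" "path_connected_space B"
      "path_connected_space F"
    and CW_type_E: "CW_complex X\<^sub>E" "mtopology_of E homotopy_equivalent_space X\<^sub>E"
    and CW_type_B: "CW_complex X\<^sub>B" "B homotopy_equivalent_space X\<^sub>B"
    and CW_type_F: "CW_complex X\<^sub>F" "F homotopy_equivalent_space X\<^sub>F"
    and r: "r \<ge> 2" and n: "n \<ge> 1"
    and ErB: "ErB = fibrewise_power r (mtopology_of E) p"
    and k: "\<And>i. i \<in> {1..n} \<Longrightarrow> k i \<ge> 1"
    and \<alpha>s: "\<And>i. i \<in> {1..n} \<Longrightarrow>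
      \<alpha>s i \<in> carrier (AS_cohomology (k i) (symmetric_product (fact n) ErB))"
    and \<alpha>: "\<And>i. i \<in> {1..n} \<Longrightarrow> \<alpha> i = AS_pullback (k i) ErB (symmetric_diagonal (fact n)) (\<alpha>s i)"
    and diagonal: "\<And>i. i \<in> {1..n} \<Longrightarrow>
      AS_pullback (k i) (mtopology_of E) (fibrewise_diagonal r) (\<alpha> i) =
        \<one>\<^bsub>AS_cohomology (k i) (mtopology_of E)\<^esub>"
    and product: "AS_cup_prod ErB k \<alpha> n \<noteq> \<one>\<^bsub>AS_cohomology (\<Sum>i=1..n. k i) ErB\<^esub>"
  shows "dTC r E p \<ge> enat n"
proof (rule ccontr)
  let ?P = "fibrewise_path_space E p" and ?\<delta> = "symmetric_diagonal (fact n)"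
  assume "\<not> dTC r E p \<ge> enat n"
  \<comment> \<open>A value below \<open>n\<close> provides a section by measures with at most
    \<open>m + 1 \<le> n\<close> support points.\<close>
  then obtain m where m: "m < n"
    "admits_section (fibrewise_measures (m + 1) ?P ErB (path_evaluation r)) ErB
       (fibrewise_measures_proj ErB (path_evaluation r))"
    unfolding dTC_def dsecat_def ErB[symmetric] not_le Inf_less_iff by auto
  then obtain s where s: "continuous_map ErB (fibrewise_measures (m + 1) ?P ErB (path_evaluation r)) s"
    "\<And>y. y \<in> topspace ErB \<Longrightarrow> fibrewise_measures_proj ErB (path_evaluation r) (s y) = y"
    unfolding admits_section_def by blast
  have s_cont: "continuous_map ErB (mtopology_of (fin_supp_measures (m + 1) ?P)) s"
    using s(1) unfolding fibrewise_measures_def by (simp add: continuous_map_in_subtopology)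
  have s_supp: "set_pmf (s y) \<subseteq> path_evaluation r -` {y}" if y: "y \<in> topspace ErB" for y
  proof -
    obtain x where x: "x \<in> topspace ErB" "set_pmf (s y) \<subseteq> {e \<in> mspace ?P. path_evaluation r e = x}"
      using s(1) y unfolding fibrewise_measures_def continuous_map_in_subtopology by blast
    then have "set_pmf (s y) \<subseteq> path_evaluation r -` {x}" by auto
    with fibrewise_measures_proj_eq[OF x(1) this] s(2)[OF y] show ?thesis by simp
  qed
  have s_card: "card (set_pmf (s y)) \<in> {1..n}" if y: "y \<in> topspace ErB" for y
  proof -
    have "s y \<in> mspace (fin_supp_measures (m + 1) ?P)"
      using continuous_map_image_subset_topspace[OF s_cont] y by auto
    then have "finite (set_pmf (s y))" "card (set_pmf (s y)) \<le> m + 1" by auto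
    then show ?thesis using m(1) by (simp add: Suc_le_eq card_gt_0_iff set_pmf_not_empty)
  qed
  \<comment> \<open>These strata are in general neither open nor closed; tautness applies to
    arbitrary subsets of a metrizable space.\<close>
  define A where "A i = {y \<in> topspace ErB. card (set_pmf (s y)) = i}" for i
  have ErB_metrizable: "metrizable_space ErB" unfolding ErB by (rule metrizable_space_fibrewise_power)
  have \<delta>: "continuous_map ErB (symmetric_product (fact n) ErB) ?\<delta>"
    by (rule continuous_map_symmetric_diagonal)
  have \<Delta>: "continuous_map (mtopology_of E) ErB (fibrewise_diagonal r)"
    by (auto simp: ErB fibrewise_power_def fibrewise_diagonal_def continuous_map_in_subtopology
        continuous_map_componentwise)
  define vanishing where "vanishing i \<phi> \<V> \<longleftrightarrow> \<phi> \<in> AS_cocycles (k i) ErB \<and> \<alpha> i = AS_class (k i) ErB \<phi> \<and>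
      (\<forall>V\<in>\<V>. openin ErB V) \<and> A i \<subseteq> \<Union>\<V> \<and>
      (\<forall>V\<in>\<V>. \<forall>xs. length xs = Suc (k i) \<longrightarrow> set xs \<subseteq> V \<longrightarrow> \<phi> xs = 0)" for i \<phi> \<V>
  \<comment> \<open>Since every number in \<open>{1..n}\<close> divides \<open>n!\<close>, each
    class is trivial on each stratum. Pairing class \<open>i\<close> with stratum \<open>i\<close>
    distributes the \<open>n\<close> strata over the \<open>n\<close> factors of the
    product.\<close>
  have "\<exists>\<phi> \<V>. vanishing i \<phi> \<V>" if i: "i \<in> {1..n}" for i
  proof -
    obtain \<phi> where \<phi>: "\<phi> \<in> AS_cocycles (k i) (symmetric_product (fact n) ErB)"
      "\<alpha>s i = AS_class (k i) (symmetric_product (fact n) ErB) \<phi>"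
      using \<alpha>s[OF i] by (auto simp: carrier_AS_cohomology)
    let ?\<phi> = "AS_pullback_cochain (k i) ErB ?\<delta> \<phi>"
    have \<alpha>_eq: "\<alpha> i = AS_class (k i) ErB ?\<phi>"
      by (simp add: \<alpha>[OF i] \<phi>(2) AS_pullback_class[OF \<delta>])
    have "AS_pullback_cochain (k i) (mtopology_of E) (fibrewise_diagonal r) ?\<phi> \<in> AS_coboundaries (k i) (mtopology_of E)"
      using diagonal[OF i] by (simp add: \<alpha>_eq AS_pullback_class[OF \<Delta>] AS_class_eq_one)
    moreover have "i dvd fact n" using i by (intro dvd_fact) auto
    ultimately have triv: "AS_pullback_cochain (k i) (subtopology ErB (A i)) ?\<delta> \<phi> \<in> AS_coboundaries (k i) (subtopology ErB (A i))"
      using r s_cont s_supp \<phi>(1) unfolding ErB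
      by (intro AS_symmetric_diagonal_on_stratum[where s = s and i = i]) (auto simp: A_def ErB)
    have "AS_pullback_cochain (k i) (subtopology ErB (A i)) id ?\<phi> = AS_pullback_cochain (k i) (subtopology ErB (A i)) ?\<delta> \<phi>"
      by (auto simp: AS_pullback_cochain_def AS_tuples_def)
    with triv have "AS_pullback_cochain (k i) (subtopology ErB (A i)) id ?\<phi> \<in> AS_coboundaries (k i) (subtopology ErB (A i))"
      by simp
    moreover have "A i \<subseteq> topspace ErB" by (auto simp: A_def)
    ultimately obtain \<phi>' \<V> where "\<phi>' \<in> AS_cocycles (k i) ErB"
      "AS_class (k i) ErB \<phi>' = AS_class (k i) ErB ?\<phi>" "\<And>V. V \<in> \<V> \<Longrightarrow> openin ErB V" "A i \<subseteq> \<Union>\<V>"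
      "\<And>V xs. \<lbrakk>V \<in> \<V>; length xs = Suc (k i); set xs \<subseteq> V\<rbrakk> \<Longrightarrow> \<phi>' xs = 0"
      using AS_tautness[OF ErB_metrizable _ AS_pullback_cocycle[OF \<delta> \<phi>(1)]] by metis
    then have "vanishing i \<phi>' \<V>" by (simp add: vanishing_def \<alpha>_eq)
    then show ?thesis by blast
  qed
  then obtain \<phi> \<V> where "\<And>i. i \<in> {1..n} \<Longrightarrow> vanishing i (\<phi> i) (\<V> i)" by metis
  note \<phi> = this[unfolded vanishing_def]
  have "topspace ErB \<subseteq> (\<Union>i\<in>{1..n}. \<Union>(\<V> i))"
  proof
    fix y assume y: "y \<in> topspace ErB"
    then have "y \<in> A (card (set_pmf (s y)))" by (simp add: A_def)
    moreover have "A (card (set_pmf (s y))) \<subseteq> \<Union>(\<V> (card (set_pmf (s y))))"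
      using \<phi>[OF s_card[OF y]] by simp
    ultimately show "y \<in> (\<Union>i\<in>{1..n}. \<Union>(\<V> i))" using s_card[OF y] by blast
  qed
  then have "AS_cup_prod ErB k \<alpha> n = \<one>\<^bsub>AS_cohomology (\<Sum>i=1..n. k i) ErB\<^esub>"
    by (rule AS_cup_prod_eq_one[of n \<phi> k ErB \<alpha> \<V>, rotated 3]) (use \<phi> in simp_all)
  with product show False by contradiction
qed

end
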